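(* Let $K$ be a CM number field, $F=K^+$ its real subfield, $[K:F]=2$, with Galois group $G=\mathrm{Gal}(K/F)=\langle\sigma\rangle$ generated by the complex conjugation $\sigma$ on $K$. Let $S_F$ be a finite set of primes of $F$ containing all infinite primes of $F$, and let $S_K$ be the set of primes of $K$ lying above those in $S_F$. If $\sharp S_F=\sharp S_K$ (for example, when every finite prime in $S_F$ is ramified or inert in $K$), then $$\sharp\mathrm{H}^1(G,\mathbf{U}_{K,S})=\frac{2}{(\mathbf{U}_{K,S}:\mathbf{U}_{F,S}\cdot\mathbf{W}_K)}=\frac{2}{(N\mathbf{U}_{K,S}:\mathbf{U}_{F,S}^2)}=2^{-r_{K,S}}\cdot(\mathbf{U}_{F,S}:N\mathbf{U}_{K,S}).$$ In particular, $(\mathbf{U}_{K,S}:\mathbf{U}_{F,S}\cdot\mathbf{W}_K)=(N\mathbf{U}_{K,S}:\mathbf{U}_{F,S}^2)\mid 2$, $\ \sharp\mathrm{H}^1(G,\mathbf{U}_{K,S})\mid 2$, and $(\mathbf{U}_{F,S}:N\mathbf{U}_{K,S})=2^{r_{K,S}}$ or $2^{r_{K,S}+1}$.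
   Context: A CM number field is a totally imaginary quadratic extension $K$ of a totally real number field $K^+$. $\sharp$ denotes cardinality; primes include the infinite ones. $\mathbf{U}_{K,S}$ is the (multiplicative) group of $S_K$-units of $K$, a $G$-module, and $\mathbf{U}_{F,S}$ is the group of $S_F$-units of $F$; $\mathbf{W}_K$ is the group of roots of unity in $K$. $N(\alpha)=N_{K/F}(\alpha)=\alpha\sigma(\alpha)$, $N\mathbf{U}_{K,S}=\{N(\alpha):\alpha\in\mathbf{U}_{K,S}\}$, $\mathbf{U}_{F,S}^2$ is the group of squares of elements of $\mathbf{U}_{F,S}$, and $r_{K,S}=\mathrm{rank}(\mathbf{U}_{K,S})=\sharp S_K-1$. *)

theory Defs
  imports Complex_Main "HOL-Computational_Algebra.Polynomial" "HOL-Algebra.Algebra"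
begin

text \<open>
  Number fields are subfields, finite over the rationals, of an arbitrary field of characteristic
  zero; the ambient field is a type, and HOL-Algebra is applied to the records below.
\<close>

definition ring_on :: "'a::comm_ring_1 set \<Rightarrow> 'a ring" where
  "ring_on A = \<lparr>carrier = A, monoid.mult = (*), one = 1, ring.zero = 0, add = (+)\<rparr>"

definition mult_group_on :: "'a::monoid_mult set \<Rightarrow> 'a monoid" where
  "mult_group_on U = \<lparr>carrier = U, monoid.mult = (*), one = 1\<rparr>"


section \<open>Group theory\<close>

definition subgroup_index :: "('a, 'm) monoid_scheme \<Rightarrow> 'a set \<Rightarrow> nat" where
  "subgroup_index A H = card (rcosets\<^bsub>A\<^esub> H)"

definition int_independent :: "('a, 'm) monoid_scheme \<Rightarrow> 'a set \<Rightarrow> bool" where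
  "int_independent A B \<longleftrightarrow> B \<subseteq> carrier A \<and> finite B \<and>
     (\<forall>c :: 'a \<Rightarrow> int. finprod A (\<lambda>b. b [^]\<^bsub>A\<^esub> c b) B = \<one>\<^bsub>A\<^esub> \<longrightarrow> (\<forall>b\<in>B. c b = 0))"

text \<open>
  The (torsion-free) rank of an abelian group. This is meaningful only if the sizes of independent
  sets are bounded, which is the case for finitely generated groups.
\<close>
definition abelian_rank :: "('a, 'm) monoid_scheme \<Rightarrow> nat" where
  "abelian_rank A = (GREATEST n. \<exists>B. int_independent A B \<and> card B = n)"

text \<open>
  First cohomology of a group \<open>G\<close> with values in a multiplicatively written \<open>G\<close>-module \<open>A\<close>, the
  action of \<open>g\<close> on \<open>a\<close> being \<open>act g a\<close>: crossed homomorphisms modulo principal ones.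
  Cocycles are extensional so that each one is counted only once.
\<close>
definition cocycles1 ::
  "('g, 'm) monoid_scheme \<Rightarrow> ('a, 'n) monoid_scheme \<Rightarrow> ('g \<Rightarrow> 'a \<Rightarrow> 'a) \<Rightarrow> ('g \<Rightarrow> 'a) set" where
  "cocycles1 G A act = {f \<in> carrier G \<rightarrow>\<^sub>E carrier A.
     \<forall>g\<in>carrier G. \<forall>h\<in>carrier G. f (g \<otimes>\<^bsub>G\<^esub> h) = f g \<otimes>\<^bsub>A\<^esub> act g (f h)}"

definition coboundaries1 ::
  "('g, 'm) monoid_scheme \<Rightarrow> ('a, 'n) monoid_scheme \<Rightarrow> ('g \<Rightarrow> 'a \<Rightarrow> 'a) \<Rightarrow> ('g \<Rightarrow> 'a) set" where
  "coboundaries1 G A act =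
     (\<lambda>a. \<lambda>g\<in>carrier G. act g a \<otimes>\<^bsub>A\<^esub> inv\<^bsub>A\<^esub> a) ` carrier A"

definition cocycle_group1 ::
  "('g, 'm) monoid_scheme \<Rightarrow> ('a, 'n) monoid_scheme \<Rightarrow> ('g \<Rightarrow> 'a \<Rightarrow> 'a) \<Rightarrow> ('g \<Rightarrow> 'a) monoid" where
  "cocycle_group1 G A act =
     \<lparr>carrier = cocycles1 G A act,
      monoid.mult = (\<lambda>f1 f2. \<lambda>g\<in>carrier G. f1 g \<otimes>\<^bsub>A\<^esub> f2 g),
      one = (\<lambda>g\<in>carrier G. \<one>\<^bsub>A\<^esub>)\<rparr>"

definition H1 ::
  "('g, 'm) monoid_scheme \<Rightarrow> ('a, 'n) monoid_scheme \<Rightarrow> ('g \<Rightarrow> 'a \<Rightarrow> 'a) \<Rightarrow> ('g \<Rightarrow> 'a) set monoid" where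
  "H1 G A act = cocycle_group1 G A act Mod coboundaries1 G A act"


section \<open>Number fields\<close>

definition number_field :: "'a::field_char_0 set \<Rightarrow> bool" where
  "number_field K \<longleftrightarrow> subfield K (ring_on UNIV) \<and> ring.finite_dimension (ring_on UNIV) \<rat> K"

text \<open>Embeddings are extensional on \<open>K\<close>, so that distinct ones differ on \<open>K\<close>.\<close>
definition embeddings :: "'a::field_char_0 set \<Rightarrow> ('a \<Rightarrow> complex) set" where
  "embeddings K = ring_hom (ring_on K) (ring_on UNIV) \<inter> extensional K"

definition totally_real :: "'a::field_char_0 set \<Rightarrow> bool" where
  "totally_real K \<longleftrightarrow> (\<forall>\<tau>\<in>embeddings K. \<tau> ` K \<subseteq> \<real>)"

definition totally_imaginary :: "'a::field_char_0 set \<Rightarrow> bool" where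
  "totally_imaginary K \<longleftrightarrow> (\<forall>\<tau>\<in>embeddings K. \<not> \<tau> ` K \<subseteq> \<real>)"

text \<open>\<open>K\<close> is a CM field with real subfield \<open>F\<close>.\<close>
definition CM_extension :: "'a::field_char_0 set \<Rightarrow> 'a set \<Rightarrow> bool" where
  "CM_extension K F \<longleftrightarrow>
     number_field K \<and> totally_imaginary K \<and>
     number_field F \<and> totally_real F \<and>
     subfield F (ring_on K) \<and> ring.dimension (ring_on K) 2 F K"

definition Gal :: "'a::field_char_0 set \<Rightarrow> 'a set \<Rightarrow> ('a \<Rightarrow> 'a) monoid" where
  "Gal K F = (BijGroup K)
     \<lparr>carrier := {s \<in> Bij K. s \<in> ring_hom (ring_on K) (ring_on K) \<and> (\<forall>x\<in>F. s x = x)}\<rparr>"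

text \<open>The automorphism induced by complex conjugation under every complex embedding.\<close>
definition complex_conjugation :: "'a::field_char_0 set \<Rightarrow> 'a set \<Rightarrow> ('a \<Rightarrow> 'a) \<Rightarrow> bool" where
  "complex_conjugation K F \<sigma> \<longleftrightarrow>
     \<sigma> \<in> carrier (Gal K F) \<and> (\<forall>\<tau>\<in>embeddings K. \<forall>x\<in>K. \<tau> (\<sigma> x) = cnj (\<tau> x))"

definition roots_of_unity :: "'a::field_char_0 set \<Rightarrow> 'a set" where
  "roots_of_unity K = {x \<in> K. \<exists>n>0. x ^ n = 1}"

definition ring_of_integers :: "'a::field_char_0 set \<Rightarrow> 'a set" where
  "ring_of_integers K = {x \<in> K. algebraic_int x}"


section \<open>Primes and S-units\<close>

text \<open>
  A finite prime is given by its prime ideal, an infinite one by the class of an embedding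
  under complex conjugation.
\<close>
datatype 'a prime_of_field = Finite_Prime "'a set" | Infinite_Prime "('a \<Rightarrow> complex) set"

definition finite_primes :: "'a::field_char_0 set \<Rightarrow> 'a prime_of_field set" where
  "finite_primes K =
     {Finite_Prime P | P. primeideal P (ring_on (ring_of_integers K)) \<and> P \<noteq> {0}}"

definition infinite_primes :: "'a::field_char_0 set \<Rightarrow> 'a prime_of_field set" where
  "infinite_primes K =
     {Infinite_Prime {\<tau>, \<lambda>x\<in>K. cnj (\<tau> x)} | \<tau>. \<tau> \<in> embeddings K}"

definition primes_of_field :: "'a::field_char_0 set \<Rightarrow> 'a prime_of_field set" where
  "primes_of_field K = finite_primes K \<union> infinite_primes K"

text \<open>For prime ideals \<open>P\<close> of a larger field, \<open>P \<inter> F\<close> is the contraction to the integers of \<open>F\<close>.\<close>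
fun prime_below :: "'a::field_char_0 set \<Rightarrow> 'a prime_of_field \<Rightarrow> 'a prime_of_field" where
  "prime_below F (Finite_Prime P) = Finite_Prime (P \<inter> F)"
| "prime_below F (Infinite_Prime T) = Infinite_Prime ((\<lambda>\<tau>. restrict \<tau> F) ` T)"

definition primes_above ::
  "'a::field_char_0 set \<Rightarrow> 'a set \<Rightarrow> 'a prime_of_field set \<Rightarrow> 'a prime_of_field set" where
  "primes_above K F S = {Q \<in> primes_of_field K. prime_below F Q \<in> S}"

definition integers_localized_at :: "'a::field_char_0 set \<Rightarrow> 'a set \<Rightarrow> 'a set" where
  "integers_localized_at K P =
     {a / b | a b. a \<in> ring_of_integers K \<and> b \<in> ring_of_integers K - P}"

definition S_integers :: "'a::field_char_0 set \<Rightarrow> 'a prime_of_field set \<Rightarrow> 'a set" where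
  "S_integers K S =
     {x \<in> K. \<forall>P. Finite_Prime P \<in> finite_primes K - S \<longrightarrow> x \<in> integers_localized_at K P}"

definition S_units :: "'a::field_char_0 set \<Rightarrow> 'a prime_of_field set \<Rightarrow> 'a set" where
  "S_units K S = Units (ring_on (S_integers K S))"

end

theory Submission
  imports Defs "Jordan_Normal_Form.Char_Poly"
begin

text \<open>
  Write \<open>U\<^sub>K\<close>, \<open>U\<^sub>F\<close> for the two groups of S-units, \<open>W\<close> for the roots of unity of \<open>K\<close> and \<open>N x = x * \<sigma> x\<close>.
  Two facts about S-units carry the theorem; the rest is a comparison of indices.

  The first is that \<open>\<sigma> x / x\<close> is a root of unity for every \<open>x \<in> U\<^sub>K\<close>
  (\<open>quotient_by_conjugate_root_of_unity\<close>). Every prime in \<open>S\<^sub>F\<close> has a prime of \<open>K\<close> above it, so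
  equality of the cardinalities makes the prime above unique, and \<open>\<sigma>\<close> fixes every finite prime
  in \<open>S\<^sub>K\<close>. At such a prime \<open>\<sigma> x\<close> and \<open>x\<close> have the same valuation, and at the other primes both are
  units. Hence \<open>\<sigma> x / x\<close> is an algebraic integer, all its conjugates have absolute value 1, and
  Kronecker's theorem applies. In particular the kernel of \<open>N\<close> on \<open>U\<^sub>K\<close> is \<open>W\<close>. Since the Galois
  group is cyclic of order 2, a cocycle is determined by its value at \<open>\<sigma>\<close>, an element of norm 1,
  and \<open>H\<^sup>1\<close> is the quotient of \<open>W\<close> by the group \<open>B\<close> of all \<open>\<sigma> x / x\<close> (\<open>order_H1\<close>). Now \<open>W\<^sup>2 \<subseteq> B \<subseteq> W\<close>, the
  index of \<open>W\<^sup>2\<close> in \<open>W\<close> is 2, and \<open>x \<mapsto> \<sigma> x / x\<close> induces an isomorphism of \<open>U\<^sub>K / U\<^sub>F W\<close> with \<open>B / W\<^sup>2\<close>; this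
  gives \<open>#H\<^sup>1 (U\<^sub>K : U\<^sub>F W) = 2\<close>. In the same way \<open>N\<close> identifies \<open>U\<^sub>K / U\<^sub>F W\<close> with \<open>N U\<^sub>K / U\<^sub>F\<^sup>2\<close>.

  The second fact is that \<open>U\<^sub>F\<close> is finitely generated. As \<open>1\<close> and \<open>- 1\<close> are its only elements with
  square 1, this implies \<open>(U\<^sub>F : U\<^sub>F\<^sup>2) = 2 ^ (r + 1)\<close> (\<open>S_units_finitely_generated\<close>,
  \<open>subgroup_index_squares\<close>) with \<open>r\<close> the rank of \<open>U\<^sub>F\<close>, which is also the rank of \<open>U\<^sub>K\<close>, because
  \<open>x\<^sup>2 = N x / (\<sigma> x / x)\<close> has a power in \<open>U\<^sub>F\<close>. As \<open>(U\<^sub>F : N U\<^sub>K) (N U\<^sub>K : U\<^sub>F\<^sup>2) = (U\<^sub>F : U\<^sub>F\<^sup>2)\<close>, the last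
  equality follows. For finite generation, the logarithms of the absolute values together with
  the valuations at the primes in \<open>S\<^sub>F\<close> map \<open>U\<^sub>F\<close> to a finite-dimensional real space so that only
  finitely many elements land in a bounded set, by Northcott's theorem
  (\<open>finite_bounded_algebraic_ints\<close>), and such a group is finitely generated
  (\<open>finitely_generated_of_discrete_log\<close>).

  The valuations are obtained directly from integer relations. If \<open>c\<^sub>n x\<^sup>n + \<dots> + c\<^sub>0 = 0\<close> with
  coprime integers \<open>c\<^sub>i\<close>, then the partial Horner sums \<open>c\<^sub>n x\<^sup>i + \<dots> + c\<^bsub>n - i\<^esub>\<close> are algebraic integers,
  and writing \<open>x\<close> and its inverse as quotients of them shows that the localisation of the ring
  of integers at any prime is a valuation ring (\<open>localized_valuation\<close>). Comparing the valuations
  of the terms of such a relation shows that a bounded power of \<open>x\<close> is, up to a unit, a power of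
  the prime number below (\<open>prime_ideal_valuation\<close>).
\<close>

\<comment> \<open>Names of polynomial operations refer to the type \<open>poly\<close> below.\<close>
hide_const (open) Polynomials.degree Polynomials.lead_coeff UnivPoly.coeff UnivPoly.monom
  up_ring.coeff up_ring.monom module.smult

section \<open>The ring of algebraic integers\<close>

text \<open>
  Multiplication by \<open>z\<close> is given on the \<open>v i\<close> by an integer matrix with eigenvalue \<open>z\<close>, so \<open>z\<close> is a
  root of the characteristic polynomial, which is monic with integer coefficients. That the
  algebraic integers form a ring, and the integrality of partial Horner sums, both come from
  this criterion.
\<close>

lemma algebraic_int_of_stable_int_span:
  fixes z :: "'a::field_char_0" and v :: "'i \<Rightarrow> 'a"
  assumes fin: "finite I" and nz: "i0 \<in> I" "v i0 \<noteq> 0"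
    and stable: "\<And>i. i \<in> I \<Longrightarrow> \<exists>c::'i \<Rightarrow> int. z * v i = (\<Sum>j\<in>I. of_int (c j) * v j)"
  shows "algebraic_int z"
proof -
  define n where "n = card I"
  obtain e where e: "bij_betw e {0..<n} I"
    using ex_bij_betw_nat_finite[OF fin] unfolding n_def by blast
  obtain c :: "'i \<Rightarrow> 'i \<Rightarrow> int" where c: "\<And>i. i \<in> I \<Longrightarrow> z * v i = (\<Sum>j\<in>I. of_int (c i j) * v j)"
    using stable by metis
  define A :: "int mat" where "A = mat n n (\<lambda>(i,j). c (e i) (e j))"
  define w :: "'a vec" where "w = vec n (\<lambda>i. v (e i))"
  have A: "A \<in> carrier_mat n n" unfolding A_def by simp
  have mA: "map_mat (of_int :: int \<Rightarrow> 'a) A \<in> carrier_mat n n" using A by simp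
  have "map_mat of_int A *\<^sub>v w = z \<cdot>\<^sub>v w"
  proof (rule eq_vecI)
    fix i assume "i < dim_vec (z \<cdot>\<^sub>v w)"
    then have i: "i < n" by (simp add: w_def)
    then have ei: "e i \<in> I" using e by (auto simp: bij_betw_def)
    have "(map_mat of_int A *\<^sub>v w) $ i = (\<Sum>j = 0..<n. of_int (c (e i) (e j)) * v (e j))"
      using i by (simp add: A_def w_def scalar_prod_def)
    also have "\<dots> = (\<Sum>j\<in>I. of_int (c (e i) j) * v j)"
      by (rule sum.reindex_bij_betw[OF e])
    also have "\<dots> = z * v (e i)" using c[OF ei] by simp
    finally show "(map_mat of_int A *\<^sub>v w) $ i = (z \<cdot>\<^sub>v w) $ i" using i by (simp add: w_def)
  qed (simp add: w_def A_def)
  moreover have "w \<noteq> 0\<^sub>v n"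
  proof
    assume "w = 0\<^sub>v n"
    moreover obtain i where i: "i < n" "e i = i0" using e nz(1) by (auto simp: bij_betw_def image_iff)
    ultimately have "w $ i = 0" by simp
    moreover have "w $ i = v i0" using i by (simp add: w_def)
    ultimately have "v i0 = 0" by simp
    with nz show False by simp
  qed
  ultimately have "eigenvalue (map_mat (of_int :: int \<Rightarrow> 'a) A) z"
    unfolding eigenvalue_def eigenvector_def using mA by (auto intro!: exI[of _ w] simp: w_def A_def)
  then have "poly (char_poly (map_mat (of_int :: int \<Rightarrow> 'a) A)) z = 0"
    using eigenvalue_root_char_poly[OF mA] by simp
  then have "poly (map_poly of_int (char_poly A)) z = 0"
    by (simp add: of_int_hom.char_poly_hom[OF A])
  moreover have "lead_coeff (char_poly A) = 1" using degree_monic_char_poly[OF A] by simp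
  ultimately show ?thesis unfolding algebraic_int_altdef_ipoly by blast
qed

lemma power_as_lower_powers:
  fixes x :: "'a::field_char_0"
  assumes "algebraic_int x"
  obtains n and a :: "nat \<Rightarrow> int" where "n > 0" "x ^ n = (\<Sum>i<n. of_int (a i) * x ^ i)"
proof -
  obtain p :: "int poly" where p: "poly (map_poly of_int p) x = 0" "lead_coeff p = 1"
    using assms unfolding algebraic_int_altdef_ipoly by blast
  have d: "degree p > 0"
  proof (rule ccontr)
    assume "\<not> ?thesis"
    then obtain c where "p = [:c:]" by (meson degree_eq_zeroE gr0I)
    then show False using p by auto
  qed
  have "0 = (\<Sum>i\<le>degree p. of_int (coeff p i) * x ^ i)"
    using p(1) by (simp add: poly_altdef degree_map_poly)
  also have "\<dots> = of_int (coeff p (degree p)) * x ^ degree p + (\<Sum>i<degree p. of_int (coeff p i) * x ^ i)"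
    by (simp add: lessThan_Suc_atMost[symmetric] add.commute)
  finally have "x ^ degree p = (\<Sum>i<degree p. of_int (- coeff p i) * x ^ i)"
    using p(2) by (simp add: sum_negf eq_neg_iff_add_eq_0)
  with d show thesis by (rule that)
qed

text \<open>
  If \<open>x ^ m\<close> and \<open>y ^ n\<close> are integral combinations of lower powers, this group is stable under
  multiplication by \<open>x\<close> and by \<open>y\<close>, hence under multiplication by their sum and their product.
\<close>

definition monomial_span :: "'a::field_char_0 \<Rightarrow> 'a \<Rightarrow> nat \<Rightarrow> nat \<Rightarrow> 'a set" where
  "monomial_span x y m n =
     {\<Sum>p\<in>{..<m} \<times> {..<n}. of_int (c p) * (x ^ fst p * y ^ snd p) | c :: nat \<times> nat \<Rightarrow> int. True}"

lemma monomial_spanI: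
  fixes c :: "nat \<times> nat \<Rightarrow> int"
  shows "(\<Sum>p\<in>{..<m} \<times> {..<n}. of_int (c p) * (x ^ fst p * y ^ snd p)) \<in> monomial_span x y m n"
  unfolding monomial_span_def by blast

lemma monomial_span_add: "u \<in> monomial_span x y m n \<Longrightarrow> w \<in> monomial_span x y m n \<Longrightarrow> u + w \<in> monomial_span x y m n"
proof -
  assume "u \<in> monomial_span x y m n" "w \<in> monomial_span x y m n"
  then obtain c d :: "nat \<times> nat \<Rightarrow> int" where "u = (\<Sum>p\<in>{..<m} \<times> {..<n}. of_int (c p) * (x ^ fst p * y ^ snd p))"
    "w = (\<Sum>p\<in>{..<m} \<times> {..<n}. of_int (d p) * (x ^ fst p * y ^ snd p))"
    unfolding monomial_span_def by blast
  then have "u + w = (\<Sum>p\<in>{..<m} \<times> {..<n}. of_int (c p + d p) * (x ^ fst p * y ^ snd p))"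
    by (simp add: sum.distrib algebra_simps)
  then show ?thesis using monomial_spanI[of "\<lambda>p. c p + d p" x y m n] by simp
qed

lemma monomial_span_scale: "u \<in> monomial_span x y m n \<Longrightarrow> of_int k * u \<in> monomial_span x y m n"
proof -
  assume "u \<in> monomial_span x y m n"
  then obtain c :: "nat \<times> nat \<Rightarrow> int" where "u = (\<Sum>p\<in>{..<m} \<times> {..<n}. of_int (c p) * (x ^ fst p * y ^ snd p))"
    unfolding monomial_span_def by blast
  then have "of_int k * u = (\<Sum>p\<in>{..<m} \<times> {..<n}. of_int (k * c p) * (x ^ fst p * y ^ snd p))"
    by (simp add: sum_distrib_left algebra_simps)
  then show ?thesis using monomial_spanI[of "\<lambda>p. k * c p" x y m n] by simp
qed

lemma monomial_span_sum:
  "finite J \<Longrightarrow> (\<And>j. j \<in> J \<Longrightarrow> f j \<in> monomial_span x y m n) \<Longrightarrow> sum f J \<in> monomial_span x y m n"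
proof (induction J rule: finite_induct)
  case empty
  show ?case using monomial_spanI[of "\<lambda>_. 0" x y m n] by simp
qed (auto intro: monomial_span_add)

lemma monomial_in_span: "i < m \<Longrightarrow> j < n \<Longrightarrow> x ^ i * y ^ j \<in> monomial_span x y m n"
proof -
  assume "i < m" "j < n"
  then have "x ^ i * y ^ j =
      (\<Sum>p\<in>{..<m} \<times> {..<n}. of_int (if p = (i,j) then 1 else 0) * (x ^ fst p * y ^ snd p))"
    by (subst sum.mono_neutral_cong_right[where S = "{(i,j)}" and h = "\<lambda>p. x ^ fst p * y ^ snd p"]) auto
  then show ?thesis using monomial_spanI[of "\<lambda>p. if p = (i,j) then 1 else 0" x y m n] by simp
qed

lemma monomial_span_mult_left:
  assumes x: "m > 0" "x ^ m = (\<Sum>i<m. of_int (a i) * x ^ i)" and u: "u \<in> monomial_span x y m n"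
  shows "x * u \<in> monomial_span x y m n"
proof -
  have step: "x * (x ^ i * y ^ j) \<in> monomial_span x y m n" if "i < m" "j < n" for i j
  proof (cases "Suc i < m")
    case True
    then show ?thesis using monomial_in_span[OF True that(2), of x y] by (simp add: mult.assoc)
  next
    case False
    then have "Suc i = m" using that by simp
    then have "x * (x ^ i * y ^ j) = x ^ m * y ^ j" by (auto simp: algebra_simps)
    also have "\<dots> = (\<Sum>i<m. of_int (a i) * (x ^ i * y ^ j))"
      unfolding x(2) by (simp add: sum_distrib_right sum_distrib_left algebra_simps)
    also have "\<dots> \<in> monomial_span x y m n"
      using that by (intro monomial_span_sum monomial_span_scale monomial_in_span) auto
    finally show ?thesis .
  qed
  obtain c :: "nat \<times> nat \<Rightarrow> int" where "u = (\<Sum>p\<in>{..<m} \<times> {..<n}. of_int (c p) * (x ^ fst p * y ^ snd p))"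
    using u unfolding monomial_span_def by blast
  then have "x * u = (\<Sum>p\<in>{..<m} \<times> {..<n}. of_int (c p) * (x * (x ^ fst p * y ^ snd p)))"
    by (simp add: sum_distrib_left algebra_simps)
  also have "\<dots> \<in> monomial_span x y m n"
    by (intro monomial_span_sum monomial_span_scale step) auto
  finally show ?thesis .
qed

lemma monomial_span_swap: "monomial_span x y m n = monomial_span y x n m"
proof -
  have "monomial_span x y m n \<subseteq> monomial_span y x n m" for x y :: 'a and m n
  proof
    fix u assume "u \<in> monomial_span x y m n"
    then obtain c :: "nat \<times> nat \<Rightarrow> int" where "u = (\<Sum>p\<in>{..<m} \<times> {..<n}. of_int (c p) * (x ^ fst p * y ^ snd p))"
      unfolding monomial_span_def by blast
    also have "\<dots> = (\<Sum>p\<in>{..<m} \<times> {..<n}. of_int (c p) * (y ^ snd p * x ^ fst p))"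
      by (simp add: mult.commute)
    also have "\<dots> \<in> monomial_span y x n m"
      by (intro monomial_span_sum monomial_span_scale monomial_in_span) auto
    finally show "u \<in> monomial_span y x n m" .
  qed
  then show ?thesis by blast
qed

lemma algebraic_int_add_times:
  fixes x y :: "'a::field_char_0"
  assumes "algebraic_int x" "algebraic_int y"
  shows algebraic_int_add: "algebraic_int (x + y)" and algebraic_int_times: "algebraic_int (x * y)"
proof -
  obtain m and a :: "nat \<Rightarrow> int" where m: "m > 0" "x ^ m = (\<Sum>i<m. of_int (a i) * x ^ i)"
    using assms(1) by (rule power_as_lower_powers)
  obtain n and b :: "nat \<Rightarrow> int" where n: "n > 0" "y ^ n = (\<Sum>i<n. of_int (b i) * y ^ i)"
    using assms(2) by (rule power_as_lower_powers)
  have alg: "algebraic_int z"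
    if z: "\<And>u. u \<in> monomial_span x y m n \<Longrightarrow> z * u \<in> monomial_span x y m n" for z
  proof (rule algebraic_int_of_stable_int_span)
    show "finite ({..<m} \<times> {..<n})" "(0,0) \<in> {..<m} \<times> {..<n}" using m n by auto
    show "x ^ fst (0::nat,0::nat) * y ^ snd (0::nat,0::nat) \<noteq> 0" by simp
    fix p :: "nat \<times> nat" assume "p \<in> {..<m} \<times> {..<n}"
    then have "z * (x ^ fst p * y ^ snd p) \<in> monomial_span x y m n"
      by (intro z monomial_in_span) auto
    then show "\<exists>c::nat \<times> nat \<Rightarrow> int. z * (x ^ fst p * y ^ snd p) =
        (\<Sum>j\<in>{..<m} \<times> {..<n}. of_int (c j) * (x ^ fst j * y ^ snd j))"
      unfolding monomial_span_def by blast
  qed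
  have X: "x * u \<in> monomial_span x y m n" if "u \<in> monomial_span x y m n" for u
    using monomial_span_mult_left[OF m that] .
  have Y: "y * u \<in> monomial_span x y m n" if "u \<in> monomial_span x y m n" for u
    using monomial_span_mult_left[OF n] that by (simp add: monomial_span_swap[of x y])
  show "algebraic_int (x + y)" "algebraic_int (x * y)"
    by (rule alg, simp add: distrib_right mult.assoc X Y monomial_span_add)+
qed

lemma algebraic_int_diff: "algebraic_int (x::'a::field_char_0) \<Longrightarrow> algebraic_int y \<Longrightarrow> algebraic_int (x - y)"
  using algebraic_int_add[of x "- y"] by simp

lemma algebraic_int_pow: "algebraic_int (x::'a::field_char_0) \<Longrightarrow> algebraic_int (x ^ n)"
  by (induction n) (auto intro: algebraic_int_times)

text \<open>
  With \<open>c\<^sub>n, \<dots>, c\<^sub>0\<close> the coefficients, the number \<open>b\<^sub>i = c\<^sub>n x\<^sup>i + \<dots> + c\<^bsub>n - i\<^esub>\<close> maps the group generated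
  by \<open>1, x, \<dots>, x\<^bsup>n - 1\<^esup>\<close> to itself. The product \<open>b\<^sub>i x\<^sup>j\<close> is visibly in this group if \<open>i + j < n\<close>;
  otherwise it is a multiple of \<open>x\<^bsup>n - i\<^esup> b\<^sub>i\<close>, which the relation turns into the negative of the
  sum of the terms of degree below \<open>n - i\<close>.
\<close>

lemma algebraic_int_partial_horner:
  fixes x :: "'a::field_char_0" and p :: "int poly"
  assumes root: "poly (map_poly of_int p) x = 0" and i: "i \<le> degree p"
  shows "algebraic_int (\<Sum>k\<le>i. of_int (coeff p (degree p - k)) * x ^ (i - k))" (is "algebraic_int ?b")
proof (cases "degree p = 0")
  case True
  then show ?thesis using i by (auto intro: int_imp_algebraic_int)
next
  case False
  define n where "n = degree p"
  have root': "(\<Sum>k\<le>n. of_int (coeff p k) * x ^ k) = 0"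
    using root by (simp add: poly_altdef degree_map_poly n_def)
  have b: "?b = (\<Sum>l=n-i..n. of_int (coeff p l) * x ^ (l - (n - i)))"
    using i unfolding n_def[symmetric]
    by (intro sum.reindex_bij_witness[where i = "\<lambda>l. n - l" and j = "\<lambda>k. n - k"]) (auto simp: n_def)
  show ?thesis
  proof (rule algebraic_int_of_stable_int_span[where I = "{..<n}" and v = "\<lambda>j. x ^ j" and ?i0.0 = 0])
    fix j assume "j \<in> {..<n}"
    then have j: "j < n" by simp
    have coll: "\<exists>c::nat \<Rightarrow> int. (\<Sum>l\<in>L. of_int (d l) * x ^ g l) = (\<Sum>k<n. of_int (c k) * x ^ k)"
      if "finite L" "\<And>l. l \<in> L \<Longrightarrow> g l < n" for L :: "nat set" and d :: "nat \<Rightarrow> int" and g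
    proof (intro exI)
      have "(\<Sum>l\<in>L. of_int (d l) * x ^ g l) = (\<Sum>k<n. \<Sum>l\<in>{l \<in> L. g l = k}. of_int (d l) * x ^ g l)"
        using that by (intro sum.group[symmetric]) auto
      also have "\<dots> = (\<Sum>k<n. of_int (\<Sum>l\<in>{l \<in> L. g l = k}. d l) * x ^ k)"
        by (simp add: sum_distrib_right)
      finally show "(\<Sum>l\<in>L. of_int (d l) * x ^ g l) = (\<Sum>k<n. of_int (\<Sum>l\<in>{l \<in> L. g l = k}. d l) * x ^ k)" .
    qed
    show "\<exists>c::nat \<Rightarrow> int. ?b * x ^ j = (\<Sum>k\<in>{..<n}. of_int (c k) * x ^ k)"
    proof (cases "i + j < n")
      case True
      have "?b * x ^ j = (\<Sum>l=n-i..n. of_int (coeff p l) * x ^ (l - (n - i) + j))"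
        unfolding b sum_distrib_right
        by (intro sum.cong refl) (simp only: power_add mult.assoc)
      moreover have "\<And>l. l \<in> {n-i..n} \<Longrightarrow> l - (n - i) + j < n" using True by auto
      ultimately show ?thesis using coll[of "{n-i..n}" "\<lambda>l. l - (n - i) + j" "coeff p"] by simp
    next
      case False
      have ni: "n - i \<le> j" "i \<le> n" using False i by (auto simp: n_def)
      have split: "(\<Sum>k\<le>n. of_int (coeff p k) * x ^ k) =
          (\<Sum>k<n-i. of_int (coeff p k) * x ^ k) + (\<Sum>l=n-i..n. of_int (coeff p l) * x ^ l)"
        using ni by (subst sum.union_disjoint[symmetric]) (auto intro!: sum.cong)
      have "x ^ (n - i) * ?b = (\<Sum>l=n-i..n. of_int (coeff p l) * x ^ l)"
        unfolding b sum_distrib_left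
        by (intro sum.cong refl) (simp add: mult.left_commute flip: power_add)
      also have "\<dots> = (\<Sum>k<n-i. of_int (- coeff p k) * x ^ k)"
        using root' split by (simp add: sum_negf eq_neg_iff_add_eq_0 add.commute)
      finally have "x ^ (j - (n - i)) * (x ^ (n - i) * ?b) =
          (\<Sum>k<n-i. of_int (- coeff p k) * x ^ (k + (j - (n - i))))"
        by (simp add: sum_distrib_left power_add algebra_simps)
      moreover have "x ^ (j - (n - i)) * (x ^ (n - i) * ?b) = ?b * x ^ j"
        using ni by (simp add: mult.assoc[symmetric] flip: power_add)
      ultimately show ?thesis
        using coll[of "{..<n-i}" "\<lambda>k. k + (j - (n - i))" "\<lambda>k. - coeff p k"] j ni by auto
    qed
  qed (use False in \<open>auto simp: n_def\<close>)
qed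

section \<open>Multiplicative groups in a field\<close>

text \<open>
  All groups below consist of nonzero elements of one field, so a bare set suffices to name a
  group.
\<close>

definition mult_subgroup :: "'a::field set \<Rightarrow> bool" where
  "mult_subgroup A \<longleftrightarrow> 1 \<in> A \<and> 0 \<notin> A \<and> (\<forall>x\<in>A. \<forall>y\<in>A. x * y \<in> A) \<and> (\<forall>x\<in>A. inverse x \<in> A)"

lemma mult_subgroupD:
  assumes "mult_subgroup A"
  shows "1 \<in> A" "0 \<notin> A" "x \<in> A \<Longrightarrow> y \<in> A \<Longrightarrow> x * y \<in> A" "x \<in> A \<Longrightarrow> inverse x \<in> A"
    "x \<in> A \<Longrightarrow> y \<in> A \<Longrightarrow> x / y \<in> A" "x \<in> A \<Longrightarrow> x \<noteq> 0"
  using assms by (auto simp: mult_subgroup_def divide_inverse)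

lemma mult_subgroup_power: "mult_subgroup A \<Longrightarrow> x \<in> A \<Longrightarrow> x ^ n \<in> A"
  by (induction n) (auto simp: mult_subgroup_def)

lemma mult_subgroup_powi: "mult_subgroup A \<Longrightarrow> x \<in> A \<Longrightarrow> x powi k \<in> A"
  by (auto simp: power_int_def mult_subgroup_power mult_subgroupD)

lemma mult_subgroup_prod:
  "mult_subgroup A \<Longrightarrow> (\<And>i. i \<in> J \<Longrightarrow> f i \<in> A) \<Longrightarrow> prod f J \<in> A"
  by (induction J rule: infinite_finite_induct) (auto simp: mult_subgroup_def)

lemma comm_group_mult_group_on: "mult_subgroup A \<Longrightarrow> comm_group (mult_group_on A)"
proof (rule comm_groupI)
  fix x assume A: "mult_subgroup A" and "x \<in> carrier (mult_group_on A)"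
  then have "inverse x \<in> A" "x \<noteq> 0" by (auto simp: mult_group_on_def mult_subgroup_def)
  then show "\<exists>y\<in>carrier (mult_group_on A). y \<otimes>\<^bsub>mult_group_on A\<^esub> x = \<one>\<^bsub>mult_group_on A\<^esub>"
    by (intro bexI[of _ "inverse x"]) (auto simp: mult_group_on_def)
qed (auto simp: mult_group_on_def mult_subgroup_def mult_ac)

lemma mult_group_on_simps [simp]:
  "carrier (mult_group_on A) = A" "x \<otimes>\<^bsub>mult_group_on A\<^esub> y = x * y" "\<one>\<^bsub>mult_group_on A\<^esub> = 1"
  by (simp_all add: mult_group_on_def)

lemma inv_mult_group_on:
  assumes "mult_subgroup A" "x \<in> A"
  shows "inv\<^bsub>mult_group_on A\<^esub> x = inverse x"
proof -
  interpret comm_group "mult_group_on A" by (rule comm_group_mult_group_on) fact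
  show ?thesis using assms by (intro inv_equality) (auto simp: mult_subgroupD)
qed

lemma int_pow_mult_group_on:
  assumes A: "mult_subgroup A" and x: "x \<in> A"
  shows "x [^]\<^bsub>mult_group_on A\<^esub> (k::int) = x powi k"
proof -
  interpret comm_group "mult_group_on A" by (rule comm_group_mult_group_on) fact
  have nat: "x [^]\<^bsub>mult_group_on A\<^esub> (n::nat) = x ^ n" for n
    by (induction n) (auto simp: mult.commute)
  show ?thesis
    using assms by (auto simp: int_pow_def2 nat power_int_def inv_mult_group_on mult_subgroup_power power_inverse)
qed

lemma finprod_mult_group_on:
  assumes A: "mult_subgroup A" and f: "\<And>i. i \<in> J \<Longrightarrow> f i \<in> A" "finite J"
  shows "finprod (mult_group_on A) f J = prod f J"
proof -
  interpret comm_group "mult_group_on A" by (rule comm_group_mult_group_on) fact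
  show ?thesis using f(2,1) by (induction J rule: finite_induct) (auto simp: finprod_insert Pi_def)
qed

section \<open>Indices of subgroups\<close>

definition coset_of :: "'a::field set \<Rightarrow> 'a \<Rightarrow> 'a set" where
  "coset_of H a = (\<lambda>h. h * a) ` H"

lemma rcosets_mult_group_on: "rcosets\<^bsub>mult_group_on A\<^esub> H = coset_of H ` A"
  by (auto simp: RCOSETS_def r_coset_def coset_of_def)

lemma coset_of_eq_iff:
  assumes "mult_subgroup H" "a \<noteq> 0" "b \<noteq> 0"
  shows "coset_of H a = coset_of H b \<longleftrightarrow> a / b \<in> H"
proof
  assume "coset_of H a = coset_of H b"
  then have "1 * a \<in> coset_of H b" using assms by (auto simp: coset_of_def mult_subgroup_def)
  then show "a / b \<in> H" using assms by (auto simp: coset_of_def)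
next
  assume ab: "a / b \<in> H"
  have "coset_of H a \<subseteq> coset_of H b" if "a / b \<in> H" "a \<noteq> 0" "b \<noteq> 0" for a b
  proof
    fix x assume "x \<in> coset_of H a"
    then obtain h where "h \<in> H" "x = h * a" by (auto simp: coset_of_def)
    then have "h * (a / b) \<in> H" using that assms by (intro mult_subgroupD(3))
    moreover have "x = h * (a / b) * b" using \<open>x = h * a\<close> that by simp
    ultimately show "x \<in> coset_of H b" unfolding coset_of_def by (rule rev_image_eqI)
  qed
  moreover have "b / a \<in> H" using mult_subgroupD(4)[OF assms(1) ab] by simp
  ultimately show "coset_of H a = coset_of H b" using ab assms by blast
qed

lemma card_image_eq_card_image:
  assumes "\<And>a b. a \<in> A \<Longrightarrow> b \<in> A \<Longrightarrow> f a = f b \<longleftrightarrow> g a = g b"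
  shows "card (f ` A) = card (g ` A)"
proof (rule bij_betw_same_card)
  show "bij_betw (\<lambda>y. g (SOME a. a \<in> A \<and> f a = y)) (f ` A) (g ` A)"
  proof -
    have *: "g (SOME a'. a' \<in> A \<and> f a' = f a) = g a" if "a \<in> A" for a
      using someI[of "\<lambda>a'. a' \<in> A \<and> f a' = f a" a] assms that by auto
    show ?thesis unfolding bij_betw_def inj_on_def using * assms by (auto simp: image_iff)
  qed
qed

text \<open>
  An index can be counted with any function that separates exactly the cosets; its values need
  not be cosets.
\<close>

lemma subgroup_index_eq_card_image:
  assumes "mult_subgroup A" "mult_subgroup H"
    and "\<And>a b. a \<in> A \<Longrightarrow> b \<in> A \<Longrightarrow> f a = f b \<longleftrightarrow> a / b \<in> H"
  shows "subgroup_index (mult_group_on A) H = card (f ` A)"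
  unfolding subgroup_index_def rcosets_mult_group_on
  by (rule card_image_eq_card_image) (use assms in \<open>auto simp: coset_of_eq_iff mult_subgroupD\<close>)

lemma subgroup_index_eq_card_cosets:
  assumes "mult_subgroup A" "mult_subgroup H"
  shows "subgroup_index (mult_group_on A) H = card (coset_of H ` A)"
  by (simp add: subgroup_index_def rcosets_mult_group_on)

text \<open>
  With a chosen representative \<open>r a\<close> of the coset of \<open>a\<close> modulo \<open>B\<close>, the coset of \<open>a\<close> modulo \<open>C\<close> is
  determined by the coset of \<open>a\<close> modulo \<open>B\<close> and the coset of \<open>a / r a\<close> in \<open>B\<close> modulo \<open>C\<close>, and any such
  pair occurs. Infinite indices are covered by the convention that the cardinality of an
  infinite set is 0.
\<close>

lemma subgroup_index_tower:
  assumes A: "mult_subgroup A" and B: "mult_subgroup B" and C: "mult_subgroup C" and sub: "C \<subseteq> B" "B \<subseteq> A"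
  shows "subgroup_index (mult_group_on A) C =
    subgroup_index (mult_group_on A) B * subgroup_index (mult_group_on B) C"
proof -
  define r where "r a = (SOME x. x \<in> A \<and> coset_of B x = coset_of B a)" for a
  have r: "r a \<in> A" "coset_of B (r a) = coset_of B a" if "a \<in> A" for a
    using someI[of "\<lambda>x. x \<in> A \<and> coset_of B x = coset_of B a" a] that unfolding r_def by auto
  have rB: "a / r a \<in> B" if "a \<in> A" for a
    using r[OF that] coset_of_eq_iff[OF B, of a "r a"] that A by (auto simp: mult_subgroupD)
  define f where "f a = (coset_of B a, coset_of C (a / r a))" for a
  have nz: "x \<noteq> 0" if "x \<in> A" for x using A that by (rule mult_subgroupD)
  have "subgroup_index (mult_group_on A) C = card (f ` A)"
  proof (rule subgroup_index_eq_card_image[OF A C])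
    fix a b assume ab: "a \<in> A" "b \<in> A"
    show "f a = f b \<longleftrightarrow> a / b \<in> C"
    proof (cases "coset_of B a = coset_of B b")
      case True
      then have "r a = r b" by (simp add: r_def)
      moreover have "(a / r b) / (b / r b) = a / b" using nz[OF r(1)[OF ab(2)]] by simp
      ultimately show ?thesis using True coset_of_eq_iff[OF C, of "a / r b" "b / r b"] nz r ab
        by (auto simp: f_def)
    next
      case False
      then show ?thesis using sub coset_of_eq_iff[OF B nz[OF ab(1)] nz[OF ab(2)]] by (auto simp: f_def)
    qed
  qed
  also have "f ` A = coset_of B ` A \<times> coset_of C ` B"
  proof
    show "f ` A \<subseteq> coset_of B ` A \<times> coset_of C ` B" using rB by (auto simp: f_def)
    show "coset_of B ` A \<times> coset_of C ` B \<subseteq> f ` A"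
    proof safe
      fix a b assume ab: "a \<in> A" "b \<in> B"
      let ?x = "b * r a"
      have x: "?x \<in> A" using ab r sub A by (auto simp: mult_subgroupD)
      have "?x / r a \<in> B" using ab nz[OF r(1)[OF ab(1)]] by simp
      then have q: "coset_of B ?x = coset_of B a"
        using coset_of_eq_iff[OF B nz[OF x] nz[OF r(1)[OF ab(1)]]] r(2)[OF ab(1)] by simp
      then have "r ?x = r a" by (simp add: r_def)
      then have "f ?x = (coset_of B a, coset_of C b)"
        using q nz[OF r(1)[OF ab(1)]] by (simp add: f_def)
      then show "(coset_of B a, coset_of C b) \<in> f ` A" using x by (metis image_eqI)
    qed
  qed
  finally show ?thesis
    using subgroup_index_eq_card_cosets[OF A B] subgroup_index_eq_card_cosets[OF B C]
    by (simp add: card_cartesian_product)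
qed

lemma mult_subgroup_image:
  assumes "mult_subgroup A" and f: "\<And>x y. x \<in> A \<Longrightarrow> y \<in> A \<Longrightarrow> f (x * y) = f x * (f y :: 'a::field)"
    and "f 1 = 1"
  shows "mult_subgroup (f ` A)"
proof -
  have inv: "f x * f (inverse x) = 1" if "x \<in> A" for x
    using f[of x "inverse x"] assms(3) that mult_subgroupD[OF assms(1)] by auto
  have "0 \<notin> f ` A" using inv by (force simp: image_iff)
  moreover have "inverse (f x) = f (inverse x)" if "x \<in> A" for x
    using inv[OF that] by (rule inverse_unique)
  ultimately show ?thesis unfolding mult_subgroup_def
    using assms mult_subgroupD[OF assms(1)] by (auto simp flip: f)
qed

text \<open>
  The function \<open>f\<close> induces a bijection between \<open>A\<close> modulo the preimage of \<open>H\<close> and \<open>f ` A\<close> modulo \<open>H\<close>.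
\<close>

lemma subgroup_index_preimage:
  assumes A: "mult_subgroup A" and H: "mult_subgroup H"
    and f: "\<And>x y. x \<in> A \<Longrightarrow> y \<in> A \<Longrightarrow> f (x * y) = f x * (f y :: 'a::field)" and f1: "f 1 = 1"
  shows "subgroup_index (mult_group_on A) {a\<in>A. f a \<in> H} = subgroup_index (mult_group_on (f ` A)) H"
proof -
  have fA: "mult_subgroup (f ` A)" by (rule mult_subgroup_image[OF A f f1])
  have inv: "f (inverse x) = inverse (f x)" if "x \<in> A" for x
    using f[of x "inverse x"] f1 that mult_subgroupD[OF A] by (metis inverse_unique right_inverse)
  have div: "f (x / y) = f x / f y" if "x \<in> A" "y \<in> A" for x y
    using f[of x "inverse y"] inv that mult_subgroupD[OF A] by (simp add: divide_inverse)
  have pre: "mult_subgroup {a\<in>A. f a \<in> H}"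
    using A H f f1 inv unfolding mult_subgroup_def by auto
  have "subgroup_index (mult_group_on A) {a\<in>A. f a \<in> H} = card ((\<lambda>a. coset_of H (f a)) ` A)"
    by (rule subgroup_index_eq_card_image[OF A pre])
      (use A H div fA in \<open>auto simp: coset_of_eq_iff mult_subgroupD\<close>)
  also have "\<dots> = subgroup_index (mult_group_on (f ` A)) H"
    by (simp add: subgroup_index_eq_card_cosets[OF fA H] image_image)
  finally show ?thesis .
qed

lemma subgroup_index_trivial:
  assumes "mult_subgroup A" shows "subgroup_index (mult_group_on A) {1} = card A"
proof -
  have "subgroup_index (mult_group_on A) {1} = card ((\<lambda>a. a) ` A)"
    by (rule subgroup_index_eq_card_image) (use assms in \<open>auto simp: mult_subgroup_def\<close>)
  then show ?thesis by simp
qed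

section \<open>Independent sets and their spans\<close>

definition mult_span :: "'a::field set \<Rightarrow> 'a set" where
  "mult_span E = {\<Prod>e\<in>E. e powi c e | c. True}"

definition mult_independent :: "'a::field set \<Rightarrow> bool" where
  "mult_independent E \<longleftrightarrow> finite E \<and> 0 \<notin> E \<and>
     (\<forall>c :: 'a \<Rightarrow> int. (\<Prod>e\<in>E. e powi c e) = 1 \<longrightarrow> (\<forall>e\<in>E. c e = 0))"

lemma mult_independentD:
  fixes c :: "'a::field \<Rightarrow> int"
  assumes "mult_independent E" "(\<Prod>e\<in>E. e powi c e) = 1" "e \<in> E"
  shows "c e = 0"
proof -
  have "(\<Prod>e\<in>E. e powi c e) = 1 \<longrightarrow> (\<forall>e\<in>E. c e = 0)"
    using assms(1) unfolding mult_independent_def by (elim conjE allE)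
  then show ?thesis using assms(2,3) by blast
qed

lemma mult_spanI: "(\<Prod>e\<in>E. e powi c e) \<in> mult_span E"
  unfolding mult_span_def by blast

lemma mult_span_cases: "x \<in> mult_span E \<Longrightarrow> (\<And>c. x = (\<Prod>e\<in>E. e powi c e) \<Longrightarrow> P) \<Longrightarrow> P"
  unfolding mult_span_def by blast

lemma int_independent_mult_group_on:
  assumes "mult_subgroup A"
  shows "int_independent (mult_group_on A) E \<longleftrightarrow> E \<subseteq> A \<and> mult_independent E"
proof -
  have "finprod (mult_group_on A) (\<lambda>b. b [^]\<^bsub>mult_group_on A\<^esub> (c b :: int)) E = (\<Prod>e\<in>E. e powi c e)"
    if "E \<subseteq> A" "finite E" for c
  proof -
    have "finprod (mult_group_on A) (\<lambda>b. b [^]\<^bsub>mult_group_on A\<^esub> c b) E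
       = (\<Prod>b\<in>E. b [^]\<^bsub>mult_group_on A\<^esub> c b)"
      using that assms by (intro finprod_mult_group_on) (auto simp: int_pow_mult_group_on mult_subgroup_powi)
    also have "\<dots> = (\<Prod>e\<in>E. e powi c e)"
      using that assms by (intro prod.cong) (auto simp: int_pow_mult_group_on)
    finally show ?thesis .
  qed
  note fp = this
  show ?thesis
  proof (cases "E \<subseteq> A \<and> finite E")
    case True
    then have "0 \<notin> E" using mult_subgroupD(2)[OF assms] by blast
    with True show ?thesis by (simp add: int_independent_def mult_independent_def fp)
  next
    case False
    then show ?thesis by (auto simp: int_independent_def mult_independent_def)
  qed
qed

lemma prod_powi_add:
  "0 \<notin> E \<Longrightarrow> (\<Prod>e\<in>E. e powi (c e + d e)) = (\<Prod>e\<in>E. e powi c e) * (\<Prod>e\<in>E. e powi d e :: 'a::field)"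
  by (induction E rule: infinite_finite_induct) (auto simp: power_int_add)

lemma prod_powi_minus: "(\<Prod>e\<in>E. e powi (- c e)) = inverse (\<Prod>e\<in>E. e powi c e :: 'a::field)"
  by (induction E rule: infinite_finite_induct) (auto simp: power_int_minus)

lemma prod_powi_power: "(\<Prod>e\<in>E. e powi (k * c e)) = (\<Prod>e\<in>E. e powi c e :: 'a::field) powi k"
  by (induction E rule: infinite_finite_induct)
    (auto simp: power_int_mult_distrib power_int_mult mult.commute[of k])

lemma mult_subgroup_span:
  assumes "0 \<notin> E" shows "mult_subgroup (mult_span E)"
proof (cases "finite E")
  case True
  show ?thesis unfolding mult_subgroup_def
  proof (intro conjI ballI)
    show "1 \<in> mult_span E" using mult_spanI[where E = E and c = "\<lambda>_. 0"] by simp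
    show "0 \<notin> mult_span E" using assms True by (auto simp: mult_span_def)
    fix x assume "x \<in> mult_span E"
    then obtain c where c: "x = (\<Prod>e\<in>E. e powi c e)" by (auto elim: mult_span_cases)
    show "inverse x \<in> mult_span E"
      using mult_spanI[where E = E and c = "\<lambda>e. - c e"] by (simp add: c prod_powi_minus)
    fix y assume "y \<in> mult_span E"
    then obtain d where d: "y = (\<Prod>e\<in>E. e powi d e)" by (auto elim: mult_span_cases)
    show "x * y \<in> mult_span E"
      using mult_spanI[where E = E and c = "\<lambda>e. c e + d e"] by (simp add: c d prod_powi_add[OF assms])
  qed
qed (auto simp: mult_subgroup_def mult_span_def)

lemma mult_span_subset: "mult_subgroup A \<Longrightarrow> E \<subseteq> A \<Longrightarrow> mult_span E \<subseteq> A"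
  unfolding mult_span_def by (auto intro!: mult_subgroup_prod mult_subgroup_powi)

lemma mult_independent_unique:
  assumes "mult_independent E" "(\<Prod>e\<in>E. e powi c e) = (\<Prod>e\<in>E. e powi d e)" "e \<in> E"
  shows "c e = d e"
proof -
  have E: "0 \<notin> E" "finite E" using assms(1) by (auto simp: mult_independent_def)
  have "(\<Prod>e\<in>E. e powi (c e + - d e)) = 1"
    unfolding prod_powi_add[OF E(1)] prod_powi_minus assms(2) using E by (simp add: power_int_eq_0_iff)
  then have "c e + - d e = 0" by (rule mult_independentD[OF assms(1) _ assms(3)])
  then show ?thesis by simp
qed

section \<open>The rank of an abelian group\<close>

text \<open>
  Elimination without division: a nonzero entry \<open>c b0 e\<close> serves as pivot, and the entries at \<open>e\<close>
  of the other vectors are cleared by cross-multiplication, which leaves vectors indexed by \<open>E\<close>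
  only.
\<close>

lemma exists_integer_relation:
  fixes c :: "'b \<Rightarrow> 'e \<Rightarrow> int"
  assumes "finite E" "finite B" "card E < card B"
  shows "\<exists>d. (\<exists>b\<in>B. d b \<noteq> 0) \<and> (\<forall>e\<in>E. (\<Sum>b\<in>B. d b * c b e) = 0)"
  using assms
proof (induction E arbitrary: B c rule: finite_induct)
  case empty
  then obtain b where "b \<in> B" by fastforce
  then show ?case by (intro exI[of _ "\<lambda>_. 1"]) auto
next
  case (insert e E)
  show ?case
  proof (cases "\<forall>b\<in>B. c b e = 0")
    case True
    have "card E < card B" using insert.hyps insert.prems(2) by simp
    from insert.IH[OF insert.prems(1) this, of c]
    obtain d where "\<exists>b\<in>B. d b \<noteq> 0" "\<forall>x\<in>E. (\<Sum>b\<in>B. d b * c b x) = 0"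
      by (elim exE conjE)
    with True show ?thesis by (intro exI[of _ d] conjI) simp_all
  next
    case False
    then obtain b0 where b0: "b0 \<in> B" "c b0 e \<noteq> 0" by blast
    define B' where "B' = B - {b0}"
    have B': "finite B'" "card E < card B'" "b0 \<notin> B'" "B = insert b0 B'"
      using insert b0 by (auto simp: B'_def)
    from insert.IH[OF B'(1,2), of "\<lambda>b x. c b0 e * c b x - c b e * c b0 x"]
    obtain d where d: "\<exists>b\<in>B'. d b \<noteq> 0"
      "\<forall>x\<in>E. (\<Sum>b\<in>B'. d b * (c b0 e * c b x - c b e * c b0 x)) = 0" by (elim exE conjE)
    define d' where "d' b = (if b = b0 then - (\<Sum>b\<in>B'. d b * c b e) else c b0 e * d b)" for b
    have "(\<Sum>b\<in>B. d' b * c b x) = (\<Sum>b\<in>B'. d b * (c b0 e * c b x - c b e * c b0 x))" for x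
    proof -
      have "(\<Sum>b\<in>B. d' b * c b x) = d' b0 * c b0 x + (\<Sum>b\<in>B'. d' b * c b x)"
        using B' by simp
      also have "(\<Sum>b\<in>B'. d' b * c b x) = (\<Sum>b\<in>B'. c b0 e * d b * c b x)"
        using B'(3) by (intro sum.cong) (auto simp: d'_def)
      also have "d' b0 * c b0 x = - (\<Sum>b\<in>B'. d b * (c b e * c b0 x))"
        by (simp add: d'_def sum_distrib_right mult.assoc)
      also have "- (\<Sum>b\<in>B'. d b * (c b e * c b0 x)) + (\<Sum>b\<in>B'. c b0 e * d b * c b x) =
          (\<Sum>b\<in>B'. c b0 e * d b * c b x - d b * (c b e * c b0 x))"
        by (simp add: sum_subtractf)
      also have "\<dots> = (\<Sum>b\<in>B'. d b * (c b0 e * c b x - c b e * c b0 x))"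
        by (intro sum.cong refl) (simp add: algebra_simps)
      finally show ?thesis .
    qed
    then have "\<forall>x\<in>insert e E. (\<Sum>b\<in>B. d' b * c b x) = 0" using d(2) by auto
    moreover have "\<exists>b\<in>B. d' b \<noteq> 0" using d(1) b0 B' by (auto simp: d'_def)
    ultimately show ?thesis by (intro exI[of _ d'] conjI)
  qed
qed

text \<open>
  More than \<open>card E\<close> elements are dependent: suitable powers of them have exponent vectors over
  \<open>E\<close>, and an integer relation between these vectors is a multiplicative relation between the
  elements.
\<close>

lemma abelian_rank_eq_card:
  assumes A: "mult_subgroup A" and E: "E \<subseteq> A" "mult_independent E"
    and tors: "\<And>x. x \<in> A \<Longrightarrow> \<exists>m>0. x ^ m \<in> mult_span E"
  shows "abelian_rank (mult_group_on A) = card E"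
  unfolding abelian_rank_def int_independent_mult_group_on[OF A]
proof (rule Greatest_equality)
  show "\<exists>B. (B \<subseteq> A \<and> mult_independent B) \<and> card B = card E" using E by blast
  fix n assume "\<exists>B. (B \<subseteq> A \<and> mult_independent B) \<and> card B = n"
  then obtain B where B: "B \<subseteq> A" "mult_independent B" "card B = n" by blast
  have fin: "finite B" "finite E" using B E by (auto simp: mult_independent_def)
  have "\<exists>m c. m > 0 \<and> b ^ m = (\<Prod>e\<in>E. e powi c e)" if "b \<in> B" for b
    using tors[of b] that B(1) by (auto elim!: mult_span_cases)
  then obtain m c where mc: "\<And>b. b \<in> B \<Longrightarrow> m b > (0::nat)"
    "\<And>b. b \<in> B \<Longrightarrow> b ^ m b = (\<Prod>e\<in>E. e powi c b e)" by metis
  show "n \<le> card E"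
  proof (rule ccontr)
    assume "\<not> n \<le> card E"
    then obtain d where d: "\<exists>b\<in>B. d b \<noteq> 0" "\<And>e. e \<in> E \<Longrightarrow> (\<Sum>b\<in>B. d b * c b e) = 0"
      using exists_integer_relation[OF fin(2,1), of c] B(3) by auto
    have "(\<Prod>b\<in>B. b powi (int (m b) * d b)) = (\<Prod>b\<in>B. \<Prod>e\<in>E. e powi (d b * c b e))"
    proof (intro prod.cong refl)
      fix b assume "b \<in> B"
      then have "b powi (int (m b) * d b) = (\<Prod>e\<in>E. e powi c b e) powi d b"
        using mc(2)[of b] by (simp add: power_int_mult)
      then show "b powi (int (m b) * d b) = (\<Prod>e\<in>E. e powi (d b * c b e))"
        by (simp only: prod_powi_power)
    qed
    also have "\<dots> = (\<Prod>e\<in>E. \<Prod>b\<in>B. e powi (d b * c b e))" by (rule prod.swap)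
    also have "\<dots> = (\<Prod>e\<in>E. e powi (\<Sum>b\<in>B. d b * c b e))"
    proof (intro prod.cong refl)
      fix e assume "e \<in> E"
      then have "e \<noteq> 0" using E(2) by (auto simp: mult_independent_def)
      show "(\<Prod>b\<in>B. e powi (d b * c b e)) = e powi (\<Sum>b\<in>B. d b * c b e)"
        using fin(1) by (induction B rule: finite_induct) (auto simp: power_int_add \<open>e \<noteq> 0\<close>)
    qed
    also have "\<dots> = 1" using d(2) by simp
    finally have prod1: "(\<Prod>b\<in>B. b powi (int (m b) * d b)) = 1" .
    have "\<forall>b\<in>B. int (m b) * d b = 0"
      using mult_independentD[where c = "\<lambda>b. int (m b) * d b", OF B(2) prod1] by blast
    then show False using d(1) mc(1) by fastforce
  qed
qed

section \<open>Discrete groups\<close>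

text \<open>
  Up to finitely many cosets, a discrete subgroup of a real vector space is spanned by an
  independent set. The coordinates \<open>L i\<close> are eliminated one at a time. Choose \<open>g\<close> with \<open>L k g \<noteq> 0\<close>,
  subtract multiples of \<open>L k\<close> from the other coordinates so that they vanish at \<open>g\<close>, and add \<open>g\<close> to
  \<open>E\<close>. Applying \<open>L k\<close> to a relation isolates the exponent of \<open>g\<close>, so the set remains independent.
  Multiplying \<open>a\<close> by a power of \<open>g\<close> makes \<open>\<bar>L k a\<bar>\<close> at most \<open>\<bar>L k g\<bar>\<close> and leaves the new coordinates
  unchanged, so a bound on these bounds all coordinates modulo powers of \<open>g\<close>. Once no coordinate
  is left, the finiteness assumption speaks of all of \<open>A\<close>. The set \<open>E\<close> in the statement collects
  the generators found so far.
\<close>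

lemma finitely_generated_of_discrete_log:
  fixes A :: "'a::field set" and L :: "'i \<Rightarrow> 'a \<Rightarrow> real"
  assumes "finite I" and A: "mult_subgroup A"
    and "\<And>i x y. i \<in> I \<Longrightarrow> x \<in> A \<Longrightarrow> y \<in> A \<Longrightarrow> L i (x * y) = L i x + L i y"
    and "E \<subseteq> A" "mult_independent E" "\<And>i e. i \<in> I \<Longrightarrow> e \<in> E \<Longrightarrow> L i e = 0"
    and "\<And>C. \<exists>T. finite T \<and> T \<subseteq> A \<and>
            (\<forall>a\<in>A. (\<forall>i\<in>I. \<bar>L i a\<bar> \<le> C) \<longrightarrow> (\<exists>t\<in>T. a / t \<in> mult_span E))"
  shows "\<exists>E' T. E' \<subseteq> A \<and> mult_independent E' \<and> finite T \<and> T \<subseteq> A \<and>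
            (\<forall>a\<in>A. \<exists>t\<in>T. a / t \<in> mult_span E')"
  using assms(1,3-)
proof (induction I arbitrary: L E rule: finite_induct)
  case empty
  then show ?case by (metis empty_iff)
next
  case (insert k I)
  note hom = insert.prems(1) and EA = insert.prems(2) and ind = insert.prems(3)
    and LE = insert.prems(4) and bdd = insert.prems(5)
  show ?case
  proof (cases "\<forall>a\<in>A. L k a = 0")
    case True
    show ?thesis
    proof (rule insert.IH[of L E])
      fix C :: real
      obtain T where T: "finite T" "T \<subseteq> A"
        "\<And>a. a \<in> A \<Longrightarrow> (\<forall>i\<in>insert k I. \<bar>L i a\<bar> \<le> \<bar>C\<bar>) \<Longrightarrow> \<exists>t\<in>T. a / t \<in> mult_span E"
        using bdd[of "\<bar>C\<bar>"] by blast
      have "\<exists>t\<in>T. a / t \<in> mult_span E" if "a \<in> A" "\<forall>i\<in>I. \<bar>L i a\<bar> \<le> C" for a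
        using T(3)[OF that(1)] that True by fastforce
      then show "\<exists>T. finite T \<and> T \<subseteq> A \<and>
            (\<forall>a\<in>A. (\<forall>i\<in>I. \<bar>L i a\<bar> \<le> C) \<longrightarrow> (\<exists>t\<in>T. a / t \<in> mult_span E))" using T by blast
    qed (use hom EA ind LE in auto)
  next
    case False
    then obtain g where g: "g \<in> A" "L k g \<noteq> 0" by blast
    have g0: "g \<noteq> 0" using A g(1) by (rule mult_subgroupD)
    define q where "q i = L i g / L k g" for i
    define L' where "L' i a = L i a - q i * L k a" for i a
    have E0: "0 \<notin> E" "finite E" using ind by (auto simp: mult_independent_def)
    have L1: "L i 1 = 0" if "i \<in> insert k I" for i using hom[OF that, of 1 1] A by (simp add: mult_subgroupD)
    have Linv: "L i (inverse x) = - L i x" if "i \<in> insert k I" "x \<in> A" for i x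
      using hom[OF that(1), of x "inverse x"] L1[OF that(1)] that A by (simp add: mult_subgroupD)
    have Lpow: "L i (x ^ n) = n * L i x" if "i \<in> insert k I" "x \<in> A" for i x n
      by (induction n) (use that L1 hom A in \<open>auto simp: mult_subgroup_power algebra_simps\<close>)
    have Lpowi: "L i (x powi n) = n * L i x" if "i \<in> insert k I" "x \<in> A" for i x n
      using that Lpow Linv A by (auto simp: power_int_def mult_subgroup_power mult_subgroupD)
    have Lprod: "L i (prod f J) = (\<Sum>j\<in>J. L i (f j))"
      if "i \<in> insert k I" "finite J" "\<And>j. j \<in> J \<Longrightarrow> f j \<in> A" for i f and J :: "'a set"
      using that(2,3) by (induction J rule: finite_induct)
        (use that(1) L1 hom A in \<open>auto simp: mult_subgroup_prod\<close>)
    have gE: "g \<notin> E" using LE g by auto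
    show ?thesis
    proof (rule insert.IH[of L' "insert g E"])
      show "mult_independent (insert g E)" unfolding mult_independent_def
      proof (intro conjI allI impI)
        fix c :: "'a \<Rightarrow> int" assume c: "(\<Prod>e\<in>insert g E. e powi c e) = 1"
        have "0 = L k (\<Prod>e\<in>insert g E. e powi c e)" using c L1 by simp
        also have "\<dots> = (\<Sum>e\<in>insert g E. c e * L k e)"
        proof -
          have "e \<in> A" if "e \<in> insert g E" for e using that EA g by auto
          then show ?thesis
            using E0 A by (subst Lprod) (auto simp: Lpowi mult_subgroup_powi simp del: sum.insert)
        qed
        also have "\<dots> = c g * L k g" using E0 gE LE by (simp add: sum.neutral)
        finally have "c g = 0" using g by simp
        moreover from this have "(\<Prod>e\<in>E. e powi c e) = 1" using c E0 gE by simp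
        then have "\<forall>e\<in>E. c e = 0" using mult_independentD[OF ind] by blast
        ultimately show "\<forall>e\<in>insert g E. c e = 0" by auto
      qed (use E0 g0 in auto)
      show "L' i e = 0" if "i \<in> I" "e \<in> insert g E" for i e
        using that LE g by (auto simp: L'_def q_def)
      show hom': "L' i (x * y) = L' i x + L' i y" if "i \<in> I" "x \<in> A" "y \<in> A" for i x y
        using that hom by (simp add: L'_def algebra_simps)
      fix C :: real
      define D where "D = \<bar>C\<bar> + \<bar>L k g\<bar> + (\<Sum>i\<in>I. \<bar>q i\<bar> * \<bar>L k g\<bar>)"
      obtain T where T: "finite T" "T \<subseteq> A"
        "\<And>a. a \<in> A \<Longrightarrow> (\<forall>i\<in>insert k I. \<bar>L i a\<bar> \<le> D) \<Longrightarrow> \<exists>t\<in>T. a / t \<in> mult_span E"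
        using bdd[of D] by blast
      have "\<exists>t\<in>T. a / t \<in> mult_span (insert g E)" if a: "a \<in> A" "\<forall>i\<in>I. \<bar>L' i a\<bar> \<le> C" for a
      proof -
        \<comment> \<open>dividing by this power of \<open>g\<close> brings \<open>L k\<close> into the range of one period\<close>
        define m where "m = \<lfloor>L k a / L k g\<rfloor>"
        define b where "b = a * g powi (- m)"
        have b: "b \<in> A" using a g A by (simp add: b_def mult_subgroupD mult_subgroup_powi)
        have Lb: "L i b = L i a - m * L i g" if "i \<in> insert k I" for i
          unfolding b_def using that a g A by (simp add: hom Lpowi mult_subgroup_powi)
        have "L k b = (L k a / L k g - m) * L k g" using Lb[of k] g by (simp add: left_diff_distrib)
        also have "\<bar>\<dots>\<bar> \<le> 1 * \<bar>L k g\<bar>"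
          unfolding abs_mult m_def by (intro mult_right_mono) (simp_all add: abs_le_iff, linarith+)
        finally have kb: "\<bar>L k b\<bar> \<le> \<bar>L k g\<bar>" by simp
        have sum_nn: "0 \<le> (\<Sum>i\<in>I. \<bar>q i\<bar> * \<bar>L k g\<bar>)" by (intro sum_nonneg) auto
        have "\<bar>L i b\<bar> \<le> D" if "i \<in> I" for i
        proof -
          have "L i b = L' i a + q i * L k b"
            using that g by (simp add: Lb L'_def q_def field_simps)
          then have "\<bar>L i b\<bar> \<le> \<bar>L' i a\<bar> + \<bar>q i\<bar> * \<bar>L k b\<bar>" by (metis abs_mult abs_triangle_ineq)
          also have "\<dots> \<le> \<bar>C\<bar> + \<bar>q i\<bar> * \<bar>L k g\<bar>"
            using a(2) that kb by (intro add_mono mult_left_mono) fastforce+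
          also have "\<bar>q i\<bar> * \<bar>L k g\<bar> \<le> (\<Sum>i\<in>I. \<bar>q i\<bar> * \<bar>L k g\<bar>)"
            using insert.hyps that by (intro member_le_sum) auto
          finally show ?thesis by (simp add: D_def)
        qed
        moreover have "\<bar>L k b\<bar> \<le> D" using kb sum_nn by (simp add: D_def)
        ultimately obtain t where t: "t \<in> T" "b / t \<in> mult_span E" using T(3)[OF b] by blast
        then obtain c where c: "b / t = (\<Prod>e\<in>E. e powi c e)" by (auto elim: mult_span_cases)
        have "a / t = (b / t) * g powi m" using g0 by (simp add: b_def power_int_minus)
        also have "\<dots> = (\<Prod>e\<in>insert g E. e powi (c(g := m)) e)"
        proof -
          have "(\<Prod>e\<in>E. e powi (c(g := m)) e) = (\<Prod>e\<in>E. e powi c e)"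
            using gE by (intro prod.cong) auto
          then show ?thesis using c E0 gE by simp
        qed
        finally show ?thesis using t(1) mult_spanI by metis
      qed
      then show "\<exists>T. finite T \<and> T \<subseteq> A \<and>
            (\<forall>a\<in>A. (\<forall>i\<in>I. \<bar>L' i a\<bar> \<le> C) \<longrightarrow> (\<exists>t\<in>T. a / t \<in> mult_span (insert g E)))" using T by blast
    qed (use EA g in auto)
  qed
qed

section \<open>The index of the squares\<close>

text \<open>
  Modulo squares only the parities of the exponents matter, and every set of odd exponents
  occurs.
\<close>

lemma subgroup_index_span_squares:
  fixes E :: "'a::field set"
  assumes ind: "mult_independent E"
  shows "subgroup_index (mult_group_on (mult_span E)) ((\<lambda>x. x\<^sup>2) ` mult_span E) = 2 ^ card E"
proof -
  have E: "finite E" "0 \<notin> E" using ind by (auto simp: mult_independent_def)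
  note B = mult_subgroup_span[OF E(2)]
  have sq: "mult_subgroup ((\<lambda>x. x\<^sup>2) ` mult_span E)"
    by (rule mult_subgroup_image[OF B]) (auto simp: power_mult_distrib)
  define ex where "ex b = (SOME c :: 'a \<Rightarrow> int. b = (\<Prod>e\<in>E. e powi c e))" for b
  have ex: "b = (\<Prod>e\<in>E. e powi ex b e)" if "b \<in> mult_span E" for b
  proof -
    from that obtain c where "b = (\<Prod>e\<in>E. e powi c e)" by (auto elim: mult_span_cases)
    then show ?thesis unfolding ex_def by (rule someI[where P = "\<lambda>c. b = (\<Prod>e\<in>E. e powi c e)"])
  qed
  have ex_eq: "ex (\<Prod>e\<in>E. e powi c e) e = c e" if "e \<in> E" for c e
    using mult_independent_unique[OF ind ex[OF mult_spanI] that] by simp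
  define f where "f b = {e\<in>E. odd (ex b e)}" for b
  have "subgroup_index (mult_group_on (mult_span E)) ((\<lambda>x. x\<^sup>2) ` mult_span E) = card (f ` mult_span E)"
  proof (rule subgroup_index_eq_card_image[OF B sq])
    fix a b assume ab: "a \<in> mult_span E" "b \<in> mult_span E"
    have quot: "a / b = (\<Prod>e\<in>E. e powi (ex a e + - ex b e))"
      unfolding prod_powi_add[OF E(2)] prod_powi_minus ex[OF ab(1), symmetric] ex[OF ab(2), symmetric]
      by (simp add: divide_inverse)
    show "f a = f b \<longleftrightarrow> a / b \<in> (\<lambda>x. x\<^sup>2) ` mult_span E"
    proof
      assume "f a = f b"
      then have "even (ex a e + - ex b e)" if "e \<in> E" for e using that by (auto simp: f_def set_eq_iff)
      then have "a / b = (\<Prod>e\<in>E. e powi (2 * ((ex a e + - ex b e) div 2)))"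
        unfolding quot by (intro prod.cong) auto
      also have "\<dots> = (\<Prod>e\<in>E. e powi ((ex a e + - ex b e) div 2))\<^sup>2"
        by (simp only: prod_powi_power power_int_numeral)
      finally show "a / b \<in> (\<lambda>x. x\<^sup>2) ` mult_span E"
        using mult_spanI[where E = E and c = "\<lambda>e. (ex a e + - ex b e) div 2"] by blast
    next
      assume "a / b \<in> (\<lambda>x. x\<^sup>2) ` mult_span E"
      then obtain x where x: "x \<in> mult_span E" "a / b = x\<^sup>2" by blast
      then have "(\<Prod>e\<in>E. e powi (ex a e + - ex b e)) = (\<Prod>e\<in>E. e powi ex x e)\<^sup>2"
        using quot ex[OF x(1)] by simp
      also have "\<dots> = (\<Prod>e\<in>E. e powi (2 * ex x e))" by (simp only: prod_powi_power power_int_numeral)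
      finally have prods: "(\<Prod>e\<in>E. e powi (ex a e + - ex b e)) = (\<Prod>e\<in>E. e powi (2 * ex x e))" .
      have "even (ex a e) \<longleftrightarrow> even (ex b e)" if "e \<in> E" for e
      proof -
        have "ex a e + - ex b e = 2 * ex x e"
          by (rule mult_independent_unique[where c = "\<lambda>e. ex a e + - ex b e" and d = "\<lambda>e. 2 * ex x e",
                OF ind prods that])
        then show ?thesis by presburger
      qed
      then show "f a = f b" by (auto simp: f_def)
    qed
  qed
  also have "f ` mult_span E = Pow E"
  proof (rule antisym)
    show "Pow E \<subseteq> f ` mult_span E"
    proof
      fix Y assume Y: "Y \<in> Pow E"
      define c :: "'a \<Rightarrow> int" where "c = (\<lambda>e. of_bool (e \<in> Y))"
      have "f (\<Prod>e\<in>E. e powi c e) = {e\<in>E. odd (c e)}" unfolding f_def using ex_eq by auto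
      also have "\<dots> = Y" using Y by (auto simp: c_def)
      finally show "Y \<in> f ` mult_span E" using mult_spanI[where E = E and c = c] by blast
    qed
  qed (auto simp: f_def)
  finally show ?thesis by (simp add: card_Pow E)
qed

text \<open>
  Let \<open>B\<close> be the span of \<open>E\<close>. Squaring maps \<open>A\<close> onto \<open>A\<^sup>2\<close>, and the preimage of \<open>B\<^sup>2\<close> is \<open>B' = B \<union> - B\<close>, in
  which \<open>B\<close> has index 2 because the torsion-free group \<open>B\<close> does not contain \<open>- 1\<close>. Comparison of the
  towers \<open>A \<supseteq> A\<^sup>2 \<supseteq> B\<^sup>2\<close> and \<open>A \<supseteq> B' \<supseteq> B \<supseteq> B\<^sup>2\<close> gives \<open>(A : A\<^sup>2) = 2 (B : B\<^sup>2)\<close> after cancelling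
  \<open>(A : B')\<close>, which is finite by the assumption on \<open>T\<close>.
\<close>

lemma subgroup_index_squares:
  fixes A :: "'a::field_char_0 set"
  assumes A: "mult_subgroup A" "- 1 \<in> A" and E: "E \<subseteq> A" "mult_independent E"
    and T: "finite T" "T \<subseteq> A" "\<And>a. a \<in> A \<Longrightarrow> \<exists>t\<in>T. a / t \<in> mult_span E"
  shows "subgroup_index (mult_group_on A) ((\<lambda>x. x\<^sup>2) ` A) = 2 ^ (card E + 1)"
proof -
  have E': "finite E" "0 \<notin> E" using E by (auto simp: mult_independent_def)
  define B where "B = mult_span E"
  have B: "mult_subgroup B" "B \<subseteq> A"
    using mult_subgroup_span[OF E'(2)] mult_span_subset[OF A(1) E(1)] by (simp_all add: B_def)
  let ?sq = "\<lambda>x::'a. x\<^sup>2"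
  have sqA: "mult_subgroup (?sq ` A)" and sqB: "mult_subgroup (?sq ` B)"
    by (rule mult_subgroup_image; use A B in \<open>auto simp: power_mult_distrib\<close>)+
  have sub: "?sq ` B \<subseteq> B" "?sq ` A \<subseteq> A" "?sq ` B \<subseteq> ?sq ` A"
    using A B by (auto simp: power2_eq_square mult_subgroupD)
  have m1: "- 1 \<notin> B"
  proof
    assume "- 1 \<in> B"
    then obtain c where c: "- 1 = (\<Prod>e\<in>E. e powi c e)" unfolding B_def by (auto elim: mult_span_cases)
    have "(\<Prod>e\<in>E. e powi (2 * c e)) = (- 1) powi 2" unfolding prod_powi_power c by (rule refl)
    then have "(\<Prod>e\<in>E. e powi (2 * c e)) = 1" by simp
    then have "2 * c e = 0" if "e \<in> E" for e
      using mult_independentD[where c = "\<lambda>e. 2 * c e", OF E(2) _ that] by blast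
    then have "(\<Prod>e\<in>E. e powi c e) = 1" by simp
    then show False using c by (metis one_neq_neg_one)
  qed
  define B' where "B' = {a\<in>A. a\<^sup>2 \<in> ?sq ` B}"
  have B'_iff: "a \<in> B' \<longleftrightarrow> a \<in> B \<or> - a \<in> B" if "a \<in> A" for a
    using that B(2) by (auto simp: B'_def power2_eq_iff image_iff intro: bexI[of _ "- a"])
  have B': "mult_subgroup B'"
    using A(1) sqB unfolding mult_subgroup_def B'_def
    by (auto simp: power_mult_distrib power_inverse simp del: image_iff)
  have BB': "B \<subseteq> B'" "B' \<subseteq> A" using B by (auto simp: B'_def)
  have neg1: "- a \<in> A" if "a \<in> A" for a using mult_subgroupD(3)[OF A(1) A(2) that] by simp
  have two: "subgroup_index (mult_group_on B') B = 2"
  proof -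
    have Bmul: "x / y \<in> B \<longleftrightarrow> (x \<in> B \<longleftrightarrow> y \<in> B)" if "x \<in> B'" "y \<in> B'" for x y
    proof -
      have nz: "x \<noteq> 0" "y \<noteq> 0" using that B' by (auto simp: mult_subgroupD)
      have pm: "x \<in> B \<or> - x \<in> B" "y \<in> B \<or> - y \<in> B" using that B'_iff BB' by blast+
      have nB: "\<not> (u \<in> B \<and> - u \<in> B)" if "u \<noteq> 0" for u
        using m1 mult_subgroupD(5)[OF B(1), of "- u" u] that by auto
      have "x \<in> B \<Longrightarrow> y \<in> B \<Longrightarrow> x / y \<in> B" "- x \<in> B \<Longrightarrow> - y \<in> B \<Longrightarrow> x / y \<in> B"
        "x \<in> B \<Longrightarrow> - y \<in> B \<Longrightarrow> - (x / y) \<in> B" "- x \<in> B \<Longrightarrow> y \<in> B \<Longrightarrow> - (x / y) \<in> B"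
        using mult_subgroupD(5)[OF B(1), of x y] mult_subgroupD(5)[OF B(1), of "-x" "-y"]
          mult_subgroupD(5)[OF B(1), of x "-y"] mult_subgroupD(5)[OF B(1), of "-x" y] by auto
      then show ?thesis using pm nB[of x] nB[of y] nB[of "x / y"] nz by auto
    qed
    have "subgroup_index (mult_group_on B') B = card ((\<lambda>a. a \<in> B) ` B')"
      by (rule subgroup_index_eq_card_image[OF B' B(1)]) (use Bmul in auto)
    moreover have "1 \<in> B'" "1 \<in> B" "- 1 \<in> B'"
      using B'_iff[OF A(2)] B'_iff[of 1] B A by (auto simp: mult_subgroupD)
    then have "(\<lambda>a. a \<in> B) ` B' = {True, False}" using m1 by (auto simp: image_iff)
    ultimately show ?thesis by simp
  qed
  have fin: "subgroup_index (mult_group_on A) B > 0"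
  proof -
    have "coset_of B ` A \<subseteq> coset_of B ` T"
    proof (rule image_subsetI)
      fix a assume a: "a \<in> A"
      then obtain t where t: "t \<in> T" "a / t \<in> B" using T unfolding B_def by blast
      then have "coset_of B a = coset_of B t"
        using a T A by (subst coset_of_eq_iff[OF B(1)]) (auto dest: mult_subgroupD(6)[OF A(1)])
      then show "coset_of B a \<in> coset_of B ` T" using t by blast
    qed
    then have "finite (coset_of B ` A)" using T(1) finite_subset by blast
    moreover have "A \<noteq> {}" using A by blast
    ultimately show ?thesis
      by (simp add: subgroup_index_eq_card_cosets[OF A(1) B(1)] card_gt_0_iff)
  qed
  have "subgroup_index (mult_group_on A) (?sq ` A) * subgroup_index (mult_group_on (?sq ` A)) (?sq ` B) =
      subgroup_index (mult_group_on A) B * subgroup_index (mult_group_on B) (?sq ` B)"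
    using subgroup_index_tower[OF A(1) sqA sqB sub(3,2)] subgroup_index_tower[OF A(1) B(1) sqB sub(1) B(2)]
    by simp
  also have "subgroup_index (mult_group_on A) B = subgroup_index (mult_group_on A) B' * 2"
    using subgroup_index_tower[OF A(1) B' B(1) BB'] two by simp
  also have "subgroup_index (mult_group_on (?sq ` A)) (?sq ` B) = subgroup_index (mult_group_on A) B'"
    unfolding B'_def by (rule subgroup_index_preimage[symmetric, OF A(1) sqB]) (auto simp: power_mult_distrib)
  also have "subgroup_index (mult_group_on B) (?sq ` B) = 2 ^ card E"
    unfolding B_def by (rule subgroup_index_span_squares[OF E(2)])
  finally show ?thesis using fin subgroup_index_tower[OF A(1) B' B(1) BB'] two by simp
qed

section \<open>Subfields and number fields\<close>

definition is_subfield :: "'a::field set \<Rightarrow> bool" where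
  "is_subfield E \<longleftrightarrow> 0 \<in> E \<and> 1 \<in> E \<and> (\<forall>x\<in>E. \<forall>y\<in>E. x + y \<in> E \<and> x * y \<in> E) \<and>
     (\<forall>x\<in>E. - x \<in> E \<and> inverse x \<in> E)"

lemma is_subfieldD:
  assumes "is_subfield E"
  shows "0 \<in> E" "1 \<in> E" "x \<in> E \<Longrightarrow> y \<in> E \<Longrightarrow> x + y \<in> E" "x \<in> E \<Longrightarrow> y \<in> E \<Longrightarrow> x * y \<in> E"
    "x \<in> E \<Longrightarrow> - x \<in> E" "x \<in> E \<Longrightarrow> inverse x \<in> E" "x \<in> E \<Longrightarrow> y \<in> E \<Longrightarrow> x - y \<in> E"
    "x \<in> E \<Longrightarrow> y \<in> E \<Longrightarrow> x / y \<in> E" "x \<in> E \<Longrightarrow> x ^ n \<in> E"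
proof -
  note d = assms[unfolded is_subfield_def]
  show "0 \<in> E" "1 \<in> E" "x \<in> E \<Longrightarrow> y \<in> E \<Longrightarrow> x + y \<in> E" "x \<in> E \<Longrightarrow> y \<in> E \<Longrightarrow> x * y \<in> E"
    "x \<in> E \<Longrightarrow> - x \<in> E" "x \<in> E \<Longrightarrow> inverse x \<in> E" "x \<in> E \<Longrightarrow> y \<in> E \<Longrightarrow> x / y \<in> E"
    using d by (auto simp: divide_inverse)
  show "x - y \<in> E" if "x \<in> E" "y \<in> E"
    using d that by (metis add_uminus_conv_diff)
  show "x \<in> E \<Longrightarrow> x ^ n \<in> E" using d by (induction n) auto
qed

lemma is_subfield_sum: "is_subfield E \<Longrightarrow> (\<And>i. i \<in> J \<Longrightarrow> f i \<in> E) \<Longrightarrow> sum f J \<in> E"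
  by (induction J rule: infinite_finite_induct) (auto simp: is_subfieldD)

lemma is_subfield_of_nat: "is_subfield E \<Longrightarrow> of_nat n \<in> E"
  by (induction n) (auto simp: is_subfieldD)

lemma is_subfield_of_int: "is_subfield E \<Longrightarrow> of_int k \<in> E"
  by (cases k rule: int_cases2) (auto simp: is_subfieldD is_subfield_of_nat)

lemma is_subfield_Rats: "is_subfield E \<Longrightarrow> \<rat> \<subseteq> (E :: 'a::field_char_0 set)"
  by (auto elim!: Rats_cases' simp: is_subfieldD is_subfield_of_int)

lemma ring_on_simps [simp]:
  "carrier (ring_on A) = A" "x \<otimes>\<^bsub>ring_on A\<^esub> y = x * y" "\<one>\<^bsub>ring_on A\<^esub> = 1"
  "\<zero>\<^bsub>ring_on A\<^esub> = 0" "x \<oplus>\<^bsub>ring_on A\<^esub> y = x + y"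
  by (simp_all add: ring_on_def)

lemma cring_ring_on:
  assumes "0 \<in> A" "1 \<in> A" "\<And>x y. x \<in> A \<Longrightarrow> y \<in> A \<Longrightarrow> x + y \<in> A"
    "\<And>x y. x \<in> A \<Longrightarrow> y \<in> A \<Longrightarrow> x * y \<in> A" "\<And>x. x \<in> A \<Longrightarrow> - x \<in> A"
  shows "cring (ring_on A)"
proof (rule cringI)
  show "abelian_group (ring_on A)"
  proof (rule abelian_groupI)
    fix x assume "x \<in> carrier (ring_on A)"
    then show "\<exists>y\<in>carrier (ring_on A). y \<oplus>\<^bsub>ring_on A\<^esub> x = \<zero>\<^bsub>ring_on A\<^esub>"
      using assms by (intro bexI[of _ "- x"]) auto
  qed (use assms in \<open>auto simp: add_ac\<close>)
  show "comm_monoid (ring_on A)"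
    by (rule comm_monoidI) (use assms in \<open>auto simp: mult_ac\<close>)
qed (use assms in \<open>auto simp: distrib_right\<close>)

lemma ring_on_minus:
  assumes "cring (ring_on A)" "x \<in> A" "- x \<in> A"
  shows "\<ominus>\<^bsub>ring_on A\<^esub> x = - x"
proof -
  interpret cring "ring_on A" by fact
  show ?thesis by (rule minus_equality) (use assms in auto)
qed

lemma subfield_ring_onD:
  assumes F: "subfield F (ring_on K)" and K: "cring (ring_on K)"
  shows "F \<subseteq> K" "is_subfield F"
proof -
  interpret cring "ring_on K" by fact
  note sub = subringE[OF subfieldE(1)[OF F]]
  show FK: "F \<subseteq> K" using sub(1) by simp
  have neg: "\<ominus>\<^bsub>ring_on K\<^esub> x = - x" if "x \<in> K" for x
  proof -
    have "x + \<ominus>\<^bsub>ring_on K\<^esub> x = 0" using that r_neg[of x] by simp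
    then show ?thesis by (metis add.inverse_unique)
  qed
  have inv: "inverse x \<in> F" if "x \<in> F" "x \<noteq> 0" for x
  proof -
    have "inv\<^bsub>ring_on K\<^esub> x \<in> F" "x * inv\<^bsub>ring_on K\<^esub> x = 1"
      using subfield_m_inv[OF F, of x] that by auto
    then show ?thesis by (metis inverse_unique)
  qed
  show "is_subfield F" unfolding is_subfield_def
  proof (intro conjI ballI)
    fix x assume x: "x \<in> F"
    show "- x \<in> F" using sub(5)[OF x] neg[of x] x FK by auto
    show "inverse x \<in> F" using inv[OF x] x by (cases "x = 0") auto
  qed (use sub in auto)
qed

lemma number_field_is_subfield: "number_field K \<Longrightarrow> is_subfield K"
  unfolding number_field_def using subfield_ring_onD(2)[of K UNIV] cring_ring_on[of UNIV] by auto

lemma cring_ring_on_subfield: "is_subfield K \<Longrightarrow> cring (ring_on K)"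
  by (rule cring_ring_on) (auto simp: is_subfieldD)

lemma field_ring_on: "is_subfield K \<Longrightarrow> field (ring_on K)"
proof -
  assume K: "is_subfield K"
  interpret cring "ring_on K" by (rule cring_ring_on_subfield) fact
  show ?thesis
  proof (rule cring_fieldI)
    have "x \<in> Units (ring_on K)" if "x \<in> K" "x \<noteq> 0" for x
      unfolding Units_def using that is_subfieldD(6)[OF K that(1)]
      by (auto intro!: bexI[of _ "inverse x"])
    then show "Units (ring_on K) = carrier (ring_on K) - {\<zero>\<^bsub>ring_on K\<^esub>}"
      by (auto simp: Units_def)
  qed
qed

lemma subfield_Rats: "subfield \<rat> (ring_on (UNIV :: 'a::field_char_0 set))"
proof -
  have U: "is_subfield (UNIV :: 'a set)" by (simp add: is_subfield_def)
  interpret field "ring_on (UNIV :: 'a set)" by (rule field_ring_on[OF U])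
  show ?thesis
  proof (rule subfieldI')
    show "subring \<rat> (ring_on (UNIV :: 'a set))"
      by (rule subringI) (auto simp: ring_on_minus cring_ring_on_subfield[OF U])
    fix k :: 'a assume k: "k \<in> \<rat> - {\<zero>\<^bsub>ring_on UNIV\<^esub>}"
    then have "inv\<^bsub>ring_on UNIV\<^esub> k = inverse k" by (intro comm_inv_char) auto
    then show "inv\<^bsub>ring_on UNIV\<^esub> k \<in> \<rat>" using k by simp
  qed
qed


definition polys_over :: "'a::field set \<Rightarrow> 'a poly set" where
  "polys_over E = {p. \<forall>i. coeff p i \<in> E}"

text \<open>
  The degree \<open>n\<close> also bounds the degree of a relation for any \<open>x\<close>, since the \<open>n + 1\<close> powers
  \<open>1, x, \<dots>, x\<^sup>n\<close> are linearly dependent.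
\<close>

lemma number_field_finite_basis:
  assumes "number_field (K :: 'a::field_char_0 set)"
  obtains n :: nat and b where "\<And>i. i < n \<Longrightarrow> b i \<in> K"
    "\<And>x. x \<in> K \<Longrightarrow> \<exists>q. (\<forall>i<n. q i \<in> \<rat>) \<and> x = (\<Sum>i<n. q i * b i)"
    "\<And>x. x \<in> K \<Longrightarrow> \<exists>p\<in>polys_over \<rat>. p \<noteq> 0 \<and> degree p \<le> n \<and> poly p x = 0"
proof -
  have U: "is_subfield (UNIV :: 'a set)" by (simp add: is_subfield_def)
  interpret field "ring_on (UNIV :: 'a set)" by (rule field_ring_on[OF U])
  note Q = subfield_Rats[where 'a = 'a]
  obtain n where dim: "dimension n \<rat> K"
    using assms unfolding number_field_def finite_dimension_def by blast
  obtain Us where Us: "length Us = n" "Span \<rat> Us = K"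
    using exists_base[OF Q dim] by blast
  have comb: "combine Ks Vs = (\<Sum>i<length Ks. Ks ! i * Vs ! i)" if "length Ks = length Vs" for Ks Vs
    using that by (induction Ks Vs rule: list_induct2)
      (simp_all add: sum.lessThan_Suc_shift del: sum.lessThan_Suc)
  show thesis
  proof (rule that[of n "\<lambda>i. Us ! i"])
    have "set Us \<subseteq> K" using Span_base_incl[OF Q, of Us] Us by simp
    then show "Us ! i \<in> K" if "i < n" for i using that Us by auto
    fix x assume x: "x \<in> K"
    then obtain Ks where Ks: "set Ks \<subseteq> \<rat>" "length Ks = length Us" "x = combine Ks Us"
      using Span_mem_iff_length_version[OF Q, of Us x] Us by auto
    then show "\<exists>q. (\<forall>i<n. q i \<in> \<rat>) \<and> x = (\<Sum>i<n. q i * Us ! i)"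
      using Us by (intro exI[of _ "\<lambda>i. Ks ! i"]) (auto simp: comb)
    let ?ps = "map (\<lambda>i. x ^ i) [0..<Suc n]"
    have psK: "set ?ps \<subseteq> K" using x number_field_is_subfield[OF assms] by (auto simp: is_subfieldD)
    have "dependent \<rat> ?ps"
    proof
      assume "independent \<rat> ?ps"
      from independent_length_le_dimension[OF Q dim this psK] show False by simp
    qed
    then obtain Ks where Ks: "length Ks = length ?ps" "combine Ks ?ps = 0" "set Ks \<subseteq> \<rat>" "set Ks \<noteq> {0}"
      using dependent_imp_non_trivial_combine[OF Q, of ?ps] by auto
    have len: "length Ks = Suc n" using Ks by simp
    have "poly (Poly Ks) x = (\<Sum>i<Suc n. Ks ! i * x ^ i)"
    proof -
      have "poly (Poly Ks) x = (\<Sum>i<length Ks. Ks ! i * x ^ i)" for Ks :: "'a list"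
        by (induction Ks) (simp_all add: sum.lessThan_Suc_shift sum_distrib_left algebra_simps del: sum.lessThan_Suc)
      then show ?thesis using len by simp
    qed
    also have "\<dots> = combine Ks ?ps" by (subst comb[OF Ks(1)]) (simp add: len del: upt_Suc)
    finally have root: "poly (Poly Ks) x = 0" using Ks by simp
    have nz: "Poly Ks \<noteq> 0"
    proof
      assume "Poly Ks = 0"
      then have "Ks = replicate (Suc n) 0" using len by (auto simp: Poly_eq_0)
      then show False using Ks(4) by (auto simp: set_replicate)
    qed
    have "Poly Ks \<in> polys_over \<rat>"
      using Ks(3) by (auto simp: polys_over_def coeff_Poly_eq nth_default_def)
    moreover have "degree (Poly Ks) \<le> n"
      by (rule degree_le) (simp add: coeff_Poly_eq nth_default_def len)
    ultimately show "\<exists>p\<in>polys_over \<rat>. p \<noteq> 0 \<and> degree p \<le> n \<and> poly p x = 0" using nz root by blast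
  qed
qed

section \<open>Homomorphisms on a subfield\<close>

text \<open>
  Values outside \<open>E\<close> are arbitrary, so a homomorphism can be viewed on a smaller subfield
  without being changed.
\<close>

definition hom_on :: "'a::field set \<Rightarrow> ('a \<Rightarrow> 'b::field) \<Rightarrow> bool" where
  "hom_on E \<tau> \<longleftrightarrow> \<tau> 1 = 1 \<and> (\<forall>x\<in>E. \<forall>y\<in>E. \<tau> (x + y) = \<tau> x + \<tau> y \<and> \<tau> (x * y) = \<tau> x * \<tau> y)"

lemma hom_onD:
  assumes "hom_on E \<tau>" "is_subfield E"
  shows "\<tau> 1 = 1" "\<tau> 0 = 0" "x \<in> E \<Longrightarrow> y \<in> E \<Longrightarrow> \<tau> (x + y) = \<tau> x + \<tau> y"
    "x \<in> E \<Longrightarrow> y \<in> E \<Longrightarrow> \<tau> (x * y) = \<tau> x * \<tau> y" "x \<in> E \<Longrightarrow> \<tau> (- x) = - \<tau> x"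
    "x \<in> E \<Longrightarrow> y \<in> E \<Longrightarrow> \<tau> (x - y) = \<tau> x - \<tau> y"
    "x \<in> E \<Longrightarrow> \<tau> (inverse x) = inverse (\<tau> x)" "x \<in> E \<Longrightarrow> \<tau> (x ^ n) = \<tau> x ^ n"
    "x \<in> E \<Longrightarrow> \<tau> x = 0 \<longleftrightarrow> x = 0"
proof -
  note d = assms(1)[unfolded hom_on_def]
  show 1: "\<tau> 1 = 1" "x \<in> E \<Longrightarrow> y \<in> E \<Longrightarrow> \<tau> (x + y) = \<tau> x + \<tau> y"
    and mul: "x \<in> E \<Longrightarrow> y \<in> E \<Longrightarrow> \<tau> (x * y) = \<tau> x * \<tau> y" for x y using d by auto
  have "\<tau> (0 + 0) = \<tau> 0 + \<tau> 0" using d is_subfieldD(1)[OF assms(2)] by blast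
  then have "\<tau> 0 + 0 = \<tau> 0 + \<tau> 0" by simp
  then show 0: "\<tau> 0 = 0" by (metis add_left_cancel)
  have neg: "\<tau> (- x) = - \<tau> x" if "x \<in> E" for x
  proof -
    have "\<tau> (x + - x) = \<tau> x + \<tau> (- x)" using d that is_subfieldD(5)[OF assms(2)] by blast
    then show ?thesis using 0 by (simp add: eq_neg_iff_add_eq_0 add.commute)
  qed
  show "x \<in> E \<Longrightarrow> \<tau> (- x) = - \<tau> x" by (rule neg)
  show "\<tau> (x - y) = \<tau> x - \<tau> y" if "x \<in> E" "y \<in> E"
    using d that neg[OF that(2)] is_subfieldD(5)[OF assms(2) that(2)] by (metis add_uminus_conv_diff)
  have inv: "\<tau> x * \<tau> (inverse x) = 1" if "x \<in> E" "x \<noteq> 0" for x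
    using mul[OF that(1) is_subfieldD(6)[OF assms(2) that(1)]] that 1 by simp
  then show "x \<in> E \<Longrightarrow> \<tau> (inverse x) = inverse (\<tau> x)"
    using 0 by (cases "x = 0") (auto intro: inverse_unique[symmetric])
  show "x \<in> E \<Longrightarrow> \<tau> x = 0 \<longleftrightarrow> x = 0" using inv 0 by (cases "x = 0") force+
  show "x \<in> E \<Longrightarrow> \<tau> (x ^ n) = \<tau> x ^ n"
    by (induction n) (auto simp: 1 mul is_subfieldD[OF assms(2)])
qed

lemma hom_on_sum:
  "hom_on E \<tau> \<Longrightarrow> is_subfield E \<Longrightarrow> (\<And>i. i \<in> J \<Longrightarrow> f i \<in> E) \<Longrightarrow> \<tau> (sum f J) = (\<Sum>i\<in>J. \<tau> (f i))"
  by (induction J rule: infinite_finite_induct) (auto simp: hom_onD is_subfield_sum)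

lemma hom_on_of_int: 
  assumes "hom_on E \<tau>" "is_subfield E" shows "\<tau> (of_int k) = of_int k"
proof -
  have nat: "\<tau> (of_nat n) = of_nat n" for n
    by (induction n) (auto simp: hom_onD[OF assms] is_subfieldD[OF assms(2)] is_subfield_of_nat[OF assms(2)])
  show ?thesis
    by (cases k rule: int_cases2)
      (auto simp: nat hom_onD[OF assms] is_subfield_of_nat[OF assms(2)])
qed

lemma hom_on_poly_int:
  fixes x :: "'a::field_char_0"
  assumes "hom_on E \<tau>" "is_subfield E" "x \<in> E"
  shows "\<tau> (poly (map_poly of_int p) x) = poly (map_poly of_int p) (\<tau> x :: 'b::field_char_0)"
proof -
  have "\<tau> (\<Sum>i\<le>degree p. of_int (coeff p i) * x ^ i) = (\<Sum>i\<le>degree p. \<tau> (of_int (coeff p i) * x ^ i))"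
    by (rule hom_on_sum[OF assms(1,2)])
      (intro is_subfieldD(4)[OF assms(2)] is_subfieldD(9)[OF assms(2,3)] is_subfield_of_int[OF assms(2)])
  also have "\<dots> = (\<Sum>i\<le>degree p. of_int (coeff p i) * \<tau> x ^ i)"
    by (intro sum.cong refl)
      (simp add: hom_onD[OF assms(1,2)] hom_on_of_int[OF assms(1,2)] assms(3)
        is_subfieldD(9)[OF assms(2,3)] is_subfield_of_int[OF assms(2)])
  finally show ?thesis by (simp add: poly_altdef degree_map_poly)
qed

lemma hom_on_algebraic_int:
  fixes x :: "'a::field_char_0" and \<tau> :: "'a \<Rightarrow> 'b::field_char_0"
  assumes "hom_on E \<tau>" "is_subfield E" "x \<in> E" "algebraic_int x"
  shows "algebraic_int (\<tau> x)"
proof -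
  obtain p where "poly (map_poly of_int p) x = 0" "lead_coeff p = 1"
    using assms(4) unfolding algebraic_int_altdef_ipoly by blast
  note p = this
  have "poly (map_poly of_int p) (\<tau> x) = \<tau> (poly (map_poly of_int p) x)"
    by (rule hom_on_poly_int[OF assms(1-3), symmetric])
  also have "\<dots> = 0" unfolding p(1) by (rule hom_onD(2)[OF assms(1,2)])
  finally show ?thesis unfolding algebraic_int_altdef_ipoly using p(2) by (intro exI[of _ p] conjI)
qed

lemma embeddings_hom_on: "\<tau> \<in> embeddings K \<Longrightarrow> hom_on K \<tau>"
  by (auto simp: embeddings_def Ring.ring_hom_def hom_on_def)

lemma embeddingsI: "hom_on K \<tau> \<Longrightarrow> is_subfield K \<Longrightarrow> restrict \<tau> K \<in> embeddings K"
  by (auto simp: embeddings_def Ring.ring_hom_def hom_on_def is_subfieldD)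

section \<open>Extension of embeddings\<close>

lemma polys_over_closed:
  assumes "is_subfield E"
  shows "p \<in> polys_over E \<Longrightarrow> q \<in> polys_over E \<Longrightarrow> p + q \<in> polys_over E"
    "p \<in> polys_over E \<Longrightarrow> q \<in> polys_over E \<Longrightarrow> p - q \<in> polys_over E"
    "p \<in> polys_over E \<Longrightarrow> q \<in> polys_over E \<Longrightarrow> p * q \<in> polys_over E"
    "p \<in> polys_over E \<Longrightarrow> - p \<in> polys_over E"
    "c \<in> E \<Longrightarrow> p \<in> polys_over E \<Longrightarrow> smult c p \<in> polys_over E"
    "c \<in> E \<Longrightarrow> monom c n \<in> polys_over E" "c \<in> E \<Longrightarrow> [:c:] \<in> polys_over E"
    "0 \<in> polys_over E" "1 \<in> polys_over E" "[:0, 1:] \<in> polys_over E"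
  by (auto simp: polys_over_def is_subfieldD[OF assms] coeff_mult is_subfield_sum[OF assms]
      coeff_pCons coeff_1 split: nat.splits)

lemma polys_over_division:
  assumes E: "is_subfield E" and m: "m \<in> polys_over E" "lead_coeff m = 1" and p: "p \<in> polys_over E"
  shows "\<exists>q\<in>polys_over E. \<exists>r\<in>polys_over E. p = q * m + r \<and> (r = 0 \<or> degree r < degree m)"
  using p
proof (induction "degree p" arbitrary: p rule: less_induct)
  case less
  note cl = polys_over_closed[OF E]
  show ?case
  proof (cases "p = 0 \<or> degree p < degree m")
    case True
    then show ?thesis using less.prems cl(8) by (intro bexI[of _ 0] bexI[of _ p]) simp_all
  next
    case False
    define h where "h = monom (lead_coeff p) (degree p - degree m)"
    have h: "h \<in> polys_over E" using less.prems cl(6) by (simp add: h_def polys_over_def)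
    define p' where "p' = p - h * m"
    have p': "p' \<in> polys_over E" using less.prems h m cl by (simp add: p'_def)
    have nz: "m \<noteq> 0" "h \<noteq> 0" using m(2) False by (auto simp: h_def)
    have deg: "degree (h * m) = degree p" using nz False by (simp add: degree_mult_eq h_def degree_monom_eq)
    have lc: "lead_coeff (h * m) = lead_coeff p" using m(2) False by (simp add: lead_coeff_mult h_def degree_monom_eq)
    show ?thesis
    proof (cases "p' = 0")
      case True
      then have "p = h * m + 0" by (simp add: p'_def)
      then show ?thesis using h cl(8) by (intro bexI[of _ h] bexI[of _ 0] conjI disjI1) simp_all
    next
      case p'0: False
      have "degree p' \<le> degree p" unfolding p'_def using deg by (intro degree_diff_le) auto
      moreover have "coeff p' (degree p) = 0" using lc deg by (simp add: p'_def)
      ultimately have "degree p' < degree p" using p'0 by (metis leading_coeff_0_iff le_less)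
      from less.hyps[OF this p'] obtain q r where qr: "q \<in> polys_over E" "r \<in> polys_over E"
        "p' = q * m + r" "r = 0 \<or> degree r < degree m" by (elim bexE conjE)
      have "p = (q + h) * m + r" using qr(3) by (simp add: p'_def distrib_right diff_eq_eq)
      with qr cl(1)[OF qr(1) h] show ?thesis by (intro bexI[of _ "q + h"] bexI[of _ r] conjI)
    qed
  qed
qed

text \<open>
  Minimality enters the construction of extensions only through divisibility, which is
  therefore taken as the definition.
\<close>

definition minimal_poly_over :: "'a::field set \<Rightarrow> 'a \<Rightarrow> 'a poly \<Rightarrow> bool" where
  "minimal_poly_over E x m \<longleftrightarrow> m \<in> polys_over E \<and> lead_coeff m = 1 \<and> poly m x = 0 \<and>
     (\<forall>p\<in>polys_over E. poly p x = 0 \<longrightarrow> (\<exists>q\<in>polys_over E. p = q * m))"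

lemma minimal_poly_over_exists:
  assumes E: "is_subfield E" and p: "p \<in> polys_over E" "p \<noteq> 0" "poly p x = 0"
  obtains m where "minimal_poly_over E x m" "degree m \<le> degree p"
proof -
  define P where "P q \<longleftrightarrow> q \<in> polys_over E \<and> q \<noteq> 0 \<and> poly q x = 0" for q
  define m0 where "m0 = (ARG_MIN degree q. P q)"
  have "P p" using p by (simp add: P_def)
  then have m0: "P m0" and min: "degree m0 \<le> degree q" if "P q" for q
    using that unfolding m0_def by (auto intro: arg_min_natI arg_min_nat_le)
  have P0: "P m0" using m0 p \<open>P p\<close> by blast
  define c where "c = inverse (lead_coeff m0)"
  define m where "m = smult c m0"
  have c: "c \<noteq> 0" "c \<in> E" using P0 E by (auto simp: c_def P_def polys_over_def is_subfieldD)
  have m: "m \<in> polys_over E" "lead_coeff m = 1" "poly m x = 0" "degree m = degree m0"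
    using P0 c polys_over_closed(5)[OF E c(2), of m0] by (auto simp: m_def P_def c_def)
  have "\<exists>q\<in>polys_over E. p = q * m" if pp: "p \<in> polys_over E" "poly p x = 0" for p
  proof -
    obtain q r where qr: "q \<in> polys_over E" "r \<in> polys_over E" "p = q * m + r"
      "r = 0 \<or> degree r < degree m" using polys_over_division[OF E m(1,2) pp(1)] by blast
    have "r = 0"
    proof (rule ccontr)
      assume "r \<noteq> 0"
      then have "P r" using qr pp m(3) by (auto simp: P_def)
      then show False using min[of r] qr(4) \<open>r \<noteq> 0\<close> m(4) by auto
    qed
    then show ?thesis using qr by auto
  qed
  then show thesis using m min[OF \<open>P p\<close>] by (intro that[of m]) (auto simp: minimal_poly_over_def)
qed

lemma map_poly_hom_on:
  assumes "hom_on E \<tau>" "is_subfield E" "p \<in> polys_over E" "q \<in> polys_over E"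
  shows "map_poly \<tau> (p + q) = map_poly \<tau> p + map_poly \<tau> q"
    "map_poly \<tau> (p * q) = map_poly \<tau> p * map_poly \<tau> q"
    "map_poly \<tau> (p - q) = map_poly \<tau> p - map_poly \<tau> q"
  using assms(3,4)
  by (auto intro!: poly_eqI sum.cong simp: coeff_map_poly hom_onD[OF assms(1,2)] polys_over_def coeff_mult
      hom_on_sum[OF assms(1,2)] is_subfieldD[OF assms(2)])

text \<open>
  Cancelling powers of \<open>y\<close> in a relation for \<open>y\<close> gives \<open>a + y * poly r y = 0\<close> with \<open>a \<noteq> 0\<close>, which can
  be solved for the inverse.
\<close>

lemma algebraic_inverse:
  assumes E: "is_subfield E" and p: "p \<in> polys_over E" "p \<noteq> 0" "poly p y = 0" and y: "y \<noteq> 0"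
  obtains q where "q \<in> polys_over E" "inverse y = poly q y"
proof -
  have "\<exists>q\<in>polys_over E. inverse y = poly q y"
    using p
  proof (induction "degree p" arbitrary: p rule: less_induct)
    case less
    obtain a r where ar: "p = pCons a r" by (cases p)
    have a: "a \<in> E" and r: "r \<in> polys_over E"
      using less.prems(1) unfolding polys_over_def ar by (auto simp: coeff_pCons split: nat.splits dest: spec[of _ 0] spec[of _ "Suc _"])
    show ?case
    proof (cases "a = 0")
      case True
      then have "r \<noteq> 0" "poly r y = 0" using less.prems y by (auto simp: ar)
      moreover from this have "degree r < degree p" by (simp add: ar)
      ultimately show ?thesis using less.hyps r by blast
    next
      case False
      have "a + y * poly r y = 0" using less.prems by (simp add: ar)
      then have "y * poly r y = - a" by (simp add: eq_neg_iff_add_eq_0 add.commute)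
      then have "y * poly (smult (- inverse a) r) y = 1" using False by (simp add: field_simps)
      then have "inverse y = poly (smult (- inverse a) r) y" by (rule inverse_unique)
      moreover have "smult (- inverse a) r \<in> polys_over E"
        using r a by (auto simp: polys_over_def is_subfieldD[OF E])
      ultimately show ?thesis by blast
    qed
  qed
  then show thesis using that by blast
qed

text \<open>
  The field \<open>E'\<close> consists of the values at \<open>x\<close> of polynomials over \<open>E\<close>, and \<open>\<tau>'\<close> sends \<open>poly p x\<close> to the
  value at \<open>z\<close> of the image of \<open>p\<close> under \<open>\<tau>\<close>. This does not depend on \<open>p\<close>: two choices differ by a
  multiple of \<open>m\<close>, and \<open>z\<close> is a root of the image of \<open>m\<close>.
\<close>

lemma extend_hom_simple:
  fixes \<tau> :: "'a::field_char_0 \<Rightarrow> 'b::field"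
  assumes K: "is_subfield K" "\<And>y. y \<in> K \<Longrightarrow> \<exists>p\<in>polys_over \<rat>. p \<noteq> 0 \<and> poly p y = 0"
    and E: "is_subfield E" "E \<subseteq> K" "hom_on E \<tau>" and x: "x \<in> K"
    and m: "minimal_poly_over E x m" and z: "poly (map_poly \<tau> m) z = 0"
  obtains E' \<tau>' where "is_subfield E'" "E \<subseteq> E'" "E' \<subseteq> K" "x \<in> E'" "hom_on E' \<tau>'"
    "\<And>y. y \<in> E \<Longrightarrow> \<tau>' y = \<tau> y" "\<tau>' x = z"
proof -
  note cl = polys_over_closed[OF E(1)]
  define E' where "E' = (\<lambda>p. poly p x) ` polys_over E"
  define rep where "rep y = (SOME p. p \<in> polys_over E \<and> poly p x = y)" for y
  have rep: "rep y \<in> polys_over E" "poly (rep y) x = y" if "y \<in> E'" for y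
    using that someI_ex[of "\<lambda>p. p \<in> polys_over E \<and> poly p x = y"] unfolding rep_def E'_def by auto
  define \<tau>' where "\<tau>' y = poly (map_poly \<tau> (rep y)) z" for y
  have eval: "\<tau>' (poly p x) = poly (map_poly \<tau> p) z" if p: "p \<in> polys_over E" for p
  proof -
    let ?r = "rep (poly p x)"
    have r: "?r \<in> polys_over E" "poly ?r x = poly p x" using rep[of "poly p x"] p by (auto simp: E'_def)
    then obtain q where q: "q \<in> polys_over E" "?r - p = q * m"
      using m cl(2)[OF r(1) p] unfolding minimal_poly_over_def by fastforce
    have mE: "m \<in> polys_over E" using m by (simp add: minimal_poly_over_def)
    have "map_poly \<tau> ?r - map_poly \<tau> p = map_poly \<tau> q * map_poly \<tau> m"
      using map_poly_hom_on(3)[OF E(3,1) r(1) p] map_poly_hom_on(2)[OF E(3,1) q(1) mE] q(2) by simp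
    then have "poly (map_poly \<tau> ?r - map_poly \<tau> p) z = 0" using z by simp
    then show ?thesis by (simp add: \<tau>'_def)
  qed
  have E'I: "poly p x \<in> E'" if "p \<in> polys_over E" for p using that by (simp add: E'_def)
  have E'K: "E' \<subseteq> K"
  proof
    fix y assume "y \<in> E'"
    then obtain p where p: "p \<in> polys_over E" "y = poly p x" by (auto simp: E'_def)
    then have "\<And>i. coeff p i \<in> K" using E(2) by (auto simp: polys_over_def)
    then show "y \<in> K" unfolding p(2) poly_altdef
      by (intro is_subfield_sum[OF K(1)] is_subfieldD(4)[OF K(1)] is_subfieldD(9)[OF K(1) x])
  qed
  have "inverse y \<in> E'" if y: "y \<in> E'" for y
  proof (cases "y = 0")
    case True
    then show ?thesis using y by simp
  next
    case False
    obtain p where p: "p \<in> polys_over \<rat>" "p \<noteq> 0" "poly p y = 0" using K(2)[of y] y E'K by blast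
    have "p \<in> polys_over E" using p(1) is_subfield_Rats[OF E(1)] by (auto simp: polys_over_def)
    from algebraic_inverse[OF E(1) this p(2,3) False] obtain q where
      q: "q \<in> polys_over E" "inverse y = poly q y" .
    have "pcompose q (rep y) \<in> polys_over E"
      using q(1)
    proof (induction q)
      case (pCons a q)
      then have "a \<in> E" "q \<in> polys_over E"
        unfolding polys_over_def by (auto simp: coeff_pCons split: nat.splits dest: spec[of _ 0] spec[of _ "Suc _"])
      then show ?case using pCons.IH rep(1)[OF y] cl by (simp add: pcompose_pCons)
    qed (simp add: cl)
    from E'I[OF this] show ?thesis using q(2) rep(2)[OF y] by (simp add: poly_pcompose)
  qed
  note inv = this
  have sub: "is_subfield E'" unfolding is_subfield_def
  proof (intro conjI ballI)
    show "0 \<in> E'" "1 \<in> E'" using E'I[OF cl(8)] E'I[OF cl(9)] by simp_all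
    fix y assume y: "y \<in> E'"
    then obtain p where p: "p \<in> polys_over E" "y = poly p x" by (auto simp: E'_def)
    show "inverse y \<in> E'" using y by (rule inv)
    show "- y \<in> E'" using E'I[OF cl(4)[OF p(1)]] p(2) by simp
    fix w assume "w \<in> E'"
    then obtain q where q: "q \<in> polys_over E" "w = poly q x" by (auto simp: E'_def)
    show "y + w \<in> E'" "y * w \<in> E'"
      using E'I[OF cl(1)[OF p(1) q(1)]] E'I[OF cl(3)[OF p(1) q(1)]] p(2) q(2) by simp_all
  qed
  have hom: "hom_on E' \<tau>'"
    unfolding hom_on_def
  proof (intro conjI ballI)
    show "\<tau>' 1 = 1" using eval[OF cl(9)] hom_onD(1)[OF E(3,1)] by (simp add: map_poly_1)
    fix y w assume "y \<in> E'" "w \<in> E'"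
    then obtain p q where pq: "p \<in> polys_over E" "y = poly p x" "q \<in> polys_over E" "w = poly q x"
      by (auto simp: E'_def)
    show "\<tau>' (y + w) = \<tau>' y + \<tau>' w" "\<tau>' (y * w) = \<tau>' y * \<tau>' w"
      using eval[OF cl(1)[OF pq(1,3)]] eval[OF cl(3)[OF pq(1,3)]] eval[OF pq(1)] eval[OF pq(3)]
        map_poly_hom_on[OF E(3,1) pq(1,3)] by (simp_all add: pq)
  qed
  have \<tau>: "\<tau>' y = \<tau> y" if "y \<in> E" for y
  proof -
    have "map_poly \<tau> [:y:] = [:\<tau> y:]"
      by (rule poly_eqI) (simp add: coeff_map_poly coeff_pCons hom_onD(2)[OF E(3,1)] split: nat.splits)
    then show ?thesis using eval[OF cl(7)[OF that]] by simp
  qed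
  have xz: "\<tau>' x = z"
    using eval[OF cl(10)] hom_onD(1,2)[OF E(3,1)] by (simp add: map_poly_pCons)
  show thesis
    by (rule that[OF sub _ E'K _ hom \<tau> xz]) (use E'I[OF cl(7)] E'I[OF cl(10)] in auto)
qed

text \<open>
  The elements of a basis of \<open>K\<close> are adjoined one after the other. Each step needs a root of a
  nonconstant complex polynomial.
\<close>

lemma extend_hom:
  fixes \<tau> :: "'a::field_char_0 \<Rightarrow> complex"
  assumes K: "number_field K" and E: "is_subfield E" "E \<subseteq> K" "hom_on E \<tau>"
  obtains \<tau>' where "\<tau>' \<in> embeddings K" "\<And>y. y \<in> E \<Longrightarrow> \<tau>' y = \<tau> y"
proof -
  obtain n b where b: "\<And>i. i < (n::nat) \<Longrightarrow> b i \<in> K"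
    "\<And>x. x \<in> K \<Longrightarrow> \<exists>q. (\<forall>i<n. q i \<in> \<rat>) \<and> x = (\<Sum>i<n. q i * b i)"
    and alg: "\<And>x. x \<in> K \<Longrightarrow> \<exists>p\<in>polys_over \<rat>. p \<noteq> 0 \<and> degree p \<le> n \<and> poly p x = 0"
    using number_field_finite_basis[OF K] by blast
  note Ks = number_field_is_subfield[OF K]
  have "\<exists>E' \<tau>'. is_subfield E' \<and> E \<subseteq> E' \<and> E' \<subseteq> K \<and> b ` {..<k} \<subseteq> E' \<and> hom_on E' \<tau>' \<and> (\<forall>y\<in>E. \<tau>' y = \<tau> y)"
    if "k \<le> n" for k
    using that
  proof (induction k)
    case 0
    then show ?case using E by (intro exI[of _ E] exI[of _ \<tau>]) auto
  next
    case (Suc k)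
    then obtain E' \<tau>' where E': "is_subfield E'" "E \<subseteq> E'" "E' \<subseteq> K" "b ` {..<k} \<subseteq> E'" "hom_on E' \<tau>'"
      "\<forall>y\<in>E. \<tau>' y = \<tau> y" by auto
    have bk: "b k \<in> K" using b Suc.prems by simp
    obtain p where "p \<in> polys_over \<rat>" "p \<noteq> 0" "poly p (b k) = 0" using alg[OF bk] by blast
    moreover from this have "p \<in> polys_over E'" using is_subfield_Rats[OF E'(1)] by (auto simp: polys_over_def)
    ultimately obtain m where m: "minimal_poly_over E' (b k) m"
      using minimal_poly_over_exists[OF E'(1)] by metis
    have lm: "lead_coeff m = 1" "poly m (b k) = 0" using m by (auto simp: minimal_poly_over_def)
    have "degree m \<noteq> 0"
    proof
      assume "degree m = 0"
      then obtain c where "m = [:c:]" by (rule degree_eq_zeroE)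
      then show False using lm by auto
    qed
    moreover have "degree (map_poly \<tau>' m) = degree m"
      by (rule degree_map_poly) (use lm hom_onD(1)[OF E'(5,1)] in auto)
    ultimately obtain z where "poly (map_poly \<tau>' m) z = 0"
      using fundamental_theorem_of_algebra[of "map_poly \<tau>' m"] by (auto simp: constant_degree)
    then obtain E'' \<tau>'' where E'': "is_subfield E''" "E' \<subseteq> E''" "E'' \<subseteq> K" "b k \<in> E''" "hom_on E'' \<tau>''"
      "\<And>y. y \<in> E' \<Longrightarrow> \<tau>'' y = \<tau>' y"
      using extend_hom_simple[OF Ks _ E'(1,3,5) bk m] alg by metis
    show ?case
      by (intro exI[of _ E''] exI[of _ \<tau>''] conjI) (use E' E'' in \<open>auto simp: lessThan_Suc\<close>)
  qed
  from this[of n] obtain E' \<tau>' where E': "is_subfield E'" "E \<subseteq> E'" "E' \<subseteq> K" "b ` {..<n} \<subseteq> E'" "hom_on E' \<tau>'"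
      "\<forall>y\<in>E. \<tau>' y = \<tau> y" by auto
  have "K \<subseteq> E'"
  proof
    fix x assume "x \<in> K"
    then obtain q where q: "\<forall>i<n. q i \<in> \<rat>" "x = (\<Sum>i<n. q i * b i)" using b(2) by blast
    show "x \<in> E'" unfolding q(2) using q(1) E'(4) is_subfield_Rats[OF E'(1)]
      by (intro is_subfield_sum[OF E'(1)] is_subfieldD(4)[OF E'(1)]) auto
  qed
  with E' have "hom_on K \<tau>'" by (metis subset_antisym)
  then have "restrict \<tau>' K \<in> embeddings K" using Ks by (rule embeddingsI)
  then show thesis by (rule that) (use E' E(2) in auto)
qed

text \<open>
  The embedding of the rational numbers of the ambient field, from which all embeddings of
  number fields are extended.
\<close>

definition rat_hom :: "'a::field_char_0 \<Rightarrow> complex" where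
  "rat_hom x = of_rat (THE r. x = of_rat r)"

lemma rat_hom_of_rat [simp]: "rat_hom (of_rat r) = of_rat r"
  unfolding rat_hom_def by simp

lemma hom_on_Rats: "hom_on \<rat> rat_hom"
  unfolding hom_on_def
  by (auto elim!: Rats_cases simp flip: of_rat_add of_rat_mult) (metis of_rat_1 rat_hom_of_rat)

lemma is_subfield_Rats_set: "is_subfield (\<rat> :: 'a::field_char_0 set)"
  by (simp add: is_subfield_def)

lemma embeddings_nonempty: "number_field K \<Longrightarrow> embeddings K \<noteq> {}"
  using extend_hom[of K \<rat> rat_hom] is_subfield_Rats_set hom_on_Rats is_subfield_Rats number_field_is_subfield
  by (metis empty_iff)

section \<open>Algebraic integers with bounded conjugates\<close>

lemma coeff_prod_linear_bound:
  fixes A :: "complex multiset"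
  assumes "\<And>z. z \<in># A \<Longrightarrow> norm z \<le> C" "C \<ge> 0"
  shows "norm (coeff (\<Prod>z\<in>#A. [:- z, 1:]) i) \<le> (1 + C) ^ size A"
  using assms(1)
proof (induction A arbitrary: i)
  case empty
  then show ?case by (cases i) auto
next
  case (add z A)
  let ?q = "\<Prod>z\<in>#A. [:- z, 1:]"
  have IH: "norm (coeff ?q j) \<le> (1 + C) ^ size A" for j using add by auto
  have c: "norm (case i of 0 \<Rightarrow> 0 | Suc j \<Rightarrow> coeff ?q j) \<le> (1 + C) ^ size A"
    using IH assms(2) by (cases i) auto
  have "coeff (\<Prod>z\<in>#add_mset z A. [:- z, 1:]) i = - z * coeff ?q i + (case i of 0 \<Rightarrow> 0 | Suc j \<Rightarrow> coeff ?q j)"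
    by (simp add: coeff_pCons)
  also have "norm \<dots> \<le> norm (- z * coeff ?q i) + norm (case i of 0 \<Rightarrow> 0 | Suc j \<Rightarrow> coeff ?q j)"
    by (rule norm_triangle_ineq)
  also have "\<dots> \<le> C * (1 + C) ^ size A + (1 + C) ^ size A"
    unfolding norm_mult norm_minus_cancel
    using add.prems[of z] assms(2) IH c by (intro add_mono mult_mono) simp_all
  also have "\<dots> = (1 + C) ^ size (add_mset z A)" by (simp add: distrib_right add.commute)
  finally show ?case .
qed

lemma algebraic_int_coeff_prod_linear:
  fixes A :: "'a::field_char_0 multiset"
  assumes "\<And>z. z \<in># A \<Longrightarrow> algebraic_int z"
  shows "algebraic_int (coeff (\<Prod>z\<in>#A. [:- z, 1:]) i)"
  using assms
proof (induction A arbitrary: i)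
  case empty
  then show ?case by (cases i) (auto intro: int_imp_algebraic_int)
next
  case (add z A)
  then show ?case
    by (auto simp: coeff_pCons split: nat.splits intro!: algebraic_int_diff algebraic_int_times)
qed

lemma finite_bounded_int_polys:
  "finite {p :: int poly. degree p \<le> n \<and> (\<forall>i. \<bar>coeff p i\<bar> \<le> B)}"
proof (rule finite_subset)
  show "{p :: int poly. degree p \<le> n \<and> (\<forall>i. \<bar>coeff p i\<bar> \<le> B)}
      \<subseteq> Poly ` {xs. set xs \<subseteq> {-B..B} \<and> length xs = Suc n}"
  proof
    fix p :: "int poly" assume p: "p \<in> {p. degree p \<le> n \<and> (\<forall>i. \<bar>coeff p i\<bar> \<le> B)}"
    have "p = Poly (map (coeff p) [0..<Suc n])"
      using p by (intro poly_eqI) (auto simp: coeff_Poly_eq nth_default_def coeff_eq_0 simp del: upt_Suc)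
    moreover have "coeff p i \<in> {-B..B}" for i using p by (simp add: abs_le_iff minus_le_iff)
    then have "set (map (coeff p) [0..<Suc n]) \<subseteq> {-B..B}" by auto
    ultimately show "p \<in> Poly ` {xs. set xs \<subseteq> {-B..B} \<and> length xs = Suc n}" by (intro image_eqI[of _ _ "map (coeff p) [0..<Suc n]"]) (simp_all del: upt_Suc set_upt set_map)
  qed
qed (intro finite_imageI finite_lists_length_eq, simp)

text \<open>
  Northcott's theorem. Let \<open>m\<close> be the minimal polynomial of \<open>x\<close> over the rationals. Each complex
  root \<open>z\<close> of \<open>m\<close> is \<open>\<tau> x\<close> for an embedding \<open>\<tau>\<close> of \<open>K\<close>: first extend the embedding of the rationals by
  \<open>x \<mapsto> z\<close>, then extend to \<open>K\<close>. So the roots are algebraic integers of absolute value at most \<open>C\<close>.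
  Expanding \<open>m\<close> as a product of linear factors shows that its coefficients are bounded, and that
  they are algebraic integers; being rational, they are integers. Only finitely many
  polynomials remain.
\<close>

lemma finite_bounded_algebraic_ints:
  assumes K: "number_field K"
  shows "finite {x \<in> K. algebraic_int x \<and> (\<forall>\<tau>\<in>embeddings K. norm (\<tau> x) \<le> C)}"
proof -
  obtain n :: nat where n: "\<And>x. x \<in> K \<Longrightarrow> \<exists>p\<in>polys_over \<rat>. p \<noteq> 0 \<and> degree p \<le> n \<and> poly p x = 0"
    using number_field_finite_basis[OF K] by metis
  note Ks = number_field_is_subfield[OF K]
  define D where "D = max C 0"
  define Ps where "Ps = {p :: int poly. degree p \<le> n \<and> (\<forall>i. \<bar>coeff p i\<bar> \<le> \<lceil>(1 + D) ^ n\<rceil>)}"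
  have "{x \<in> K. algebraic_int x \<and> (\<forall>\<tau>\<in>embeddings K. norm (\<tau> x) \<le> C)} \<subseteq>
      (\<Union>p\<in>Ps - {0}. {x. poly (map_poly of_int p) x = 0})"
  proof
    fix x assume "x \<in> {x \<in> K. algebraic_int x \<and> (\<forall>\<tau>\<in>embeddings K. norm (\<tau> x) \<le> C)}"
    then have x: "x \<in> K" "algebraic_int x" "\<And>\<tau>. \<tau> \<in> embeddings K \<Longrightarrow> norm (\<tau> x) \<le> C" by auto
    obtain p where p: "p \<in> polys_over \<rat>" "p \<noteq> 0" "degree p \<le> n" "poly p x = 0" using n[OF x(1)] by blast
    obtain m where m: "minimal_poly_over \<rat> x m" and deg: "degree m \<le> degree p"
      using minimal_poly_over_exists[OF is_subfield_Rats_set p(1,2,4)] by blast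
    have m': "m \<in> polys_over \<rat>" "lead_coeff m = 1" "poly m x = 0" using m by (auto simp: minimal_poly_over_def)
    define M where "M = map_poly rat_hom m"
    have rh: "rat_hom (0::'a) = 0" "rat_hom (1::'a) = 1"
      using hom_onD[OF hom_on_Rats is_subfield_Rats_set] by auto
    have dM: "degree M = degree m" unfolding M_def by (rule degree_map_poly) (use m'(2) rh in auto)
    have M1: "lead_coeff M = 1" by (simp add: dM) (simp add: M_def coeff_map_poly rh m'(2))
    have root: "norm z \<le> D \<and> algebraic_int z" if z: "poly M z = 0" for z
    proof -
      obtain E' \<tau>' where E': "is_subfield E'" "E' \<subseteq> K" "x \<in> E'" "hom_on E' \<tau>'" "\<tau>' x = z"
        using extend_hom_simple[OF Ks _ is_subfield_Rats_set is_subfield_Rats[OF Ks] hom_on_Rats x(1) m] z n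
        unfolding M_def by metis
      obtain \<tau> where \<tau>: "\<tau> \<in> embeddings K" "\<tau> x = z"
        using extend_hom[OF K E'(1,2,4)] E'(3,5) by metis
      show ?thesis
        using x(3)[OF \<tau>(1)] hom_on_algebraic_int[OF embeddings_hom_on[OF \<tau>(1)] Ks x(1,2)]
        by (simp add: \<tau>(2) D_def)
    qed
    have "M \<noteq> 0" using M1 by auto
    then obtain A where A: "size A = degree M" "M = (\<Prod>z\<in>#A. [:- z, 1:])"
      using alg_closed_imp_factorization[of M] M1 by auto
    have Aroot: "poly M z = 0" if "z \<in># A" for z
      using that unfolding A(2) by (auto simp: poly_prod_mset prod_mset_zero_iff)
    have bound: "norm (coeff M i) \<le> (1 + D) ^ n" for i
    proof -
      have "norm (coeff M i) \<le> (1 + D) ^ size A"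
        unfolding A(2) by (rule coeff_prod_linear_bound) (use root Aroot in \<open>auto simp: D_def\<close>)
      also have "\<dots> \<le> (1 + D) ^ n" using A(1) dM deg p(3) by (intro power_increasing) (auto simp: D_def)
      finally show ?thesis .
    qed
    have "\<exists>c::int. coeff m i = of_int c \<and> coeff M i = of_int c" for i
    proof -
      have "coeff m i \<in> \<rat>" using m'(1) by (simp add: polys_over_def)
      then obtain r where r: "coeff m i = of_rat r" by (auto elim: Rats_cases)
      then have Mr: "coeff M i = of_rat r" by (simp add: M_def coeff_map_poly rh)
      have "algebraic_int (coeff M i)"
        unfolding A(2) by (rule algebraic_int_coeff_prod_linear) (use root Aroot in auto)
      then have "coeff M i \<in> \<int>" using rational_algebraic_int_is_int[of "coeff M i"] Mr by simp
      then obtain c where c: "coeff M i = of_int c" by (auto elim: Ints_cases)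
      then have "of_rat r = (of_rat (of_int c) :: complex)" using Mr by simp
      then have "r = of_int c" by (simp only: of_rat_eq_iff)
      then show ?thesis using r c by auto
    qed
    then obtain c :: "nat \<Rightarrow> int" where c: "\<And>i. coeff m i = of_int (c i)" "\<And>i. coeff M i = of_int (c i)" by metis
    define g where "g = Poly (map c [0..<Suc n])"
    have cg: "coeff g i = c i" for i
    proof -
      have "c i = 0" if "i > n"
        using that c(1)[of i] deg p(3) by (simp add: coeff_eq_0)
      then show ?thesis by (auto simp: g_def coeff_Poly_eq nth_default_def simp del: upt_Suc)
    qed
    have gm: "map_poly of_int g = m" by (rule poly_eqI) (simp add: coeff_map_poly cg c)
    have "\<bar>coeff g i\<bar> \<le> \<lceil>(1 + D) ^ n\<rceil>" for i
    proof -
      have "real_of_int \<bar>c i\<bar> \<le> (1 + D) ^ n" using bound[of i] by (simp add: c(2))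
      then show ?thesis unfolding cg by linarith
    qed
    moreover have "degree g \<le> n" by (rule degree_le) (simp add: g_def coeff_Poly_eq nth_default_def)
    moreover have "g \<noteq> 0" using gm m'(2) by auto
    ultimately show "x \<in> (\<Union>p\<in>Ps - {0}. {x. poly (map_poly of_int p) x = 0})"
      using gm m'(3) by (auto simp: Ps_def)
  qed
  moreover have "finite (\<Union>p\<in>Ps - {0}. {x::'a. poly (map_poly of_int p) x = 0})"
  proof (intro finite_UN_I finite_Diff)
    show "finite Ps" unfolding Ps_def by (rule finite_bounded_int_polys)
    fix p :: "int poly" assume "p \<in> Ps - {0}"
    then have "map_poly of_int p \<noteq> (0 :: 'a poly)" by (auto simp: poly_eq_iff coeff_map_poly)
    then show "finite {x::'a. poly (map_poly of_int p) x = 0}" by (rule poly_roots_finite)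
  qed
  ultimately show ?thesis by (rule finite_subset)
qed

text \<open>
  Kronecker's theorem: the powers of \<open>x\<close> lie in a finite set, so two of them coincide.
\<close>

lemma root_of_unity_of_norm_1:
  assumes K: "number_field K" and x: "x \<in> K" "algebraic_int x" "\<And>\<tau>. \<tau> \<in> embeddings K \<Longrightarrow> norm (\<tau> x) = 1"
  shows "x \<in> roots_of_unity K"
proof -
  note Ks = number_field_is_subfield[OF K]
  have "x ^ i \<in> {x \<in> K. algebraic_int x \<and> (\<forall>\<tau>\<in>embeddings K. norm (\<tau> x) \<le> 1)}" for i :: nat
    using x by (auto simp: is_subfieldD[OF Ks] algebraic_int_pow norm_power
        hom_onD(8)[OF embeddings_hom_on Ks])
  then have "range (\<lambda>i::nat. x ^ i) \<subseteq> {x \<in> K. algebraic_int x \<and> (\<forall>\<tau>\<in>embeddings K. norm (\<tau> x) \<le> 1)}" by blast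
  then have "finite (range (\<lambda>i::nat. x ^ i))"
    using finite_bounded_algebraic_ints[OF K] finite_subset by blast
  then have "\<not> inj (\<lambda>i::nat. x ^ i)" using finite_imageD infinite_UNIV_nat by blast
  then obtain i j :: nat where ij: "i < j" "x ^ i = x ^ j"
    by (metis (mono_tags, lifting) injI linorder_neqE_nat)
  obtain \<tau> where "\<tau> \<in> embeddings K" using embeddings_nonempty[OF K] by blast
  then have "x \<noteq> 0" using x(3)[of \<tau>] hom_onD(2)[OF embeddings_hom_on[of \<tau>] Ks] by auto
  moreover have "x ^ i * x ^ (j - i) = x ^ (i + (j - i))" by (rule power_add[symmetric])
  then have "x ^ i * x ^ (j - i) = x ^ i * 1" using ij by simp
  ultimately have "x ^ (j - i) = 1" by simp
  then show ?thesis using ij x(1) by (auto simp: roots_of_unity_def intro!: exI[of _ "j - i"])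
qed

lemma algebraic_int_root_of_unity: "x ^ n = 1 \<Longrightarrow> n > 0 \<Longrightarrow> algebraic_int (x::'a::field_char_0)"
proof (rule algebraic_int.intros[of "monom 1 n - 1"])
  assume n: "x ^ n = 1" "n > 0"
  have "degree (monom 1 n - 1 :: 'a poly) = n"
    using n(2) degree_add_eq_left[of "- 1" "monom 1 n :: 'a poly"] by (simp add: degree_monom_eq)
  then show "lead_coeff (monom 1 n - 1 :: 'a poly) = 1" using n(2) by (simp add: coeff_1)
  show "poly (monom 1 n - 1) x = 0" using n by (simp add: poly_monom)
qed (auto simp: coeff_1)

lemma finite_roots_of_unity: "number_field K \<Longrightarrow> finite (roots_of_unity K)"
proof -
  assume K: "number_field K"
  note Ks = number_field_is_subfield[OF K]
  have "roots_of_unity K \<subseteq> {x \<in> K. algebraic_int x \<and> (\<forall>\<tau>\<in>embeddings K. norm (\<tau> x) \<le> 1)}"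
  proof
    fix x assume "x \<in> roots_of_unity K"
    then obtain n where n: "x \<in> K" "n > 0" "x ^ n = 1" by (auto simp: roots_of_unity_def)
    have "norm (\<tau> x) \<le> 1" if "\<tau> \<in> embeddings K" for \<tau>
    proof -
      have "\<tau> x ^ n = \<tau> (x ^ n)" by (rule hom_onD(8)[symmetric, OF embeddings_hom_on[OF that] Ks n(1)])
      also have "\<dots> = 1" unfolding n(3) by (rule hom_onD(1)[OF embeddings_hom_on[OF that] Ks])
      finally have "norm (\<tau> x) ^ n \<le> 1" by (simp flip: norm_power)
      then show ?thesis using n(2) by (simp add: power_le_one_iff)
    qed
    moreover have "algebraic_int x" using n algebraic_int_root_of_unity by blast
    ultimately show "x \<in> {x \<in> K. algebraic_int x \<and> (\<forall>\<tau>\<in>embeddings K. norm (\<tau> x) \<le> 1)}"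
      using n by blast
  qed
  then show ?thesis using finite_bounded_algebraic_ints[OF K] finite_subset by blast
qed

section \<open>Prime ideals\<close>

definition is_subring :: "'a::comm_ring_1 set \<Rightarrow> bool" where
  "is_subring R \<longleftrightarrow> 0 \<in> R \<and> 1 \<in> R \<and> (\<forall>x\<in>R. - x \<in> R) \<and> (\<forall>x\<in>R. \<forall>y\<in>R. x + y \<in> R \<and> x * y \<in> R)"

definition ideal_in :: "'a::comm_ring_1 set \<Rightarrow> 'a set \<Rightarrow> bool" where
  "ideal_in R I \<longleftrightarrow> I \<subseteq> R \<and> 0 \<in> I \<and> (\<forall>x\<in>I. \<forall>y\<in>I. x + y \<in> I) \<and> (\<forall>r\<in>R. \<forall>x\<in>I. r * x \<in> I)"

definition prime_in :: "'a::comm_ring_1 set \<Rightarrow> 'a set \<Rightarrow> bool" where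
  "prime_in R P \<longleftrightarrow> ideal_in R P \<and> 1 \<notin> P \<and> (\<forall>a\<in>R. \<forall>b\<in>R. a * b \<in> P \<longrightarrow> a \<in> P \<or> b \<in> P)"

lemma is_subringD:
  assumes "is_subring R"
  shows "0 \<in> R" "1 \<in> R" "x \<in> R \<Longrightarrow> - x \<in> R" "x \<in> R \<Longrightarrow> y \<in> R \<Longrightarrow> x + y \<in> R"
    "x \<in> R \<Longrightarrow> y \<in> R \<Longrightarrow> x * y \<in> R" "x \<in> R \<Longrightarrow> y \<in> R \<Longrightarrow> x - y \<in> R" "x \<in> R \<Longrightarrow> x ^ n \<in> R"
proof -
  note d = assms[unfolded is_subring_def]
  show "0 \<in> R" "1 \<in> R" "x \<in> R \<Longrightarrow> - x \<in> R" "x \<in> R \<Longrightarrow> y \<in> R \<Longrightarrow> x + y \<in> R"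
    "x \<in> R \<Longrightarrow> y \<in> R \<Longrightarrow> x * y \<in> R" using d by auto
  show "x - y \<in> R" if "x \<in> R" "y \<in> R"
    using d that by (metis add_uminus_conv_diff)
  show "x \<in> R \<Longrightarrow> x ^ n \<in> R" using d by (induction n) auto
qed

lemma cring_ring_on_subring: "is_subring R \<Longrightarrow> cring (ring_on R)"
  by (rule cring_ring_on) (auto simp: is_subringD)

lemma ideal_inD:
  assumes "ideal_in R I" 
  shows "x \<in> I \<Longrightarrow> x \<in> R" "0 \<in> I" "x \<in> I \<Longrightarrow> y \<in> I \<Longrightarrow> x + y \<in> I"
    "r \<in> R \<Longrightarrow> x \<in> I \<Longrightarrow> r * x \<in> I" "r \<in> R \<Longrightarrow> x \<in> I \<Longrightarrow> x * r \<in> I"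
    "is_subring R \<Longrightarrow> x \<in> I \<Longrightarrow> - x \<in> I" "is_subring R \<Longrightarrow> x \<in> I \<Longrightarrow> y \<in> I \<Longrightarrow> x - y \<in> I"
proof -
  note d = assms[unfolded ideal_in_def]
  show "x \<in> I \<Longrightarrow> x \<in> R" "0 \<in> I" "x \<in> I \<Longrightarrow> y \<in> I \<Longrightarrow> x + y \<in> I"
    "r \<in> R \<Longrightarrow> x \<in> I \<Longrightarrow> r * x \<in> I" using d by auto
  show "r \<in> R \<Longrightarrow> x \<in> I \<Longrightarrow> x * r \<in> I" using d by (simp add: mult.commute)
  have neg: "- x \<in> I" if "is_subring R" "x \<in> I" for x
  proof -
    have "- 1 \<in> R" using that by (simp add: is_subringD)
    then have "- 1 * x \<in> I" using d that by blast
    then show ?thesis by simp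
  qed
  then show "is_subring R \<Longrightarrow> x \<in> I \<Longrightarrow> - x \<in> I" .
  show "x - y \<in> I" if "is_subring R" "x \<in> I" "y \<in> I"
    using d neg that by (metis add_uminus_conv_diff)
qed

lemma primeideal_ring_on_iff:
  assumes R: "is_subring R"
  shows "primeideal P (ring_on R) \<longleftrightarrow> prime_in R P"
proof
  assume "primeideal P (ring_on R)"
  then interpret primeideal P "ring_on R" .
  have id: "ideal_in R P"
    unfolding ideal_in_def using a_subset zero_closed additive_subgroup.zero_closed[OF is_additive_subgroup]
      additive_subgroup.a_closed[OF is_additive_subgroup] I_l_closed by auto
  moreover have "1 \<notin> P"
  proof
    assume "1 \<in> P"
    then have "r \<in> P" if "r \<in> R" for r using ideal_inD(4)[OF id that] by fastforce
    then have "P = R" using ideal_inD(1)[OF id] by blast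
    then show False using I_notcarr by simp
  qed
  ultimately show "prime_in R P" unfolding prime_in_def using I_prime by auto
next
  assume P: "prime_in R P"
  then have id: "ideal_in R P" by (simp add: prime_in_def)
  interpret cring "ring_on R" by (rule cring_ring_on_subring) fact
  show "primeideal P (ring_on R)"
  proof (rule primeidealI)
    show "ideal P (ring_on R)"
    proof (rule idealI)
      show "ring (ring_on R)" by (rule ring_axioms)
      show "subgroup P (add_monoid (ring_on R))"
      proof (rule add.subgroupI)
        show "P \<subseteq> carrier (ring_on R)" using ideal_inD(1)[OF id] by auto
        show "P \<noteq> {}" using ideal_inD(2)[OF id] by auto
        fix a assume a: "a \<in> P"
        have "\<ominus>\<^bsub>ring_on R\<^esub> a = - a"
          using a ideal_inD(1)[OF id] R by (intro ring_on_minus) (auto simp: is_subringD is_cring)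
        then show "\<ominus>\<^bsub>ring_on R\<^esub> a \<in> P" using ideal_inD(6)[OF id R a] by simp
      qed (use ideal_inD[OF id] in auto)
    qed (use ideal_inD[OF id] in auto)
    show "cring (ring_on R)" by (rule is_cring)
    show "carrier (ring_on R) \<noteq> P" using P R by (auto simp: prime_in_def is_subringD)
  qed (use P in \<open>auto simp: prime_in_def\<close>)
qed

text \<open>
  Take \<open>P\<close> maximal among the ideals that contain \<open>I\<close> and are disjoint from \<open>M\<close>. If \<open>a\<close> and \<open>b\<close> are not
  in \<open>P\<close>, the ideals generated by \<open>P\<close> and one of them meet \<open>M\<close>, say in \<open>p + r * a\<close> and \<open>q + s * b\<close>.
  Their product lies in \<open>M\<close>, hence not in \<open>P\<close>, but it would lie in \<open>P\<close> if \<open>a * b\<close> did.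
\<close>

lemma prime_ideal_avoiding:
  assumes R: "is_subring R" and I: "ideal_in R I" and M: "M \<subseteq> R" "1 \<in> M" "\<And>x y. x \<in> M \<Longrightarrow> y \<in> M \<Longrightarrow> x * y \<in> M"
    and disj: "I \<inter> M = {}"
  obtains P where "prime_in R P" "I \<subseteq> P" "P \<inter> M = {}"
proof -
  define S where "S = {J. ideal_in R J \<and> I \<subseteq> J \<and> J \<inter> M = {}}"
  have "\<exists>P\<in>S. \<forall>J\<in>S. P \<subseteq> J \<longrightarrow> J = P"
  proof (rule subset_Zorn_nonempty)
    show "S \<noteq> {}" using I disj by (auto simp: S_def)
    fix C assume C: "C \<noteq> {}" "subset.chain S C"
    then have CS: "\<And>J. J \<in> C \<Longrightarrow> J \<in> S" and ch: "\<And>J L. J \<in> C \<Longrightarrow> L \<in> C \<Longrightarrow> J \<subseteq> L \<or> L \<subseteq> J"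
      by (auto simp: subset_chain_def)
    have idl: "ideal_in R J" if "J \<in> C" for J using CS[OF that] by (simp add: S_def)
    obtain J0 where J0: "J0 \<in> C" using C by blast
    have "ideal_in R (\<Union>C)" unfolding ideal_in_def
    proof (intro conjI ballI)
      show "\<Union>C \<subseteq> R" using idl by (auto dest: ideal_inD(1))
      show "0 \<in> \<Union>C" using J0 ideal_inD(2)[OF idl] by blast
      show "r * x \<in> \<Union>C" if "r \<in> R" "x \<in> \<Union>C" for r x using that idl by (auto intro: ideal_inD(4))
      fix x y assume "x \<in> \<Union>C" "y \<in> \<Union>C"
      then obtain J L where JL: "J \<in> C" "x \<in> J" "L \<in> C" "y \<in> L" by blast
      then consider "J \<subseteq> L" | "L \<subseteq> J" using ch by blast
      then show "x + y \<in> \<Union>C"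
      proof cases
        case 1
        then have "x + y \<in> L" using JL idl by (intro ideal_inD(3)) auto
        then show ?thesis using JL by blast
      next
        case 2
        then have "x + y \<in> J" using JL idl by (intro ideal_inD(3)) auto
        then show ?thesis using JL by blast
      qed
    qed
    moreover have "I \<subseteq> \<Union>C" using J0 CS by (auto simp: S_def)
    moreover have "\<Union>C \<inter> M = {}" using CS by (auto simp: S_def)
    ultimately show "\<Union>C \<in> S" by (simp add: S_def)
  qed
  then obtain P where P: "P \<in> S" and max: "\<And>J. J \<in> S \<Longrightarrow> P \<subseteq> J \<Longrightarrow> J = P" by blast
  then have idP: "ideal_in R P" and IP: "I \<subseteq> P" and PM: "P \<inter> M = {}" by (auto simp: S_def)
  have meets: "\<exists>p\<in>P. \<exists>r\<in>R. p + r * a \<in> M" if a: "a \<in> R" "a \<notin> P" for a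
  proof (rule ccontr)
    assume no: "\<not> ?thesis"
    define J where "J = {p + r * a | p r. p \<in> P \<and> r \<in> R}"
    have "ideal_in R J" unfolding ideal_in_def
    proof (intro conjI ballI)
      show "J \<subseteq> R" using a ideal_inD(1)[OF idP] R by (auto simp: J_def is_subringD)
      have "0 = 0 + 0 * a" by simp
      then show "0 \<in> J" unfolding J_def using ideal_inD(2)[OF idP] is_subringD(1)[OF R] by blast
      fix x assume "x \<in> J"
      then obtain p r where x: "x = p + r * a" "p \<in> P" "r \<in> R" by (auto simp: J_def)
      fix y assume "y \<in> J"
      then obtain q s where y: "y = q + s * a" "q \<in> P" "s \<in> R" by (auto simp: J_def)
      have "x + y = (p + q) + (r + s) * a" by (simp add: x y algebra_simps)
      moreover have "p + q \<in> P" "r + s \<in> R"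
        using x y ideal_inD(3)[OF idP] is_subringD(4)[OF R] by auto
      ultimately show "x + y \<in> J" unfolding J_def by blast
    next
      fix t x assume "t \<in> R" "x \<in> J"
      then obtain p r where x: "x = p + r * a" "p \<in> P" "r \<in> R" by (auto simp: J_def)
      have "t * x = t * p + (t * r) * a" by (simp add: x algebra_simps)
      moreover have "t * p \<in> P" "t * r \<in> R"
        using x \<open>t \<in> R\<close> ideal_inD(4)[OF idP] is_subringD(5)[OF R] by auto
      ultimately show "t * x \<in> J" unfolding J_def by blast
    qed
    moreover have PJ: "P \<subseteq> J"
    proof
      fix p assume "p \<in> P"
      moreover have "p = p + 0 * a" by simp
      ultimately show "p \<in> J" unfolding J_def using is_subringD(1)[OF R] by blast
    qed
    moreover have "J \<inter> M = {}" using no by (auto simp: J_def)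
    ultimately have "J = P" using IP by (intro max) (auto simp: S_def)
    moreover have "a = 0 + 1 * a" by simp
    then have "a \<in> J" unfolding J_def using ideal_inD(2)[OF idP] is_subringD(2)[OF R] by blast
    ultimately show False using a by simp
  qed
  have "prime_in R P" unfolding prime_in_def
  proof (intro conjI ballI impI)
    show "1 \<notin> P" using PM M by blast
    fix a b assume ab: "a \<in> R" "b \<in> R" "a * b \<in> P"
    show "a \<in> P \<or> b \<in> P"
    proof (rule ccontr)
      assume "\<not> ?thesis"
      then obtain p r q s where pr: "p \<in> P" "r \<in> R" "p + r * a \<in> M" and qs: "q \<in> P" "s \<in> R" "q + s * b \<in> M"
        using meets[OF ab(1)] meets[OF ab(2)] by blast
      have "(p + r * a) * (q + s * b) = (q + s * b) * p + (r * a) * q + (r * s) * (a * b)"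
        by (simp add: algebra_simps)
      also have "\<dots> \<in> P"
      proof (intro ideal_inD(3)[OF idP])
        show "(q + s * b) * p \<in> P" "(r * a) * q \<in> P" "(r * s) * (a * b) \<in> P"
          using pr qs ab R M(1) by (simp_all only: ideal_inD(4)[OF idP] is_subringD(5)[OF R] subsetD)
      qed
      finally show False using M(3)[OF pr(3) qs(3)] PM by blast
    qed
  qed (rule idP)
  then show thesis using IP PM by (rule that)
qed

section \<open>Rational integers in prime ideals\<close>

lemma is_subring_ring_of_integers: "is_subfield K \<Longrightarrow> is_subring (ring_of_integers K)"
  by (auto simp: is_subring_def ring_of_integers_def is_subfieldD algebraic_int_add algebraic_int_times
      intro: int_imp_algebraic_int)

lemma of_int_in_ring_of_integers: "is_subfield K \<Longrightarrow> of_int k \<in> ring_of_integers K"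
  by (auto simp: ring_of_integers_def is_subfield_of_int intro: int_imp_algebraic_int)

definition finite_prime_ideal :: "'a::field_char_0 set \<Rightarrow> 'a set \<Rightarrow> bool" where
  "finite_prime_ideal K P \<longleftrightarrow> prime_in (ring_of_integers K) P \<and> P \<noteq> {0}"

lemma Finite_Prime_in_finite_primes_iff:
  "is_subfield K \<Longrightarrow> Finite_Prime P \<in> finite_primes K \<longleftrightarrow> finite_prime_ideal K P"
  by (auto simp: finite_primes_def finite_prime_ideal_def primeideal_ring_on_iff is_subring_ring_of_integers)

lemma prime_inD:
  assumes "prime_in R P"
  shows "ideal_in R P" "1 \<notin> P" "0 \<in> P" "a \<in> P \<Longrightarrow> a \<in> R" "a \<in> R \<Longrightarrow> b \<in> R \<Longrightarrow> a * b \<in> P \<longleftrightarrow> a \<in> P \<or> b \<in> P"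
proof -
  show id: "ideal_in R P" and "1 \<notin> P" using assms by (auto simp: prime_in_def)
  show "0 \<in> P" "a \<in> P \<Longrightarrow> a \<in> R" using id by (auto dest: ideal_inD)
  show "a * b \<in> P \<longleftrightarrow> a \<in> P \<or> b \<in> P" if "a \<in> R" "b \<in> R"
    using assms that ideal_inD(4,5)[OF id] by (auto simp: prime_in_def)
qed

text \<open>
  The rational integers in \<open>P\<close> form a proper ideal, which is principal.
\<close>

lemma integers_in_prime_ideal:
  assumes K: "is_subfield (K :: 'a::field_char_0 set)" and P: "prime_in (ring_of_integers K) P"
  obtains p :: int where "\<And>k. of_int k \<in> P \<longleftrightarrow> p dvd k" "p \<ge> 0" "\<not> p dvd 1"
proof -
  note R = is_subring_ring_of_integers[OF K]
  note id = prime_inD(1)[OF P]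
  define J where "J = {k::int. of_int k \<in> P}"
  have J: "0 \<in> J" "\<And>k l. k \<in> J \<Longrightarrow> l \<in> J \<Longrightarrow> k - l \<in> J" "\<And>k l. l \<in> J \<Longrightarrow> k * l \<in> J"
    using ideal_inD(2)[OF id] ideal_inD(7)[OF id R] ideal_inD(4)[OF id of_int_in_ring_of_integers[OF K]]
    by (simp_all add: J_def)
  have J1: "1 \<notin> J" using prime_inD(2)[OF P] by (simp add: J_def)
  have "\<exists>p\<ge>0. \<forall>k. k \<in> J \<longleftrightarrow> p dvd k"
  proof (cases "J = {0}")
    case True
    then show ?thesis by (intro exI[of _ 0]) auto
  next
    case False
    then obtain k where k: "k \<in> J" "k \<noteq> 0" using J(1) by blast
    then have "- k \<in> J" using J(3)[OF k(1), of "- 1"] by simp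
    then have ex: "\<exists>n::nat. n > 0 \<and> int n \<in> J" using k by (intro exI[of _ "nat \<bar>k\<bar>"]) (auto simp: abs_if)
    define p where "p = (LEAST n. n > 0 \<and> int n \<in> J)"
    have p: "p > 0" "int p \<in> J" using LeastI_ex[OF ex] by (auto simp: p_def)
    have "l \<in> J \<longleftrightarrow> int p dvd l" for l
    proof
      assume l: "l \<in> J"
      have "l - (l div int p) * int p \<in> J" using J(2)[OF l J(3)[OF p(2)]] .
      then have r: "l mod int p \<in> J" by (simp add: minus_div_mult_eq_mod)
      have "l mod int p = 0"
      proof (rule ccontr)
        assume "l mod int p \<noteq> 0"
        moreover have "l mod int p \<ge> 0" using p(1) by simp
        ultimately have "l mod int p > 0" by linarith
        then have "nat (l mod int p) > 0 \<and> int (nat (l mod int p)) \<in> J" using r by simp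
        then have "p \<le> nat (l mod int p)" unfolding p_def by (rule Least_le)
        moreover have "l mod int p < int p" using p(1) by simp
        then have "nat (l mod int p) < p" using p(1) by (simp add: nat_less_iff)
        ultimately show False by simp
      qed
      then show "int p dvd l" by auto
    next
      assume "int p dvd l"
      then have "l = (l div int p) * int p" by simp
      with J(3)[OF p(2), of "l div int p"] show "l \<in> J" by simp
    qed
    then show ?thesis by (intro exI[of _ "int p"]) auto
  qed
  then obtain p where p: "p \<ge> 0" "\<forall>k. k \<in> J \<longleftrightarrow> p dvd k" by (elim exE conjE)
  show thesis
    by (rule that[OF _ p(1)]) (use p(2) J1 in \<open>auto simp: J_def\<close>)
qed

text \<open>
  The constant term of an integer relation for \<open>x\<close>, divided by the highest possible power of \<open>x\<close>,
  is a nonzero multiple of \<open>x\<close>. It shows that nonzero ideals contain nonzero integers.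
\<close>

lemma algebraic_int_divides_nonzero_integer:
  fixes x :: "'a::field_char_0"
  assumes "algebraic_int x" "x \<noteq> 0"
  obtains a :: int and r :: "int poly" where "a \<noteq> 0" "of_int a = - x * poly (map_poly of_int r) x"
proof -
  have "\<exists>a r. a \<noteq> 0 \<and> of_int a = - x * poly (map_poly of_int r) x"
    if "poly (map_poly of_int p) x = 0" "p \<noteq> 0" for p :: "int poly"
    using that
  proof (induction p)
    case (pCons a p)
    have e: "of_int a + x * poly (map_poly of_int p) x = 0" using pCons by (simp add: map_poly_pCons)
    show ?case
    proof (cases "a = 0")
      case True
      then show ?thesis using e assms(2) pCons by auto
    next
      case False
      then show ?thesis using e by (intro exI[of _ a] exI[of _ p]) (simp add: eq_neg_iff_add_eq_0)
    qed
  qed simp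
  moreover obtain p :: "int poly" where "poly (map_poly of_int p) x = 0" "lead_coeff p = 1"
    using assms(1) unfolding algebraic_int_altdef_ipoly by blast
  moreover from this have "p \<noteq> 0" by auto
  ultimately show thesis using that by blast
qed

lemma poly_int_in_ring_of_integers:
  assumes "is_subfield K" "x \<in> ring_of_integers K"
  shows "poly (map_poly of_int r) x \<in> ring_of_integers K"
proof (induction r)
  case (pCons a r)
  then show ?case
    using assms of_int_in_ring_of_integers[OF assms(1)] is_subringD[OF is_subring_ring_of_integers[OF assms(1)]]
    by (simp add: map_poly_pCons)
qed (simp add: is_subringD[OF is_subring_ring_of_integers[OF assms(1)]])

lemma nonzero_integer_in_ideal:
  assumes K: "is_subfield (K :: 'a::field_char_0 set)" and I: "ideal_in (ring_of_integers K) I" "x \<in> I" "x \<noteq> 0"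
  obtains a :: int where "a \<noteq> 0" "of_int a \<in> I"
proof -
  have x: "x \<in> ring_of_integers K" using ideal_inD(1)[OF I(1,2)] .
  then have "algebraic_int x" by (simp add: ring_of_integers_def)
  then obtain a r where a: "a \<noteq> 0" "of_int a = - x * poly (map_poly of_int r) x"
    using I(3) by (rule algebraic_int_divides_nonzero_integer)
  have "- poly (map_poly of_int r) x \<in> ring_of_integers K"
    using poly_int_in_ring_of_integers[OF K x] is_subringD(3)[OF is_subring_ring_of_integers[OF K]] by blast
  from ideal_inD(4)[OF I(1) this I(2)] show thesis using a that by (simp add: mult.commute)
qed

lemma prime_number_of_prime_ideal:
  assumes K: "is_subfield (K :: 'a::field_char_0 set)" and P: "finite_prime_ideal K P"
  obtains p :: int where "\<And>k. of_int k \<in> P \<longleftrightarrow> p dvd k" "p > 1"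
proof -
  have P': "prime_in (ring_of_integers K) P" "P \<noteq> {0}" using P by (auto simp: finite_prime_ideal_def)
  obtain x where "x \<in> P" "x \<noteq> 0" using P'(2) prime_inD(3)[OF P'(1)] by blast
  then obtain a :: int where a: "a \<noteq> 0" "of_int a \<in> P"
    using nonzero_integer_in_ideal[OF K prime_inD(1)[OF P'(1)]] by blast
  obtain p where p: "\<And>k. of_int k \<in> P \<longleftrightarrow> p dvd k" "p \<ge> 0" "\<not> p dvd 1"
    using integers_in_prime_ideal[OF K P'(1)] by blast
  have "p \<noteq> 0" using a p(1)[of a] by auto
  moreover have "p \<noteq> 1" using p(3) by auto
  ultimately show thesis using p by (intro that[of p]) auto
qed

lemma number_field_int_relation:
  assumes K: "number_field K"
  obtains n where "\<And>x. x \<in> K \<Longrightarrow> \<exists>f :: int poly. f \<noteq> 0 \<and> degree f \<le> n \<and> poly (map_poly of_int f) x = 0"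
proof -
  obtain n :: nat where n: "\<And>x. x \<in> K \<Longrightarrow> \<exists>p\<in>polys_over \<rat>. p \<noteq> 0 \<and> degree p \<le> n \<and> poly p x = 0"
    using number_field_finite_basis[OF K] by metis
  show thesis
  proof (rule that[of n])
    fix x assume "x \<in> K"
    then obtain p where p: "p \<in> polys_over \<rat>" "p \<noteq> 0" "degree p \<le> n" "poly p x = 0" using n by blast
    have "\<exists>d::int. d \<noteq> 0 \<and> of_int d * coeff p i \<in> \<int>" for i
    proof -
      have "coeff p i \<in> \<rat>" using p(1) by (simp add: polys_over_def)
      then obtain a b :: int where "b > 0" "coeff p i = of_int a / of_int b" by (auto elim: Rats_cases')
      then show ?thesis by (intro exI[of _ b]) auto
    qed
    then obtain d :: "nat \<Rightarrow> int" where d: "\<And>i. d i \<noteq> 0" "\<And>i. of_int (d i) * coeff p i \<in> \<int>" by metis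
    define D where "D = (\<Prod>i\<le>degree p. d i)"
    have D: "D \<noteq> 0" using d by (simp add: D_def)
    have "of_int D * coeff p i \<in> \<int>" for i
    proof (cases "i \<le> degree p")
      case True
      then have "D = (\<Prod>j\<in>{..degree p} - {i}. d j) * d i"
        unfolding D_def by (simp add: prod.remove mult.commute)
      then have "of_int D * coeff p i = of_int (\<Prod>j\<in>{..degree p} - {i}. d j) * (of_int (d i) * coeff p i)"
        by (simp add: mult.assoc)
      then show ?thesis using d(2)[of i] by (simp only: Ints_mult Ints_of_int)
    qed (simp add: coeff_eq_0)
    then have "\<exists>c::int. of_int D * coeff p i = of_int c" for i by (metis Ints_cases)
    then obtain c :: "nat \<Rightarrow> int" where c: "\<And>i. of_int D * coeff p i = of_int (c i)" by metis
    define f where "f = Poly (map c [0..<Suc n])"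
    have cf: "coeff f i = c i" for i
    proof -
      have "c i = 0" if "i > n"
        using that c[of i] p(3) by (simp add: coeff_eq_0)
      then show ?thesis by (auto simp: f_def coeff_Poly_eq nth_default_def simp del: upt_Suc)
    qed
    have fp: "map_poly of_int f = smult (of_int D) p" by (rule poly_eqI) (simp add: coeff_map_poly cf c)
    moreover have "degree f \<le> n" by (rule degree_le) (simp add: f_def coeff_Poly_eq nth_default_def)
    moreover have "f \<noteq> 0" using fp D p(2) by auto
    ultimately show "\<exists>f :: int poly. f \<noteq> 0 \<and> degree f \<le> n \<and> poly (map_poly of_int f) x = 0"
      using p(4) by (intro exI[of _ f]) simp
  qed
qed

section \<open>Localisations are valuation rings\<close>

definition local_units :: "'a::field_char_0 set \<Rightarrow> 'a set \<Rightarrow> 'a set" where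
  "local_units K P = {a / b | a b. a \<in> ring_of_integers K - P \<and> b \<in> ring_of_integers K - P}"

lemma localizedI: "a \<in> ring_of_integers K \<Longrightarrow> b \<in> ring_of_integers K \<Longrightarrow> b \<notin> P \<Longrightarrow> a / b \<in> integers_localized_at K P"
  unfolding integers_localized_at_def by blast

lemma local_unitsI: "a \<in> ring_of_integers K \<Longrightarrow> a \<notin> P \<Longrightarrow> b \<in> ring_of_integers K \<Longrightarrow> b \<notin> P \<Longrightarrow> a / b \<in> local_units K P"
  unfolding local_units_def by blast

lemma localizedE:
  assumes "x \<in> integers_localized_at K P"
  obtains a b where "x = a / b" "a \<in> ring_of_integers K" "b \<in> ring_of_integers K" "b \<notin> P"
  using assms unfolding integers_localized_at_def by blast

lemma local_unitsE:
  assumes "x \<in> local_units K P"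
  obtains a b where "x = a / b" "a \<in> ring_of_integers K" "a \<notin> P" "b \<in> ring_of_integers K" "b \<notin> P"
  using assms unfolding local_units_def by blast

lemma localized_closed:
  assumes K: "is_subfield K" and P: "prime_in (ring_of_integers K) P"
  shows localized_add: "x \<in> integers_localized_at K P \<Longrightarrow> y \<in> integers_localized_at K P \<Longrightarrow> x + y \<in> integers_localized_at K P"
    and localized_times: "x \<in> integers_localized_at K P \<Longrightarrow> y \<in> integers_localized_at K P \<Longrightarrow> x * y \<in> integers_localized_at K P"
proof -
  note R = is_subringD[OF is_subring_ring_of_integers[OF K]]
  assume xy: "x \<in> integers_localized_at K P" "y \<in> integers_localized_at K P"
  obtain a b where x: "x = a / b" "a \<in> ring_of_integers K" "b \<in> ring_of_integers K" "b \<notin> P"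
    using xy(1) by (rule localizedE)
  obtain c d where y: "y = c / d" "c \<in> ring_of_integers K" "d \<in> ring_of_integers K" "d \<notin> P"
    using xy(2) by (rule localizedE)
  have nz: "b \<noteq> 0" "d \<noteq> 0" using x y prime_inD(3)[OF P] by auto
  have bd: "b * d \<in> ring_of_integers K" "b * d \<notin> P" using x y R prime_inD(5)[OF P] by auto
  have "(a * d + c * b) / (b * d) \<in> integers_localized_at K P"
    by (rule localizedI[OF _ bd]) (use x y R in auto)
  moreover have "x + y = (a * d + c * b) / (b * d)" using nz by (simp add: x y add_frac_eq)
  ultimately show "x + y \<in> integers_localized_at K P" by simp
  have "(a * c) / (b * d) \<in> integers_localized_at K P"
    by (rule localizedI[OF _ bd]) (use x y R in auto)
  then show "x * y \<in> integers_localized_at K P" by (simp add: x y)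
qed

lemma integers_subset_localized:
  assumes K: "is_subfield K" and P: "prime_in (ring_of_integers K) P" and x: "x \<in> ring_of_integers K"
  shows "x \<in> integers_localized_at K P"
  using localizedI[OF x is_subringD(2)[OF is_subring_ring_of_integers[OF K]] prime_inD(2)[OF P]] by simp

lemma localized_subset: "is_subfield K \<Longrightarrow> integers_localized_at K P \<subseteq> K"
  by (auto elim!: localizedE simp: ring_of_integers_def is_subfieldD)

lemma local_units_iff:
  assumes K: "is_subfield K" and P: "prime_in (ring_of_integers K) P"
  shows "x \<in> local_units K P \<longleftrightarrow> x \<noteq> 0 \<and> x \<in> integers_localized_at K P \<and> inverse x \<in> integers_localized_at K P"
proof
  assume "x \<in> local_units K P"
  then obtain a b where ab: "x = a / b" "a \<in> ring_of_integers K" "a \<notin> P" "b \<in> ring_of_integers K" "b \<notin> P"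
    by (rule local_unitsE)
  then show "x \<noteq> 0 \<and> x \<in> integers_localized_at K P \<and> inverse x \<in> integers_localized_at K P"
    using localizedI[of a K b P] localizedI[of b K a P] prime_inD(3)[OF P] by auto
next
  assume *: "x \<noteq> 0 \<and> x \<in> integers_localized_at K P \<and> inverse x \<in> integers_localized_at K P"
  obtain a b where ab: "x = a / b" "a \<in> ring_of_integers K" "b \<in> ring_of_integers K" "b \<notin> P"
    using * by (auto elim: localizedE)
  obtain c d where cd: "inverse x = c / d" "c \<in> ring_of_integers K" "d \<in> ring_of_integers K" "d \<notin> P"
    using * by (auto elim: localizedE)
  have "b \<noteq> 0" "d \<noteq> 0" using ab cd prime_inD(3)[OF P] by auto
  then have "a * c = b * d" using * ab(1) cd(1) by (auto simp: field_simps)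
  moreover have "b * d \<notin> P" using ab cd prime_inD(5)[OF P] by simp
  ultimately have "a \<notin> P" using ab cd prime_inD(5)[OF P] by metis
  then show "x \<in> local_units K P" using ab local_unitsI by metis
qed

lemma mult_subgroup_local_units:
  assumes K: "is_subfield K" and P: "prime_in (ring_of_integers K) P"
  shows "mult_subgroup (local_units K P)"
  unfolding mult_subgroup_def
proof (intro conjI ballI)
  have "1 \<in> integers_localized_at K P"
    by (rule integers_subset_localized[OF K P is_subringD(2)[OF is_subring_ring_of_integers[OF K]]])
  then show "1 \<in> local_units K P" by (simp add: local_units_iff[OF K P])
qed (auto simp: local_units_iff[OF K P] localized_times[OF K P])

text \<open>
  The localisation is a local ring.
\<close>

lemma nonunit_add:
  assumes K: "is_subfield K" and P: "prime_in (ring_of_integers K) P"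
    and x: "x \<in> integers_localized_at K P" "x \<notin> local_units K P"
    and y: "y \<in> integers_localized_at K P" "y \<notin> local_units K P"
  shows "x + y \<notin> local_units K P"
proof
  note R = is_subringD[OF is_subring_ring_of_integers[OF K]] and id = ideal_inD[OF prime_inD(1)[OF P]]
  assume u: "x + y \<in> local_units K P"
  obtain a b where x': "x = a / b" "a \<in> ring_of_integers K" "b \<in> ring_of_integers K" "b \<notin> P"
    using x(1) by (rule localizedE)
  obtain c d where y': "y = c / d" "c \<in> ring_of_integers K" "d \<in> ring_of_integers K" "d \<notin> P"
    using y(1) by (rule localizedE)
  obtain e f where u': "x + y = e / f" "e \<in> ring_of_integers K" "e \<notin> P" "f \<in> ring_of_integers K" "f \<notin> P"
    using u by (rule local_unitsE)
  have ac: "a \<in> P" "c \<in> P" using x y x' y' local_unitsI by metis+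
  have nz: "b \<noteq> 0" "d \<noteq> 0" "f \<noteq> 0" using x' y' u' prime_inD(3)[OF P] by auto
  have "e * (b * d) = f * (a * d + c * b)" using u'(1) nz by (simp add: x' y' field_simps)
  also have "\<dots> \<in> P"
  proof (rule id(4)[OF u'(4)], rule id(3))
    show "a * d \<in> P" "c * b \<in> P" using id(5)[OF y'(3) ac(1)] id(5)[OF x'(3) ac(2)] .
  qed
  finally have "e * (b * d) \<in> P" .
  moreover have "b * d \<in> ring_of_integers K" using x' y' R by auto
  ultimately show False using prime_inD(5)[OF P] u' x' y' by metis
qed

lemma nonunit_sum:
  assumes K: "is_subfield K" and P: "prime_in (ring_of_integers K) P" and "finite J"
    and "\<And>j. j \<in> J \<Longrightarrow> f j \<in> integers_localized_at K P" "\<And>j. j \<in> J \<Longrightarrow> f j \<notin> local_units K P"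
  shows "sum f J \<in> integers_localized_at K P \<and> sum f J \<notin> local_units K P"
  using assms(3-)
proof (induction J rule: finite_induct)
  case empty
  have "0 \<in> integers_localized_at K P"
    by (rule integers_subset_localized[OF K P is_subringD(1)[OF is_subring_ring_of_integers[OF K]]])
  then show ?case by (simp add: local_units_iff[OF K P])
next
  case (insert j J)
  then have "sum f J \<in> integers_localized_at K P" "sum f J \<notin> local_units K P"
    "f j \<in> integers_localized_at K P" "f j \<notin> local_units K P" by auto
  then show ?case using insert.hyps nonunit_add[OF K P] localized_add[OF K P] by simp
qed

text \<open>
  Let \<open>c\<^sub>n x\<^sup>n + \<dots> + c\<^sub>0 = 0\<close> be a relation with coprime integer coefficients, and let \<open>b\<^sub>i\<close> be its
  partial Horner sums. Both \<open>b\<^sub>i\<close> and \<open>b\<^sub>i x = b\<^bsub>i + 1\<^esub> - c\<^bsub>n - i - 1\<^esub>\<close> are algebraic integers. If some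
  \<open>b\<^sub>i\<close> is not in \<open>P\<close>, then \<open>x = b\<^sub>i x / b\<^sub>i\<close> is in the localisation; if some \<open>b\<^sub>i x\<close> is not in \<open>P\<close>, then so
  is the inverse of \<open>x\<close>. If neither happens, all differences \<open>c\<^sub>i\<close> are in \<open>P\<close>, and so is 1, because
  the \<open>c\<^sub>i\<close> are coprime.
\<close>

lemma localized_valuation:
  assumes K: "number_field K" and P: "prime_in (ring_of_integers K) P" and x: "x \<in> K"
  shows "x \<in> integers_localized_at K P \<or> inverse x \<in> integers_localized_at K P"
proof (rule ccontr)
  assume neg: "\<not> ?thesis"
  note Ks = number_field_is_subfield[OF K]
  note R = is_subringD[OF is_subring_ring_of_integers[OF Ks]] and id = ideal_inD[OF prime_inD(1)[OF P]]
  obtain f0 :: "int poly" where f0: "f0 \<noteq> 0" "poly (map_poly of_int f0) x = 0"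
    using number_field_int_relation[OF K] x by metis
  define f where "f = primitive_part f0"
  have "coeff f0 i = content f0 * coeff f i" for i
    unfolding f_def coeff_smult[symmetric] content_times_primitive_part by (rule refl)
  then have "map_poly of_int f0 = smult (of_int (content f0)) (map_poly of_int f :: 'a poly)"
    by (intro poly_eqI) (simp add: coeff_map_poly)
  then have root: "poly (map_poly of_int f) x = 0" using f0 by simp
  have cont: "content f = 1" using f0 by (simp add: f_def)
  define n where "n = degree f"
  define b where "b i = (\<Sum>k\<le>i. of_int (coeff f (n - k)) * x ^ (i - k))" for i
  have bO: "b i \<in> ring_of_integers K" if "i \<le> n" for i
    using algebraic_int_partial_horner[OF root, of i] that x
    by (auto simp: b_def n_def ring_of_integers_def is_subfieldD[OF Ks] is_subfield_of_int[OF Ks]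
        intro!: is_subfield_sum[OF Ks])
  have step: "b (Suc i) = b i * x + of_int (coeff f (n - Suc i))" for i
  proof -
    have "(\<Sum>k\<le>i. of_int (coeff f (n - k)) * x ^ (Suc i - k)) = b i * x"
      unfolding b_def sum_distrib_right by (intro sum.cong refl) (simp add: Suc_diff_le mult.assoc mult.commute[of x])
    then show ?thesis by (simp add: b_def)
  qed
  have "b n = poly (map_poly of_int f) x"
    unfolding b_def by (simp add: poly_altdef degree_map_poly n_def)
      (rule sum.reindex_bij_witness[where i = "\<lambda>k. n - k" and j = "\<lambda>k. n - k"]; simp add: n_def)
  then have bn: "b n = 0" using root by simp
  have b0: "b 0 = of_int (coeff f n)" by (simp add: b_def)
  have dO: "b i * x \<in> ring_of_integers K" if "i < n" for i
  proof -
    have "b i * x = b (Suc i) - of_int (coeff f (n - Suc i))" using step[of i] by simp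
    also have "\<dots> \<in> ring_of_integers K"
      using that by (intro R(6) bO of_int_in_ring_of_integers[OF Ks]) auto
    finally show ?thesis .
  qed
  have x0: "x \<noteq> 0" using neg integers_subset_localized[OF Ks P R(1)] by auto
  have bP: "b i \<in> P" if "i < n" for i
  proof (rule ccontr)
    assume nP: "b i \<notin> P"
    then have "b i \<noteq> 0" using prime_inD(3)[OF P] by auto
    then have "x = (b i * x) / b i" by simp
    then show False using neg localizedI[OF dO[OF that] bO nP] that by simp
  qed
  have dP: "b i * x \<in> P" if "i < n" for i
  proof (rule ccontr)
    assume nP: "b i * x \<notin> P"
    then have "b i * x \<noteq> 0" using prime_inD(3)[OF P] by auto
    then have inv: "inverse x = b i / (b i * x)" by (simp add: field_simps)
    have "b i / (b i * x) \<in> integers_localized_at K P"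
      by (rule localizedI[OF bO dO[OF that] nP]) (use that in simp)
    then show False using neg unfolding inv by blast
  qed
  have n0: "n \<noteq> 0"
  proof
    assume "n = 0"
    then have "coeff f n = 0" using bn b0 by simp
    then have "f = 0" unfolding n_def leading_coeff_0_iff .
    then show False using cont by simp
  qed
  have coeffP: "of_int (coeff f i) \<in> P" for i
  proof -
    consider "i > n" | "i = n" | "i < n" by linarith
    then show ?thesis
    proof cases
      case 1
      then show ?thesis using prime_inD(3)[OF P] by (simp add: coeff_eq_0 n_def)
    next
      case 2
      then show ?thesis using bP[of 0] b0 n0 by simp
    next
      case 3
      define j where "j = n - Suc i"
      have j: "j < n" "n - Suc j = i" "Suc j \<le> n" using 3 by (auto simp: j_def)
      have "of_int (coeff f i) = b (Suc j) - b j * x" using step[of j] j by simp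
      moreover have "b (Suc j) \<in> P"
        using bP[of "Suc j"] bn prime_inD(3)[OF P] j(3) by (cases "Suc j = n") auto
      ultimately show ?thesis
        using id(7)[OF is_subring_ring_of_integers[OF Ks] _ dP[OF j(1)]] by simp
    qed
  qed
  obtain p where p: "\<And>k. of_int k \<in> P \<longleftrightarrow> p dvd k" "\<not> p dvd 1"
    using integers_in_prime_ideal[OF Ks P] by blast
  have "\<forall>i. p dvd coeff f i" using coeffP p(1) by blast
  then have "[:p:] dvd f" by (simp add: const_poly_dvd_iff)
  then have "p dvd content f" by (simp only: const_poly_dvd_iff_dvd_content)
  then show False using p(2) cont by simp
qed

lemma nonunit_inverse_localized:
  assumes K: "number_field K" and P: "prime_in (ring_of_integers K) P" and x: "x \<in> K" "x \<notin> integers_localized_at K P"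
  shows "inverse x \<in> integers_localized_at K P" "inverse x \<notin> local_units K P"
  using localized_valuation[OF K P x(1)] x(2) local_units_iff[OF number_field_is_subfield[OF K] P, of "inverse x"] by auto

text \<open>
  Otherwise the inverse of \<open>x\<close> is in the localisation, and so is
  \<open>x = x ^ n * inverse x ^ (n - 1)\<close>.
\<close>

lemma localized_power_cancel:
  assumes K: "number_field K" and P: "prime_in (ring_of_integers K) P" and x: "x \<in> K" "x ^ n \<in> integers_localized_at K P" "n > 0"
  shows "x \<in> integers_localized_at K P"
proof (rule ccontr)
  assume nx: "x \<notin> integers_localized_at K P"
  note Ks = number_field_is_subfield[OF K]
  note R = is_subringD[OF is_subring_ring_of_integers[OF Ks]]
  have inv: "inverse x \<in> integers_localized_at K P" using nonunit_inverse_localized(1)[OF K P x(1) nx] .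
  have pow: "inverse x ^ k \<in> integers_localized_at K P" for k
    by (induction k) (use inv localized_times[OF Ks P] integers_subset_localized[OF Ks P R(2)] in auto)
  have x0: "x \<noteq> 0" using nx integers_subset_localized[OF Ks P R(1)] by auto
  have "x ^ n * inverse x ^ (n - 1) \<in> integers_localized_at K P"
    using x(2) pow by (rule localized_times[OF Ks P])
  moreover have "x ^ n * inverse x ^ (n - 1) = x"
    using x(3) x0 by (cases n) (auto simp: power_inverse)
  ultimately show False using nx by simp
qed

text \<open>
  The denominators of \<open>x\<close> form an ideal. It contains the leading coefficient of an integer
  relation for \<open>x\<close>, so it is not zero. If it were proper, it would lie in a prime ideal \<open>P\<close>; but \<open>x\<close>
  has a denominator outside \<open>P\<close>.
\<close>

lemma algebraic_int_of_localized:
  assumes K: "number_field K" and x: "x \<in> K"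
    and loc: "\<And>P. finite_prime_ideal K P \<Longrightarrow> x \<in> integers_localized_at K P"
  shows "algebraic_int x"
proof (rule ccontr)
  assume nx: "\<not> algebraic_int x"
  note Ks = number_field_is_subfield[OF K]
  note Rs = is_subring_ring_of_integers[OF Ks]
  note R = is_subringD[OF Rs]
  define I where "I = {d \<in> ring_of_integers K. d * x \<in> ring_of_integers K}"
  have I: "ideal_in (ring_of_integers K) I"
    unfolding ideal_in_def I_def using R by (auto simp: distrib_right mult.assoc)
  have disj: "I \<inter> {1} = {}" using nx by (auto simp: I_def ring_of_integers_def)
  obtain P where P: "prime_in (ring_of_integers K) P" "I \<subseteq> P"
  proof (rule prime_ideal_avoiding[OF Rs I _ _ _ disj])
    show "{1} \<subseteq> ring_of_integers K" using R(2) by simp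
  qed auto
  obtain f :: "int poly" where f: "f \<noteq> 0" "poly (map_poly of_int f) x = 0"
    using number_field_int_relation[OF K] x by metis
  have "degree f \<noteq> 0"
  proof
    assume "degree f = 0"
    then obtain c where "f = [:c:]" by (rule degree_eq_zeroE)
    then show False using f by (simp add: map_poly_pCons)
  qed
  then have "algebraic_int (\<Sum>k\<le>1. of_int (coeff f (degree f - k)) * x ^ (1 - k))"
    by (intro algebraic_int_partial_horner[OF f(2)]) simp
  then have "algebraic_int (of_int (lead_coeff f) * x + of_int (coeff f (degree f - 1)))" by simp
  then have "algebraic_int (of_int (lead_coeff f) * x + of_int (coeff f (degree f - 1)) - of_int (coeff f (degree f - 1)))"
    by (rule algebraic_int_diff) (auto intro: int_imp_algebraic_int)
  then have "of_int (lead_coeff f) \<in> I"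
    using x of_int_in_ring_of_integers[OF Ks]
    by (simp add: I_def) (simp add: ring_of_integers_def is_subfieldD[OF Ks] is_subfield_of_int[OF Ks])
  then have "of_int (lead_coeff f) \<in> P" using P by blast
  then have "P \<noteq> {0}" using f by auto
  then have "x \<in> integers_localized_at K P" using P by (intro loc) (simp add: finite_prime_ideal_def)
  then obtain a b where ab: "x = a / b" "a \<in> ring_of_integers K" "b \<in> ring_of_integers K" "b \<notin> P"
    by (rule localizedE)
  then have "b \<noteq> 0" using prime_inD(3)[OF P(1)] by auto
  then have "b \<in> I" using ab by (simp add: I_def)
  then show False using ab P by blast
qed

section \<open>Discreteness of the valuations\<close>

lemma exists_least_valuation:
  assumes K: "number_field K" and P: "prime_in (ring_of_integers K) P"
    and "finite J" "J \<noteq> {}" "\<And>j. j \<in> J \<Longrightarrow> f j \<in> K - {0}"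
  shows "\<exists>j\<in>J. \<forall>i\<in>J. f i / f j \<in> integers_localized_at K P"
  using assms(3-)
proof (induction J rule: finite_ne_induct)
  case (singleton j)
  note Ks = number_field_is_subfield[OF K]
  show ?case using singleton
      integers_subset_localized[OF Ks P is_subringD(2)[OF is_subring_ring_of_integers[OF Ks]]] by simp
next
  case (insert k J)
  note Ks = number_field_is_subfield[OF K]
  have one: "1 \<in> integers_localized_at K P"
    by (rule integers_subset_localized[OF Ks P is_subringD(2)[OF is_subring_ring_of_integers[OF Ks]]])
  have "\<exists>j\<in>J. \<forall>i\<in>J. f i / f j \<in> integers_localized_at K P"
    by (rule insert.IH) (rule insert.prems, simp)
  then obtain j where j: "j \<in> J" "\<forall>i\<in>J. f i / f j \<in> integers_localized_at K P" ..
  have nz: "f j \<noteq> 0" "f k \<noteq> 0" "f j \<in> K" "f k \<in> K" using insert.prems j by auto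
  have "f k / f j \<in> integers_localized_at K P \<or> inverse (f k / f j) \<in> integers_localized_at K P"
    by (rule localized_valuation[OF K P]) (use nz Ks in \<open>simp add: is_subfieldD\<close>)
  then show ?case
  proof
    assume "f k / f j \<in> integers_localized_at K P"
    then have "\<forall>i\<in>insert k J. f i / f j \<in> integers_localized_at K P" using j(2) by simp
    then show ?thesis using j(1) by (intro bexI[of _ j]) simp_all
  next
    assume inv: "inverse (f k / f j) \<in> integers_localized_at K P"
    have "f i / f k \<in> integers_localized_at K P" if "i \<in> J" for i
    proof -
      have "(f i / f j) * inverse (f k / f j) \<in> integers_localized_at K P"
        by (rule localized_times[OF Ks P _ inv]) (use j that in blast)
      then show ?thesis using nz by simp
    qed
    then show ?thesis using one nz(2) by (intro bexI[of _ k]) simp_all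
  qed
qed

text \<open>
  In a vanishing sum two terms have the same valuation: divide by a term of least valuation;
  the other quotients add up to \<open>- 1\<close>, so they are not all nonunits.
\<close>

lemma unit_terms_of_relation:
  assumes K: "number_field K" and P: "prime_in (ring_of_integers K) P"
    and J: "finite J" "J \<noteq> {}" "\<And>j. j \<in> J \<Longrightarrow> f j \<in> K - {0}" and sum: "sum f J = 0"
  shows "\<exists>i\<in>J. \<exists>j\<in>J. i \<noteq> j \<and> f i / f j \<in> local_units K P"
proof (rule ccontr)
  assume neg: "\<not> ?thesis"
  note Ks = number_field_is_subfield[OF K]
  have "\<exists>j\<in>J. \<forall>i\<in>J. f i / f j \<in> integers_localized_at K P"
    by (rule exists_least_valuation[OF K P J(1,2)]) (rule J(3))
  then obtain j where j: "j \<in> J" "\<forall>i\<in>J. f i / f j \<in> integers_localized_at K P" ..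
  have fj: "f j \<noteq> 0" using J(3) j by auto
  have "(\<Sum>i\<in>J - {j}. f i / f j) \<in> integers_localized_at K P \<and> (\<Sum>i\<in>J - {j}. f i / f j) \<notin> local_units K P"
  proof (rule nonunit_sum[OF Ks P])
    show "finite (J - {j})" using J(1) by simp
    fix i assume "i \<in> J - {j}"
    then have i: "i \<in> J" "i \<noteq> j" by auto
    show "f i / f j \<in> integers_localized_at K P" using j(2) i(1) ..
    show "f i / f j \<notin> local_units K P" using neg i j(1) by meson
  qed
  moreover have "(\<Sum>i\<in>J - {j}. f i / f j) = - 1"
  proof -
    have "0 = (\<Sum>i\<in>J. f i / f j)" using sum by (simp flip: sum_divide_distrib)
    also have "\<dots> = 1 + (\<Sum>i\<in>J - {j}. f i / f j)" using J j fj by (simp add: sum.remove)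
    finally show ?thesis by (simp add: eq_neg_iff_add_eq_0 add.commute)
  qed
  moreover have "- 1 \<in> local_units K P"
    unfolding local_units_iff[OF Ks P]
    using integers_subset_localized[OF Ks P, of "- 1"] is_subringD[OF is_subring_ring_of_integers[OF Ks]] by auto
  ultimately show False by simp
qed

text \<open>
  The last property is what finiteness arguments need: a lower bound on \<open>w x\<close> bounds the
  denominator of \<open>x\<close> at \<open>P\<close>. In an integer relation for \<open>x\<close> two terms \<open>c\<^sub>i x\<^sup>i\<close> and \<open>c\<^sub>j x\<^sup>j\<close> have the same
  valuation, and a nonzero integer is a power of \<open>p\<close> times a unit, where \<open>p\<close> generates the ideal
  of integers in \<open>P\<close>. So \<open>x powi (i - j)\<close> is a power of \<open>p\<close> up to a unit. As \<open>\<bar>i - j\<bar>\<close> is at most the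
  bound \<open>n\<close> on the degrees of relations, \<open>x ^ fact n\<close> is \<open>p powi w x\<close> times a unit. The exponent is
  unique, which makes \<open>w\<close> additive. It is in general a multiple of the normalised valuation.
\<close>

lemma prime_ideal_valuation:
  assumes K: "number_field K" and P: "finite_prime_ideal K P"
  obtains w :: "'a::field_char_0 \<Rightarrow> int" and p :: int where "p \<noteq> 0"
    "\<And>x y. x \<in> K - {0} \<Longrightarrow> y \<in> K - {0} \<Longrightarrow> w (x * y) = w x + w y"
    "\<And>x C. x \<in> K - {0} \<Longrightarrow> w x \<ge> - int C \<Longrightarrow> of_int p ^ C * x \<in> integers_localized_at K P"
proof -
  note Ks = number_field_is_subfield[OF K]
  note R = is_subringD[OF is_subring_ring_of_integers[OF Ks]]
  have P': "prime_in (ring_of_integers K) P" using P by (simp add: finite_prime_ideal_def)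
  obtain p where p: "\<And>k. of_int k \<in> P \<longleftrightarrow> p dvd k" "p > 1" using prime_number_of_prime_ideal[OF Ks P] by blast
  define \<pi> where "\<pi> = (of_int p :: 'a)"
  have \<pi>0: "\<pi> \<noteq> 0" using p(2) by (simp add: \<pi>_def)
  have \<pi>K: "\<pi> \<in> K" "\<pi> \<in> ring_of_integers K"
    using of_int_in_ring_of_integers[OF Ks] is_subfield_of_int[OF Ks] by (auto simp: \<pi>_def)
  let ?U = "local_units K P" and ?L = "integers_localized_at K P"
  note U = mult_subgroupD[OF mult_subgroup_local_units[OF Ks P']]
  note Upow = mult_subgroup_power[OF mult_subgroup_local_units[OF Ks P']]
    mult_subgroup_powi[OF mult_subgroup_local_units[OF Ks P']]
  have UL: "x \<in> ?L" if "x \<in> ?U" for x using that local_units_iff[OF Ks P'] by blast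
  have \<pi>L: "\<pi> ^ k \<in> ?L" for k
    by (rule integers_subset_localized[OF Ks P']) (use \<pi>K R in auto)
  have \<pi>U: "\<pi> ^ k \<notin> ?U" if "k > 0" for k
  proof
    assume u: "\<pi> ^ k \<in> ?U"
    have "\<pi> ^ (k - 1) * inverse (\<pi> ^ k) \<in> ?L"
      using u by (intro localized_times[OF Ks P'] \<pi>L UL U(4))
    moreover have "\<pi> ^ (k - 1) * inverse (\<pi> ^ k) = 1 / \<pi>" using that \<pi>0 by (cases k) (auto simp: field_simps)
    ultimately have "1 / \<pi> \<in> ?L" by simp
    then obtain a b where ab: "1 / \<pi> = a / b" "a \<in> ring_of_integers K" "b \<in> ring_of_integers K" "b \<notin> P"
      by (rule localizedE)
    then have "b = a * \<pi>" using \<pi>0 prime_inD(3)[OF P'] by (auto simp: field_simps)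
    moreover have "\<pi> \<in> P" using p(1)[of p] by (simp add: \<pi>_def)
    ultimately show False using ab ideal_inD(4)[OF prime_inD(1)[OF P']] by blast
  qed
  have uniq: "k = l" if "x * \<pi> powi (- k) \<in> ?U" "x * \<pi> powi (- l) \<in> ?U" for x k l
  proof -
    have *: "k \<ge> l" if u: "x * \<pi> powi (- k) \<in> ?U" "x * \<pi> powi (- l) \<in> ?U" for k l
    proof (rule ccontr)
      assume kl: "\<not> k \<ge> l"
      have x0: "x \<noteq> 0" using U(6)[OF u(1)] by auto
      have "(x * \<pi> powi (- k)) / (x * \<pi> powi (- l)) \<in> ?U" using u by (rule U(5))
      also have "(x * \<pi> powi (- k)) / (x * \<pi> powi (- l)) = \<pi> powi (- k - - l)"
        using x0 \<pi>0 by (simp add: power_int_diff power_int_minus field_simps)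
      also have "\<dots> = \<pi> ^ nat (l - k)" using kl by (simp add: power_int_def)
      finally show False using \<pi>U[of "nat (l - k)"] kl by simp
    qed
    from *[OF that] *[OF that(2,1)] show ?thesis by simp
  qed
  have int_unit: "\<exists>k. of_int c * \<pi> powi (- k) \<in> ?U" if "c \<noteq> 0" for c :: int
  proof -
    have "\<not> is_unit p" using p(2) by simp
    with that obtain c' where c': "c = p ^ multiplicity p c * c'" "\<not> p dvd c'"
      by (rule multiplicity_decompose')
    have "of_int c' \<notin> P" using p(1) c'(2) by simp
    then have "of_int c' / 1 \<in> ?U"
      using of_int_in_ring_of_integers[OF Ks] R prime_inD(2)[OF P'] by (intro local_unitsI) auto
    moreover have "of_int c * \<pi> powi (- int (multiplicity p c)) = of_int c'"
      using \<pi>0 by (subst c'(1)) (simp add: \<pi>_def power_int_minus)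
    ultimately show ?thesis by (intro exI[of _ "int (multiplicity p c)"]) simp
  qed
  obtain n where n: "\<And>x. x \<in> K \<Longrightarrow> \<exists>f :: int poly. f \<noteq> 0 \<and> degree f \<le> n \<and> poly (map_poly of_int f) x = 0"
    using number_field_int_relation[OF K] by metis
  \<comment> \<open>a common multiple of all differences of exponents in a relation of degree at most \<open>n\<close>\<close>
  define M :: nat where "M = fact n"
  have M: "M > 0" by (simp add: M_def)
  have ex: "\<exists>k. x ^ M * \<pi> powi (- k) \<in> ?U" if x: "x \<in> K - {0}" for x
  proof -
    obtain f :: "int poly" where f: "f \<noteq> 0" "degree f \<le> n" "poly (map_poly of_int f) x = 0"
      using n x by blast
    define J where "J = {i. i \<le> degree f \<and> coeff f i \<noteq> 0}"
    have "(\<Sum>i\<in>J. of_int (coeff f i) * x ^ i) = (\<Sum>i\<le>degree f. of_int (coeff f i) * x ^ i)"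
      by (rule sum.mono_neutral_left) (auto simp: J_def)
    also have "\<dots> = 0" using f(3) by (simp add: poly_altdef degree_map_poly)
    finally have rel: "(\<Sum>i\<in>J. of_int (coeff f i) * x ^ i) = 0" .
    have "finite J" "J \<noteq> {}" using f(1) by (auto simp: J_def intro!: exI[of _ "degree f"])
    moreover have "of_int (coeff f i) * x ^ i \<in> K - {0}" if "i \<in> J" for i
      using that x by (auto simp: J_def is_subfieldD[OF Ks] is_subfield_of_int[OF Ks])
    ultimately obtain i j where ij: "i \<in> J" "j \<in> J" "i \<noteq> j"
      "(of_int (coeff f i) * x ^ i) / (of_int (coeff f j) * x ^ j) \<in> ?U"
      using unit_terms_of_relation[OF K P', of J "\<lambda>i. of_int (coeff f i) * x ^ i"] rel by blast
    obtain k where k: "of_int (coeff f i) * \<pi> powi (- k) \<in> ?U" using int_unit ij by (auto simp: J_def)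
    obtain l where l: "of_int (coeff f j) * \<pi> powi (- l) \<in> ?U" using int_unit ij by (auto simp: J_def)
    have x0: "x \<noteq> 0" using x by simp
    have cnz: "(of_int (coeff f i) :: 'a) \<noteq> 0" "(of_int (coeff f j) :: 'a) \<noteq> 0" using ij by (auto simp: J_def)
    define d where "d = int i - int j"
    have "(of_int (coeff f i) * x ^ i) / (of_int (coeff f j) * x ^ j) *
        inverse (of_int (coeff f i) * \<pi> powi (- k)) * (of_int (coeff f j) * \<pi> powi (- l)) \<in> ?U"
      by (intro U(3) U(4) ij k l)
    also have "(of_int (coeff f i) * x ^ i) / (of_int (coeff f j) * x ^ j) *
        inverse (of_int (coeff f i) * \<pi> powi (- k)) * (of_int (coeff f j) * \<pi> powi (- l)) =
        x powi d * \<pi> powi (k - l)"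
      using x0 \<pi>0 cnz by (simp add: d_def power_int_diff power_int_minus field_simps)
    finally have xd: "x powi d * \<pi> powi (k - l) \<in> ?U" .
    have "\<bar>d\<bar> \<le> int n" "d \<noteq> 0" using ij f(2) by (auto simp: J_def d_def)
    then have "nat \<bar>d\<bar> dvd M" unfolding M_def by (intro dvd_fact) auto
    then have "d dvd int M" by (simp flip: int_dvd_int_iff)
    then obtain q where q: "int M = d * q" by (rule dvdE)
    have "(x powi d * \<pi> powi (k - l)) powi q \<in> ?U" using xd by (rule Upow)
    also have "(x powi d * \<pi> powi (k - l)) powi q = x powi (int M) * \<pi> powi ((k - l) * q)"
      by (simp add: q power_int_mult_distrib power_int_mult)
    finally show ?thesis by (intro exI[of _ "- ((k - l) * q)"]) simp
  qed
  define w where "w x = (SOME k. x ^ M * \<pi> powi (- k) \<in> ?U)" for x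
  have w: "x ^ M * \<pi> powi (- w x) \<in> ?U" if "x \<in> K - {0}" for x
    unfolding w_def using ex[OF that] by (rule someI_ex)
  show thesis
  proof (rule that)
    show "p \<noteq> 0" using p(2) by simp
  next
    fix x y assume xy: "x \<in> K - {0}" "y \<in> K - {0}"
    then have "x * y \<in> K - {0}" by (auto simp: is_subfieldD[OF Ks])
    then have "(x * y) ^ M * \<pi> powi (- w (x * y)) \<in> ?U" by (rule w)
    moreover have "(x ^ M * \<pi> powi (- w x)) * (y ^ M * \<pi> powi (- w y)) \<in> ?U"
      by (rule U(3)[OF w[OF xy(1)] w[OF xy(2)]])
    then have "(x * y) ^ M * \<pi> powi (- (w x + w y)) \<in> ?U"
      using \<pi>0 by (simp add: power_int_diff power_int_minus power_mult_distrib field_simps)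
    ultimately show "w (x * y) = w x + w y" by (rule uniq)
  next
    fix x and C :: nat assume x: "x \<in> K - {0}" and C: "w x \<ge> - int C"
    have "int C * 1 \<le> int C * int M" using M by (intro mult_left_mono) auto
    then have nn: "int (C * M) + w x \<ge> 0" using C by simp
    have "(\<pi> ^ C * x) ^ M = \<pi> powi (int (C * M) + w x) * (x ^ M * \<pi> powi (- w x))"
      using \<pi>0 by (simp add: power_mult_distrib power_int_add power_int_minus power_int_mult flip: power_mult)
    also have "\<pi> powi (int (C * M) + w x) = \<pi> ^ nat (int (C * M) + w x)"
      using nn by (simp add: power_int_def)
    also have "\<pi> ^ nat (int (C * M) + w x) * (x ^ M * \<pi> powi (- w x)) \<in> ?L"
      by (rule localized_times[OF Ks P' \<pi>L UL[OF w[OF x]]])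
    finally have "(\<pi> ^ C * x) ^ M \<in> ?L" .
    then have "\<pi> ^ C * x \<in> ?L"
    proof (rule localized_power_cancel[OF K P' _ _ M, rotated])
      show "\<pi> ^ C * x \<in> K" using x \<pi>K by (simp add: is_subfieldD[OF Ks])
    qed
    then show "of_int p ^ C * x \<in> ?L" by (simp add: \<pi>_def)
  qed
qed

section \<open>Primes over a given prime\<close>

text \<open>
  The ideal \<open>I\<close> of the elements whose norm is in \<open>P\<close>, and whose multiples all have trace in \<open>P\<close>,
  contains \<open>P\<close>. It contains no integer \<open>s\<close> of \<open>F\<close> outside \<open>P\<close>, because the norm of \<open>s\<close> is \<open>s\<^sup>2\<close>. A prime
  ideal that contains \<open>I\<close> and avoids these \<open>s\<close> contracts to \<open>P\<close>. The condition on traces makes \<open>I\<close>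
  closed under addition, since \<open>N (x + y) = N x + N y + Tr (x * \<sigma> y)\<close>.
\<close>

lemma lying_over_quadratic:
  assumes K: "is_subfield K" and F: "is_subfield F" "F \<subseteq> K"
    and \<sigma>: "hom_on K \<sigma>" "\<And>x. x \<in> K \<Longrightarrow> \<sigma> x \<in> K" "\<And>x. x \<in> K \<Longrightarrow> \<sigma> (\<sigma> x) = x"
    and fixed: "\<And>x. x \<in> K \<Longrightarrow> \<sigma> x = x \<longleftrightarrow> x \<in> F"
    and P: "prime_in (ring_of_integers F) (P :: 'a::field_char_0 set)"
  obtains Q where "prime_in (ring_of_integers K) Q" "Q \<inter> F = P"
proof -
  note RK = is_subring_ring_of_integers[OF K] and RF = is_subring_ring_of_integers[OF F(1)]
  note rK = is_subringD[OF RK] and rF = is_subringD[OF RF]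
  note id = ideal_inD[OF prime_inD(1)[OF P]]
  let ?OK = "ring_of_integers K" and ?OF = "ring_of_integers F"
  have OFK: "x \<in> ?OK" if "x \<in> ?OF" for x using that F(2) by (auto simp: ring_of_integers_def)
  have OF: "x \<in> ?OF" if "x \<in> ?OK" "\<sigma> x = x" for x
    using that fixed by (auto simp: ring_of_integers_def)
  have \<sigma>O: "\<sigma> x \<in> ?OK" if "x \<in> ?OK" for x
    using that \<sigma>(2) hom_on_algebraic_int[OF \<sigma>(1) K] by (auto simp: ring_of_integers_def)
  have inK: "x \<in> K" if "x \<in> ?OK" for x using that by (simp add: ring_of_integers_def)
  note h = hom_onD[OF \<sigma>(1) K]
  have N: "x * \<sigma> x \<in> ?OF" if "x \<in> ?OK" for x
    using that by (intro OF rK(5) \<sigma>O) (simp_all add: h \<sigma>(2,3) inK mult.commute)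
  have T: "x + \<sigma> x \<in> ?OF" if "x \<in> ?OK" for x
    using that by (intro OF rK(4) \<sigma>O) (simp_all add: h \<sigma>(2,3) inK add.commute)
  define I where "I = {x \<in> ?OK. x * \<sigma> x \<in> P \<and> (\<forall>y\<in>?OK. x * y + \<sigma> (x * y) \<in> P)}"
  have I: "ideal_in ?OK I" unfolding ideal_in_def
  proof (intro conjI ballI)
    show "I \<subseteq> ?OK" by (auto simp: I_def)
    show "0 \<in> I" using id(2) rK(1) by (auto simp: I_def h)
  next
    fix x x' assume x: "x \<in> I" and x': "x' \<in> I"
    then have O: "x \<in> ?OK" "x' \<in> ?OK" by (auto simp: I_def)
    have "(x + x') * \<sigma> (x + x') = (x * \<sigma> x + x' * \<sigma> x') + (x * \<sigma> x' + \<sigma> (x * \<sigma> x'))"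
      using O by (simp add: h \<sigma>(2,3) inK algebra_simps)
    also have "\<dots> \<in> P"
    proof (rule id(3)[OF id(3)])
      show "x * \<sigma> x \<in> P" "x' * \<sigma> x' \<in> P" using x x' by (auto simp: I_def)
      show "x * \<sigma> x' + \<sigma> (x * \<sigma> x') \<in> P" using x \<sigma>O[OF O(2)] unfolding I_def by blast
    qed
    finally have N: "(x + x') * \<sigma> (x + x') \<in> P" .
    have "(x + x') * y + \<sigma> ((x + x') * y) \<in> P" if y: "y \<in> ?OK" for y
    proof -
      have "(x + x') * y + \<sigma> ((x + x') * y) = (x * y + \<sigma> (x * y)) + (x' * y + \<sigma> (x' * y))"
        using O y by (simp add: h inK is_subfieldD[OF K] algebra_simps)
      also have "\<dots> \<in> P"
      proof (rule id(3))
        show "x * y + \<sigma> (x * y) \<in> P" "x' * y + \<sigma> (x' * y) \<in> P" using x x' y unfolding I_def by blast+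
      qed
      finally show ?thesis .
    qed
    then show "x + x' \<in> I" using N O rK by (simp add: I_def)
  next
    fix r x assume r: "r \<in> ?OK" and x: "x \<in> I"
    then have O: "x \<in> ?OK" by (auto simp: I_def)
    have "(r * x) * \<sigma> (r * x) = (r * \<sigma> r) * (x * \<sigma> x)" using r O by (simp add: h inK mult_ac)
    also have "\<dots> \<in> P" using x by (intro id(4)[OF N[OF r]]) (auto simp: I_def)
    finally have N: "(r * x) * \<sigma> (r * x) \<in> P" .
    have "(r * x) * y + \<sigma> ((r * x) * y) \<in> P" if y: "y \<in> ?OK" for y
    proof -
      have "x * (r * y) + \<sigma> (x * (r * y)) \<in> P" using x rK(5)[OF r y] by (auto simp: I_def)
      then show ?thesis by (simp add: mult_ac)
    qed
    then show "r * x \<in> I" using N r O rK by (simp add: I_def)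
  qed
  have PI: "P \<subseteq> I"
  proof
    fix p assume p: "p \<in> P"
    then have pO: "p \<in> ?OF" by (rule id(1))
    have "\<sigma> p = p" using pO F(2) fixed by (auto simp: ring_of_integers_def)
    moreover have "p * p \<in> P" using id(4)[OF pO p] .
    moreover have "p * y + \<sigma> (p * y) \<in> P" if "y \<in> ?OK" for y
    proof -
      have "p * y + \<sigma> (p * y) = (y + \<sigma> y) * p"
        using \<open>\<sigma> p = p\<close> inK[OF that] inK[OF OFK[OF pO]] by (simp add: h algebra_simps)
      then show ?thesis using id(4)[OF T[OF that] p] by simp
    qed
    ultimately show "p \<in> I" using OFK[OF pO] by (simp add: I_def)
  qed
  have disj: "I \<inter> (?OF - P) = {}"
  proof -
    have False if s: "s \<in> I" "s \<in> ?OF" "s \<notin> P" for s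
    proof -
      have "\<sigma> s = s" using s(2) F(2) fixed by (auto simp: ring_of_integers_def)
      then have "s * s \<in> P" using s(1) by (auto simp: I_def)
      then show False using prime_inD(5)[OF P s(2,2)] s(3) by simp
    qed
    then show ?thesis by blast
  qed
  obtain Q where Q: "prime_in ?OK Q" "I \<subseteq> Q" "Q \<inter> (?OF - P) = {}"
  proof (rule prime_ideal_avoiding[OF RK I _ _ _ disj])
    show "?OF - P \<subseteq> ?OK" using OFK by blast
    show "1 \<in> ?OF - P" using rF(2) prime_inD(2)[OF P] by simp
    show "x * y \<in> ?OF - P" if "x \<in> ?OF - P" "y \<in> ?OF - P" for x y
      using that rF(5) prime_inD(5)[OF P] by auto
  qed
  have "Q \<inter> F = P"
  proof
    show "Q \<inter> F \<subseteq> P"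
    proof
      fix x assume x: "x \<in> Q \<inter> F"
      then have "x \<in> ?OF" using prime_inD(4)[OF Q(1)] by (auto simp: ring_of_integers_def)
      then show "x \<in> P" using x Q(3) by blast
    qed
    show "P \<subseteq> Q \<inter> F" using PI Q(2) id(1) by (auto simp: ring_of_integers_def)
  qed
  with Q(1) show thesis by (rule that)
qed

section \<open>S-units\<close>

lemma S_units_iff:
  assumes K: "is_subfield K"
  shows "x \<in> S_units K S \<longleftrightarrow> x \<in> K \<and> x \<noteq> 0 \<and>
    (\<forall>P. finite_prime_ideal K P \<longrightarrow> Finite_Prime P \<notin> S \<longrightarrow> x \<in> local_units K P)"
proof -
  have U: "x \<in> S_units K S \<longleftrightarrow> x \<noteq> 0 \<and> x \<in> S_integers K S \<and> inverse x \<in> S_integers K S"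
  proof
    assume "x \<in> S_units K S"
    then obtain y where y: "x \<in> S_integers K S" "y \<in> S_integers K S" "y * x = 1"
      by (auto simp: S_units_def Units_def)
    then have "x \<noteq> 0" "y = inverse x" by (auto simp: inverse_unique mult.commute)
    then show "x \<noteq> 0 \<and> x \<in> S_integers K S \<and> inverse x \<in> S_integers K S" using y by blast
  next
    assume "x \<noteq> 0 \<and> x \<in> S_integers K S \<and> inverse x \<in> S_integers K S"
    then show "x \<in> S_units K S"
      unfolding S_units_def Units_def by (auto intro!: bexI[of _ "inverse x"])
  qed
  have prime: "prime_in (ring_of_integers K) P" if "finite_prime_ideal K P" for P
    using that by (simp add: finite_prime_ideal_def)
  show ?thesis
    unfolding U S_integers_def using is_subfieldD(6)[OF K]
    by (auto simp: Finite_Prime_in_finite_primes_iff[OF K] local_units_iff[OF K prime])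
qed

lemma mult_subgroup_S_units:
  assumes K: "is_subfield K" shows "mult_subgroup (S_units K S)"
proof -
  have loc: "mult_subgroup (local_units K P)" if "finite_prime_ideal K P" for P
    using mult_subgroup_local_units[OF K, of P] that by (simp add: finite_prime_ideal_def)
  show ?thesis unfolding mult_subgroup_def
    using loc by (auto simp: S_units_iff[OF K] is_subfieldD[OF K] mult_subgroupD)
qed

lemma algebraic_unit_in_S_units:
  assumes K: "is_subfield K" and x: "x \<in> K" "x \<noteq> 0" "algebraic_int x" "algebraic_int (inverse x)"
  shows "x \<in> S_units K S"
proof -
  have "x \<in> ring_of_integers K" "inverse x \<in> ring_of_integers K"
    using x by (auto simp: ring_of_integers_def is_subfieldD[OF K])
  then show ?thesis
    unfolding S_units_iff[OF K] finite_prime_ideal_def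
    using x by (auto simp: local_units_iff[OF K] integers_subset_localized[OF K])
qed

lemma mult_subgroup_roots_of_unity:
  assumes K: "is_subfield K" shows "mult_subgroup (roots_of_unity K)"
  unfolding mult_subgroup_def
proof (intro conjI ballI)
  show "1 \<in> roots_of_unity K" by (auto simp: roots_of_unity_def is_subfieldD[OF K])
  show "0 \<notin> roots_of_unity K" by (auto simp: roots_of_unity_def zero_power)
  fix x assume "x \<in> roots_of_unity K"
  then obtain n where x: "x \<in> K" "n > 0" "x ^ n = 1" by (auto simp: roots_of_unity_def)
  then show "inverse x \<in> roots_of_unity K"
    by (auto simp: roots_of_unity_def is_subfieldD[OF K] power_inverse)
  fix y assume "y \<in> roots_of_unity K"
  then obtain m where y: "y \<in> K" "m > 0" "y ^ m = 1" by (auto simp: roots_of_unity_def)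
  have "(x * y) ^ (n * m) = (x ^ n) ^ m * (y ^ m) ^ n"
    unfolding power_mult_distrib power_mult[symmetric] by (simp only: mult.commute)
  then have "(x * y) ^ (n * m) = 1" using x y by simp
  then show "x * y \<in> roots_of_unity K"
    using x y unfolding roots_of_unity_def by (auto simp: is_subfieldD[OF K] intro!: exI[of _ "n * m"])
qed

lemma roots_of_unity_subset_S_units:
  assumes K: "is_subfield K" shows "roots_of_unity K \<subseteq> S_units K S"
proof
  fix x assume "x \<in> roots_of_unity K"
  then obtain n where x: "x \<in> K" "n > 0" "x ^ n = 1" by (auto simp: roots_of_unity_def)
  moreover have "inverse x ^ n = 1" using x by (simp add: power_inverse)
  moreover have "x \<noteq> 0" using x by (auto simp: zero_power)
  ultimately show "x \<in> S_units K S"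
    using algebraic_int_root_of_unity by (intro algebraic_unit_in_S_units[OF K]) blast+
qed

text \<open>
  The coordinates are \<open>ln (norm (\<tau> x))\<close> for the embeddings \<open>\<tau>\<close> and the valuations of \<open>x\<close> at the
  finite primes in \<open>S\<close>. If all of them are bounded by \<open>C\<close>, a fixed integer \<open>m\<close> depending on \<open>C\<close> clears
  the denominators, and \<open>m * x\<close> is an algebraic integer with bounded conjugates. So there are
  finitely many such \<open>x\<close>, and the group is discrete.
\<close>

lemma S_units_finitely_generated:
  assumes K: "number_field K" and emb: "finite (embeddings K)" and S: "finite S"
  obtains E T where "E \<subseteq> S_units K S" "mult_independent E" "finite T" "T \<subseteq> S_units K S"
    "\<And>a. a \<in> S_units K S \<Longrightarrow> \<exists>t\<in>T. a / t \<in> mult_span E"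
proof -
  note Ks = number_field_is_subfield[OF K]
  note R = is_subringD[OF is_subring_ring_of_integers[OF Ks]]
  note A = mult_subgroup_S_units[OF Ks, of S]
  have AK: "x \<in> K - {0}" if "x \<in> S_units K S" for x using that by (simp add: S_units_iff[OF Ks])
  define Ps where "Ps = {P. finite_prime_ideal K P \<and> Finite_Prime P \<in> S}"
  have finPs: "finite Ps"
    by (rule finite_subset[OF _ finite_vimageI[OF S, of Finite_Prime]]) (auto simp: Ps_def inj_def)
  define good where "good P wp \<longleftrightarrow> snd wp \<noteq> (0::int) \<and>
      (\<forall>x\<in>K - {0}. \<forall>y\<in>K - {0}. fst wp (x * y) = fst wp x + (fst wp y :: int)) \<and>
      (\<forall>x\<in>K - {0}. \<forall>C. fst wp x \<ge> - int C \<longrightarrow> of_int (snd wp) ^ C * x \<in> integers_localized_at K P)" for P wp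
  have "\<exists>wp. good P wp" if "P \<in> Ps" for P
  proof -
    have P: "finite_prime_ideal K P" using that by (simp add: Ps_def)
    obtain w p where wp: "p \<noteq> 0"
      "\<And>x y. x \<in> K - {0} \<Longrightarrow> y \<in> K - {0} \<Longrightarrow> w (x * y) = w x + w y"
      "\<And>x C. x \<in> K - {0} \<Longrightarrow> w x \<ge> - int C \<Longrightarrow> of_int p ^ C * x \<in> integers_localized_at K P"
      by (rule prime_ideal_valuation[OF K P]) (rule that)
    show ?thesis unfolding good_def by (intro exI[of _ "(w, p)"] conjI ballI allI impI) (simp_all add: wp)
  qed
  then have "\<forall>P\<in>Ps. \<exists>wp. good P wp" by simp
  then obtain wp where wp: "\<forall>P\<in>Ps. good P (wp P)" using bchoice by metis
  define w where "w P = fst (wp P)" for P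
  define p where "p P = snd (wp P)" for P
  have p0: "p P \<noteq> 0" if "P \<in> Ps" for P using wp that by (simp add: good_def p_def)
  have w_add: "w P (x * y) = w P x + w P y" if "P \<in> Ps" "x \<in> K - {0}" "y \<in> K - {0}" for P x y
    using wp that by (simp add: good_def w_def)
  have w_loc: "of_int (p P) ^ C * x \<in> integers_localized_at K P"
    if "P \<in> Ps" "x \<in> K - {0}" "w P x \<ge> - int C" for P x C
    using wp that by (simp add: good_def w_def p_def)
  define J where "J = Inl ` embeddings K \<union> Inr ` Ps"
  define L :: "('a \<Rightarrow> complex) + 'a set \<Rightarrow> 'a \<Rightarrow> real" where
    "L i x = (case i of Inl \<tau> \<Rightarrow> ln (norm (\<tau> x)) | Inr P \<Rightarrow> real_of_int (w P x))" for i x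
  have \<tau>0: "\<tau> x \<noteq> 0" if "\<tau> \<in> embeddings K" "x \<in> K - {0}" for \<tau> x
    using hom_onD(9)[OF embeddings_hom_on[OF that(1)] Ks, of x] that(2) by simp
  have "\<exists>E T. E \<subseteq> S_units K S \<and> mult_independent E \<and> finite T \<and> T \<subseteq> S_units K S \<and>
      (\<forall>a\<in>S_units K S. \<exists>t\<in>T. a / t \<in> mult_span E)"
  proof (rule finitely_generated_of_discrete_log[of J _ L "{}"])
    show "finite J" using emb finPs by (simp add: J_def)
    show "mult_subgroup (S_units K S)" by (rule A)
    show "mult_independent {}" by (simp add: mult_independent_def)
  next
    fix i x y assume i: "i \<in> J" and xy: "x \<in> S_units K S" "y \<in> S_units K S"
    note x = AK[OF xy(1)] and y = AK[OF xy(2)]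
    show "L i (x * y) = L i x + L i y"
    proof (cases i)
      case (Inl \<tau>)
      then have \<tau>: "\<tau> \<in> embeddings K" using i by (auto simp: J_def)
      have "\<tau> (x * y) = \<tau> x * \<tau> y" using hom_onD(4)[OF embeddings_hom_on[OF \<tau>] Ks] x y by simp
      then show ?thesis using \<tau>0[OF \<tau> x] \<tau>0[OF \<tau> y] by (simp add: L_def Inl norm_mult ln_mult)
    next
      case (Inr P)
      then have "P \<in> Ps" using i by (auto simp: J_def)
      then show ?thesis using w_add x y by (simp add: L_def Inr)
    qed
  next
    fix C :: real
    define N where "N = nat \<lceil>\<bar>C\<bar>\<rceil>"
    \<comment> \<open>clears the denominators at all primes in \<open>S\<close> of the elements considered\<close>
    define m where "m = (\<Prod>P\<in>Ps. p P ^ N)"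
    have m0: "m \<noteq> 0" using p0 finPs by (simp add: m_def)
    define B where "B = {y \<in> K. algebraic_int y \<and> (\<forall>\<tau>\<in>embeddings K. norm (\<tau> y) \<le> \<bar>of_int m\<bar> * exp C)}"
    define T where "T = {a \<in> S_units K S. \<forall>i\<in>J. \<bar>L i a\<bar> \<le> C}"
    have "(\<lambda>a. of_int m * a) ` T \<subseteq> B"
    proof (rule image_subsetI)
      fix a assume a: "a \<in> T"
      then have aU: "a \<in> S_units K S" and aK: "a \<in> K - {0}" using AK by (auto simp: T_def)
      have La: "\<bar>L i a\<bar> \<le> C" if "i \<in> J" for i using a that by (simp add: T_def)
      have maK: "of_int m * a \<in> K" using aK by (simp add: is_subfieldD[OF Ks] is_subfield_of_int[OF Ks])
      have "algebraic_int (of_int m * a)"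
      proof (rule algebraic_int_of_localized[OF K maK])
        fix P assume P: "finite_prime_ideal K P"
        then have P': "prime_in (ring_of_integers K) P" by (simp add: finite_prime_ideal_def)
        have int: "of_int k \<in> integers_localized_at K P" for k
          by (rule integers_subset_localized[OF Ks P' of_int_in_ring_of_integers[OF Ks]])
        show "of_int m * a \<in> integers_localized_at K P"
        proof (cases "Finite_Prime P \<in> S")
          case False
          then have "a \<in> local_units K P" using aU P S_units_iff[OF Ks] by blast
          then show ?thesis using int localized_times[OF Ks P'] local_units_iff[OF Ks P'] by blast
        next
          case True
          then have PPs: "P \<in> Ps" using P by (simp add: Ps_def)
          then have "Inr P \<in> J" by (simp add: J_def)
          from La[OF this] have "\<bar>real_of_int (w P a)\<bar> \<le> C" by (simp add: L_def)
          then have "w P a \<ge> - int N" unfolding N_def by linarith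
          then have "of_int (p P) ^ N * a \<in> integers_localized_at K P" by (rule w_loc[OF PPs aK])
          then have "of_int (\<Prod>P\<in>Ps - {P}. p P ^ N) * (of_int (p P) ^ N * a) \<in> integers_localized_at K P"
            by (rule localized_times[OF Ks P' int])
          moreover have "m = p P ^ N * (\<Prod>P\<in>Ps - {P}. p P ^ N)"
            unfolding m_def using finPs PPs by (rule prod.remove)
          ultimately show ?thesis by (simp add: mult_ac)
        qed
      qed
      moreover have "norm (\<tau> (of_int m * a)) \<le> \<bar>of_int m\<bar> * exp C" if \<tau>: "\<tau> \<in> embeddings K" for \<tau>
      proof -
        have "Inl \<tau> \<in> J" using \<tau> by (simp add: J_def)
        from La[OF this] have "ln (norm (\<tau> a)) \<le> C" by (simp add: L_def)
        then have "exp (ln (norm (\<tau> a))) \<le> exp C" by simp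
        then have "norm (\<tau> a) \<le> exp C" using \<tau>0[OF \<tau> aK] by simp
        moreover have "\<tau> (of_int m * a) = of_int m * \<tau> a"
          using hom_onD(4)[OF embeddings_hom_on[OF \<tau>] Ks] hom_on_of_int[OF embeddings_hom_on[OF \<tau>] Ks] aK
          by (simp add: is_subfield_of_int[OF Ks])
        ultimately show ?thesis by (simp add: norm_mult mult_left_mono)
      qed
      ultimately show "of_int m * a \<in> B" using maK by (simp add: B_def)
    qed
    then have "finite ((\<lambda>a. of_int m * a) ` T)"
      using finite_bounded_algebraic_ints[OF K] finite_subset unfolding B_def by blast
    moreover have "inj_on (\<lambda>a. of_int m * a) T" using m0 by (auto simp: inj_on_def)
    ultimately have "finite T" by (rule finite_imageD)
    moreover have "T \<subseteq> S_units K S" by (auto simp: T_def)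
    moreover have "\<exists>t\<in>T. a / t \<in> mult_span {}" if "a \<in> S_units K S" "\<forall>i\<in>J. \<bar>L i a\<bar> \<le> C" for a
      using that AK[OF that(1)] by (intro bexI[of _ a]) (auto simp: T_def mult_span_def)
    ultimately show "\<exists>T. finite T \<and> T \<subseteq> S_units K S \<and>
        (\<forall>a\<in>S_units K S. (\<forall>i\<in>J. \<bar>L i a\<bar> \<le> C) \<longrightarrow> (\<exists>t\<in>T. a / t \<in> mult_span {}))"
      by (intro exI[of _ T]) simp
  qed simp_all
  then obtain E T where ET: "E \<subseteq> S_units K S" "mult_independent E" "finite T" "T \<subseteq> S_units K S"
      "\<forall>a\<in>S_units K S. \<exists>t\<in>T. a / t \<in> mult_span E" by (elim exE conjE)
  show thesis by (rule that[OF ET(1-4)]) (use ET(5) in simp)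
qed

text \<open>
  Two powers of \<open>a\<close> lie in the same coset of the span.
\<close>

lemma power_in_span_of_finite_index:
  assumes E: "0 \<notin> E" and A: "mult_subgroup A" and T: "finite T" "T \<subseteq> A"
    and AT: "\<And>a. a \<in> A \<Longrightarrow> \<exists>t\<in>T. a / t \<in> mult_span E" and a: "a \<in> A"
  shows "\<exists>m>0. a ^ m \<in> mult_span E"
proof -
  have "\<exists>t\<in>T. a ^ i / t \<in> mult_span E" for i :: nat by (rule AT[OF mult_subgroup_power[OF A a]])
  then have "\<forall>i. \<exists>t. t \<in> T \<and> a ^ i / t \<in> mult_span E" by (simp add: Bex_def)
  then obtain t where t': "\<forall>i::nat. t i \<in> T \<and> a ^ i / t i \<in> mult_span E" by (elim choice[THEN exE])
  then have t: "\<And>i. t i \<in> T" "\<And>i. a ^ i / t i \<in> mult_span E" by simp_all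
  have "finite (range t)" using T(1) by (rule finite_subset[rotated]) (use t(1) in auto)
  then have "\<not> inj t" using finite_imageD[of t UNIV] infinite_UNIV_nat by auto
  then obtain i j where ij: "i < j" "t i = t j"
    unfolding inj_def by (metis linorder_neqE_nat)
  have "t j \<in> A" using T(2) t(1) by (rule subsetD)
  then have nz: "a \<noteq> 0" "t j \<noteq> 0" using mult_subgroupD(6)[OF A] a by simp_all
  have "(a ^ j / t j) / (a ^ i / t i) \<in> mult_span E"
    by (rule mult_subgroupD(5)[OF mult_subgroup_span[OF E] t(2) t(2)])
  also have "(a ^ j / t j) / (a ^ i / t i) = a ^ (j - i)"
    using nz ij by (simp add: power_diff)
  finally show ?thesis using ij by (intro exI[of _ "j - i"]) simp
qed

section \<open>Complex conjugation on a CM field\<close>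

locale CM_conjugation =
  fixes K F :: "'a::field_char_0 set" and \<sigma> :: "'a \<Rightarrow> 'a"
  assumes CM: "CM_extension K F" and conj: "complex_conjugation K F \<sigma>"
begin

lemma number_field_K: "number_field K" and number_field_F: "number_field F"
  using CM by (auto simp: CM_extension_def)

lemma subfield_K: "is_subfield K" and subfield_F: "is_subfield F"
  using number_field_K number_field_F number_field_is_subfield by auto

lemma F_subset_K: "F \<subseteq> K"
  using CM subfield_ring_onD(1)[OF _ cring_ring_on_subfield[OF subfield_K]] by (simp add: CM_extension_def)

lemma Gal_carrier:
  "carrier (Gal K F) = {s \<in> Bij K. hom_on K s \<and> s ` K \<subseteq> K \<and> (\<forall>x\<in>F. s x = x)}"
  unfolding Gal_def by (auto simp: Ring.ring_hom_def hom_on_def)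

lemma \<sigma>_Gal: "\<sigma> \<in> carrier (Gal K F)" using conj by (simp add: complex_conjugation_def)

lemma \<sigma>_hom: "hom_on K \<sigma>" and \<sigma>_closed: "x \<in> K \<Longrightarrow> \<sigma> x \<in> K" and \<sigma>_F: "x \<in> F \<Longrightarrow> \<sigma> x = x"
    and \<sigma>_Bij: "\<sigma> \<in> Bij K"
  using \<sigma>_Gal by (auto simp: Gal_carrier)

lemmas \<sigma>_simps = hom_onD[OF \<sigma>_hom subfield_K]

lemma embedding_\<sigma>: "\<tau> \<in> embeddings K \<Longrightarrow> x \<in> K \<Longrightarrow> \<tau> (\<sigma> x) = cnj (\<tau> x)"
  using conj by (simp add: complex_conjugation_def)

lemma embedding_eq_iff: "\<tau> \<in> embeddings K \<Longrightarrow> x \<in> K \<Longrightarrow> y \<in> K \<Longrightarrow> \<tau> x = \<tau> y \<longleftrightarrow> x = y"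
  using hom_onD(9)[OF embeddings_hom_on subfield_K, of \<tau> "x - y"] hom_onD(6)[OF embeddings_hom_on subfield_K, of \<tau> x y]
    is_subfieldD(7)[OF subfield_K, of x y] by simp

lemma embedding_exists: obtains \<tau> where "\<tau> \<in> embeddings K"
  using embeddings_nonempty[OF number_field_K] by blast

lemma \<sigma>_\<sigma>: "x \<in> K \<Longrightarrow> \<sigma> (\<sigma> x) = x"
proof -
  assume x: "x \<in> K"
  obtain \<tau> where \<tau>: "\<tau> \<in> embeddings K" by (rule embedding_exists)
  have "\<tau> (\<sigma> (\<sigma> x)) = \<tau> x" using x by (simp add: embedding_\<sigma>[OF \<tau>] \<sigma>_closed)
  then show ?thesis using embedding_eq_iff[OF \<tau>] x \<sigma>_closed by simp
qed

lemma \<sigma>_nontrivial: obtains x where "x \<in> K" "\<sigma> x \<noteq> x"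
proof -
  obtain \<tau> where \<tau>: "\<tau> \<in> embeddings K" by (rule embedding_exists)
  then have "\<not> \<tau> ` K \<subseteq> \<real>" using CM by (simp add: CM_extension_def totally_imaginary_def)
  then obtain x where x: "x \<in> K" "\<tau> x \<notin> \<real>" by blast
  then have "cnj (\<tau> x) \<noteq> \<tau> x" by (simp add: Reals_cnj_iff)
  then have "\<sigma> x \<noteq> x" using embedding_\<sigma>[OF \<tau> x(1)] by metis
  with x(1) show thesis by (rule that)
qed

text \<open>
  As \<open>K\<close> has degree 2 over \<open>F\<close>, two independent elements span it.
\<close>

lemma basis_1_y:
  assumes y: "y \<in> K" "y \<notin> F" and x: "x \<in> K"
  obtains a b where "a \<in> F" "b \<in> F" "x = a + b * y"
proof -
  interpret field "ring_on K" by (rule field_ring_on[OF subfield_K])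
  have sub: "subfield F (ring_on K)" and dim: "dimension 2 F K"
    using CM by (auto simp: CM_extension_def)
  have span1: "Span F [1] = F"
  proof -
    have "Span F [1] = {combine ks [1] | ks. length ks = length [1::'a] \<and> set ks \<subseteq> F}"
      by (rule Span_eq_combine_set_length_version[OF sub]) (simp add: is_subfieldD[OF subfield_K])
    also have "\<dots> = F"
    proof (intro equalityI subsetI)
      fix u assume "u \<in> F"
      then have "u = combine [u] [1]" "set [u] \<subseteq> F" by auto
      then show "u \<in> {combine ks [1] | ks. length ks = length [1::'a] \<and> set ks \<subseteq> F}"
        by (intro CollectI exI[of _ "[u]"]) auto
    qed (auto simp: length_Suc_conv)
    finally show ?thesis .
  qed
  have "independent F [y, 1]"
  proof (intro li_Cons)
    show "y \<notin> Span F [1]" using span1 y by simp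
    show "1 \<notin> Span F []" by simp
  qed (use y subfield_K in \<open>auto simp: is_subfieldD\<close>)
  then have "Span F [y, 1] = K"
    using independent_length_eq_dimension[OF sub dim, of "[y, 1]"] y is_subfieldD(2)[OF subfield_K] by simp
  then have "x \<in> Span F [y, 1]" using x by simp
  then obtain ks where ks: "set ks \<subseteq> F" "length ks = 2" "x = combine ks [y, 1]"
    using Span_mem_iff_length_version[OF sub, of "[y, 1]" x] y is_subfieldD(2)[OF subfield_K] by auto
  then obtain b a where "ks = [b, a]" by (auto simp: length_Suc_conv numeral_2_eq_2)
  then show thesis using ks by (intro that[of a b]) (auto simp: add.commute)
qed

text \<open>
  A fixed element outside \<open>F\<close> would generate \<open>K\<close> over \<open>F\<close>, and \<open>\<sigma>\<close> would be the identity. But \<open>\<sigma>\<close> moves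
  every element with a nonreal conjugate.
\<close>

lemma fixed_iff: "x \<in> K \<Longrightarrow> \<sigma> x = x \<longleftrightarrow> x \<in> F"
proof
  assume x: "x \<in> K" "\<sigma> x = x"
  show "x \<in> F"
  proof (rule ccontr)
    assume nx: "x \<notin> F"
    obtain y where y: "y \<in> K" "\<sigma> y \<noteq> y" by (rule \<sigma>_nontrivial)
    obtain a b where ab: "a \<in> F" "b \<in> F" "y = a + b * x" by (rule basis_1_y[OF x(1) nx y(1)])
    have "a \<in> K" "b \<in> K" using ab F_subset_K by auto
    then have "\<sigma> y = y" using ab x by (simp add: \<sigma>_simps is_subfieldD[OF subfield_K] \<sigma>_F)
    then show False using y by simp
  qed
qed (rule \<sigma>_F)

definition ident :: "'a \<Rightarrow> 'a" where "ident = (\<lambda>x\<in>K. x)"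

lemma ident_simp [simp]: "x \<in> K \<Longrightarrow> ident x = x" by (simp add: ident_def)

lemma ident_ne_\<sigma>: "ident \<noteq> \<sigma>"
  using \<sigma>_nontrivial ident_simp by metis

text \<open>
  If \<open>\<sigma>\<close> moves \<open>y\<close>, then \<open>\<alpha> = y - \<sigma> y\<close> generates \<open>K\<close> over \<open>F\<close> and satisfies \<open>\<sigma> \<alpha> = - \<alpha>\<close>. So \<open>\<alpha>\<^sup>2\<close> is in \<open>F\<close>,
  and an automorphism over \<open>F\<close> can only send \<open>\<alpha>\<close> to \<open>\<alpha>\<close> or \<open>- \<alpha>\<close>.
\<close>

lemma carrier_Gal: "carrier (Gal K F) = {ident, \<sigma>}"
proof (intro equalityI subsetI)
  fix s assume "s \<in> carrier (Gal K F)"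
  then have s: "s \<in> Bij K" "hom_on K s" "\<And>x. x \<in> K \<Longrightarrow> s x \<in> K" "\<And>x. x \<in> F \<Longrightarrow> s x = x"
    by (auto simp: Gal_carrier)
  note h = hom_onD[OF s(2) subfield_K]
  obtain y where y: "y \<in> K" "\<sigma> y \<noteq> y" by (rule \<sigma>_nontrivial)
  define \<alpha> where "\<alpha> = y - \<sigma> y"
  have \<alpha>: "\<alpha> \<in> K" "\<alpha> \<noteq> 0" "\<sigma> \<alpha> = - \<alpha>"
    using y by (auto simp: \<alpha>_def \<sigma>_closed \<sigma>_simps \<sigma>_\<sigma> is_subfieldD[OF subfield_K])
  have nF: "\<alpha> \<notin> F" using \<sigma>_F[of \<alpha>] \<alpha> by auto
  have "\<alpha> * \<alpha> \<in> F" using \<alpha> fixed_iff[of "\<alpha> * \<alpha>"] by (simp add: \<sigma>_simps is_subfieldD[OF subfield_K])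
  then have "s \<alpha> * s \<alpha> = \<alpha> * \<alpha>" using s(4) h(4)[OF \<alpha>(1,1)] by simp
  then have "s \<alpha> = \<alpha> \<or> s \<alpha> = - \<alpha>" by (simp add: square_eq_iff)
  then have "s \<alpha> = ident \<alpha> \<or> s \<alpha> = \<sigma> \<alpha>" using \<alpha> by simp
  moreover have eq: "s = t" if t: "s \<alpha> = t \<alpha>" "t \<in> extensional K" "hom_on K t" "\<And>x. x \<in> F \<Longrightarrow> t x = x" for t
  proof (rule extensionalityI)
    show "s \<in> extensional K" using s(1) by (simp add: Bij_def)
    fix x assume "x \<in> K"
    then obtain a b where ab: "a \<in> F" "b \<in> F" "x = a + b * \<alpha>" by (rule basis_1_y[OF \<alpha>(1) nF])
    then have K: "a \<in> K" "b \<in> K" using F_subset_K by auto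
    then show "s x = t x" using ab t s(4) \<alpha>(1)
      by (simp add: h hom_onD[OF t(3) subfield_K] is_subfieldD[OF subfield_K])
  qed (rule t(2))
  moreover have "ident \<in> extensional K" "hom_on K ident" "\<And>x. x \<in> F \<Longrightarrow> ident x = x"
    using F_subset_K by (auto simp: ident_def hom_on_def is_subfieldD[OF subfield_K])
  moreover have "\<sigma> \<in> extensional K" using \<sigma>_Bij by (simp add: Bij_def)
  ultimately show "s \<in> {ident, \<sigma>}" using \<sigma>_hom \<sigma>_F by blast
next
  fix s assume "s \<in> {ident, \<sigma>}"
  moreover have "ident \<in> carrier (Gal K F)"
    using F_subset_K id_Bij[of K] by (auto simp: Gal_carrier hom_on_def is_subfieldD[OF subfield_K]) (simp add: ident_def)
  ultimately show "s \<in> carrier (Gal K F)" using \<sigma>_Gal by auto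
qed

lemma ident_Bij: "ident \<in> Bij K" unfolding ident_def by (rule id_Bij)

lemma Gal_mult:
  "ident \<otimes>\<^bsub>Gal K F\<^esub> ident = ident" "ident \<otimes>\<^bsub>Gal K F\<^esub> \<sigma> = \<sigma>" "\<sigma> \<otimes>\<^bsub>Gal K F\<^esub> ident = \<sigma>"
  "\<sigma> \<otimes>\<^bsub>Gal K F\<^esub> \<sigma> = ident"
proof -
  have mult: "g \<otimes>\<^bsub>Gal K F\<^esub> h = compose K g h" if "g \<in> Bij K" "h \<in> Bij K" for g h
    using that by (simp add: Gal_def BijGroup_def)
  have ext: "\<sigma> \<in> extensional K" using \<sigma>_Bij by (simp add: Bij_def)
  show "ident \<otimes>\<^bsub>Gal K F\<^esub> ident = ident" "ident \<otimes>\<^bsub>Gal K F\<^esub> \<sigma> = \<sigma>" "\<sigma> \<otimes>\<^bsub>Gal K F\<^esub> ident = \<sigma>"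
    "\<sigma> \<otimes>\<^bsub>Gal K F\<^esub> \<sigma> = ident"
    unfolding mult[OF ident_Bij ident_Bij] mult[OF ident_Bij \<sigma>_Bij] mult[OF \<sigma>_Bij ident_Bij] mult[OF \<sigma>_Bij \<sigma>_Bij]
    using ext by (auto simp: compose_def ident_def \<sigma>_closed \<sigma>_\<sigma> fun_eq_iff extensional_def)
qed

lemma \<sigma>_integers: "x \<in> ring_of_integers K \<Longrightarrow> \<sigma> x \<in> ring_of_integers K"
  using hom_on_algebraic_int[OF \<sigma>_hom subfield_K] \<sigma>_closed by (auto simp: ring_of_integers_def)

lemma \<sigma>_image_mem_iff:
  assumes "P \<subseteq> K" "x \<in> K" shows "\<sigma> x \<in> \<sigma> ` P \<longleftrightarrow> x \<in> P"
  using assms \<sigma>_\<sigma> by (metis (no_types, lifting) image_iff subsetD)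

lemma prime_ideal_subset: "finite_prime_ideal K P \<Longrightarrow> P \<subseteq> K"
  by (auto simp: finite_prime_ideal_def ring_of_integers_def dest: prime_inD(4))

lemma \<sigma>_image_prime:
  assumes P: "finite_prime_ideal K P" shows "finite_prime_ideal K (\<sigma> ` P)"
proof -
  have PK: "P \<subseteq> K" by (rule prime_ideal_subset[OF P])
  have P': "prime_in (ring_of_integers K) P" "P \<noteq> {0}" using P by (auto simp: finite_prime_ideal_def)
  note id = ideal_inD[OF prime_inD(1)[OF P'(1)]]
  have iff: "x \<in> \<sigma> ` P \<longleftrightarrow> \<sigma> x \<in> P" if "x \<in> K" for x
    using \<sigma>_image_mem_iff[OF PK \<sigma>_closed[OF that]] that by (simp add: \<sigma>_\<sigma>)
  have OK: "x \<in> K" if "x \<in> ring_of_integers K" for x using that by (simp add: ring_of_integers_def)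
  have sub: "\<sigma> ` P \<subseteq> ring_of_integers K" using \<sigma>_integers id(1) by auto
  then have subK: "x \<in> K" if "x \<in> \<sigma> ` P" for x using OK that by blast
  note R = is_subringD[OF is_subring_ring_of_integers[OF subfield_K]]
  have "ideal_in (ring_of_integers K) (\<sigma> ` P)" unfolding ideal_in_def
  proof (intro conjI ballI)
    show "0 \<in> \<sigma> ` P" using iff[of 0] id(2) by (simp add: \<sigma>_simps is_subfieldD[OF subfield_K])
  next
    fix x y assume "x \<in> \<sigma> ` P" "y \<in> \<sigma> ` P"
    then have "x \<in> K" "y \<in> K" "\<sigma> x \<in> P" "\<sigma> y \<in> P" using subK iff by blast+
    then show "x + y \<in> \<sigma> ` P" using iff[of "x + y"] id(3) by (simp add: \<sigma>_simps is_subfieldD[OF subfield_K])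
  next
    fix r x assume r: "r \<in> ring_of_integers K" and "x \<in> \<sigma> ` P"
    then have "x \<in> K" "\<sigma> x \<in> P" "r \<in> K" "\<sigma> r \<in> ring_of_integers K" using subK iff OK \<sigma>_integers by blast+
    then show "r * x \<in> \<sigma> ` P" using iff[of "r * x"] id(4) by (simp add: \<sigma>_simps is_subfieldD[OF subfield_K])
  qed (rule sub)
  moreover have "1 \<notin> \<sigma> ` P" using iff[of 1] prime_inD(2)[OF P'(1)] by (simp add: \<sigma>_simps is_subfieldD[OF subfield_K])
  moreover have "a \<in> \<sigma> ` P \<or> b \<in> \<sigma> ` P"
    if "a \<in> ring_of_integers K" "b \<in> ring_of_integers K" "a * b \<in> \<sigma> ` P" for a b
  proof -
    have "a \<in> K" "b \<in> K" "a * b \<in> K" using that OK R(5) by blast+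
    moreover from this have "\<sigma> a * \<sigma> b \<in> P" using that(3) iff[of "a * b"] by (simp add: \<sigma>_simps)
    ultimately show ?thesis using iff prime_inD(5)[OF P'(1) \<sigma>_integers[OF that(1)] \<sigma>_integers[OF that(2)]] by blast
  qed
  moreover have "\<sigma> ` P \<noteq> {0}"
  proof -
    obtain x where "x \<in> P" "x \<noteq> 0" using P'(2) id(2) by blast
    then have "\<sigma> x \<in> \<sigma> ` P" "\<sigma> x \<noteq> 0" using PK \<sigma>_simps(9)[of x] by auto
    then show ?thesis by blast
  qed
  ultimately show ?thesis by (simp add: finite_prime_ideal_def prime_in_def)
qed

lemma \<sigma>_image_inter_F:
  assumes "P \<subseteq> K" shows "\<sigma> ` P \<inter> F = P \<inter> F"
proof (intro equalityI subsetI)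
  fix x assume "x \<in> \<sigma> ` P \<inter> F"
  then obtain y where y: "y \<in> P" "x = \<sigma> y" "x \<in> F" by blast
  then have "\<sigma> x = y" using assms \<sigma>_\<sigma> by auto
  then show "x \<in> P \<inter> F" using y \<sigma>_F[of x] by auto
next
  fix x assume "x \<in> P \<inter> F"
  then show "x \<in> \<sigma> ` P \<inter> F" using \<sigma>_F[of x] by (auto simp: image_iff intro!: bexI[of _ x])
qed

lemma \<sigma>_localized:
  assumes P: "finite_prime_ideal K P" and x: "x \<in> integers_localized_at K P"
  shows "\<sigma> x \<in> integers_localized_at K (\<sigma> ` P)"
proof -
  obtain a b where ab: "x = a / b" "a \<in> ring_of_integers K" "b \<in> ring_of_integers K" "b \<notin> P"
    using x by (rule localizedE)
  then have K: "a \<in> K" "b \<in> K" by (auto simp: ring_of_integers_def)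
  have "\<sigma> x = \<sigma> a / \<sigma> b" using K by (simp add: ab(1) divide_inverse \<sigma>_simps is_subfieldD[OF subfield_K])
  moreover have "\<sigma> b \<notin> \<sigma> ` P" using \<sigma>_image_mem_iff[OF prime_ideal_subset[OF P] K(2)] ab(4) by simp
  ultimately show ?thesis using localizedI \<sigma>_integers ab by metis
qed

text \<open>
  Every conjugate \<open>\<tau> x\<close> has absolute value 1, and \<open>\<tau>\<close> turns \<open>\<sigma>\<close> into complex conjugation.
\<close>

lemma roots_of_unity_norm: "x \<in> roots_of_unity K \<Longrightarrow> x * \<sigma> x = 1"
proof -
  assume "x \<in> roots_of_unity K"
  then obtain n where n: "x \<in> K" "n > 0" "x ^ n = 1" by (auto simp: roots_of_unity_def)
  obtain \<tau> where \<tau>: "\<tau> \<in> embeddings K" by (rule embedding_exists)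
  note h = hom_onD[OF embeddings_hom_on[OF \<tau>] subfield_K]
  have "\<tau> x ^ n = 1" using h(8)[OF n(1), of n] n(3) h(1) by simp
  then have "norm (\<tau> x) ^ n = 1" by (metis norm_one norm_power)
  then have "norm (\<tau> x) = 1" using n(2) power_eq_imp_eq_base[of "norm (\<tau> x)" n 1] by simp
  then have "\<tau> x * cnj (\<tau> x) = 1" by (simp add: complex_norm_square[symmetric])
  then have "\<tau> (x * \<sigma> x) = \<tau> 1" using n(1) by (simp add: h \<sigma>_closed embedding_\<sigma>[OF \<tau>])
  then show ?thesis using embedding_eq_iff[OF \<tau>] n(1) \<sigma>_closed by (simp add: is_subfieldD[OF subfield_K])
qed

end

section \<open>S-units of a CM field\<close>

locale CM_S_units = CM_conjugation +
  fixes S_F :: "'a prime_of_field set"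
  assumes finite_S_F: "finite S_F" and S_F_primes: "S_F \<subseteq> primes_of_field F"
    and infinite_S_F: "infinite_primes F \<subseteq> S_F"
    and card_eq: "card S_F = card (primes_above K F S_F)"
begin

abbreviation "S_K \<equiv> primes_above K F S_F"
abbreviation "U_K \<equiv> S_units K S_K"
abbreviation "U_F \<equiv> S_units F S_F"
abbreviation "W \<equiv> roots_of_unity K"

lemma prime_of_K_over:
  assumes "p \<in> S_F"
  obtains Q where "Q \<in> S_K" "prime_below F Q = p"
proof -
  have "p \<in> primes_of_field F" using assms S_F_primes by blast
  then consider P where "p = Finite_Prime P" "finite_prime_ideal F P"
    | \<tau> where "\<tau> \<in> embeddings F" "p = Infinite_Prime {\<tau>, \<lambda>x\<in>F. cnj (\<tau> x)}"
    unfolding primes_of_field_def infinite_primes_def finite_primes_def finite_prime_ideal_def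
    using primeideal_ring_on_iff[OF is_subring_ring_of_integers[OF subfield_F]] by blast
  then show thesis
  proof cases
    case 1
    then have P: "prime_in (ring_of_integers F) P" "P \<noteq> {0}" by (auto simp: finite_prime_ideal_def)
    obtain Q where Q: "prime_in (ring_of_integers K) Q" "Q \<inter> F = P"
      by (rule lying_over_quadratic[OF subfield_K subfield_F F_subset_K \<sigma>_hom \<sigma>_closed \<sigma>_\<sigma> fixed_iff P(1)])
    have "Q \<noteq> {0}"
    proof
      assume "Q = {0}"
      then have "P = {0}" using Q(2) is_subfieldD(1)[OF subfield_F] by auto
      then show False using P(2) by simp
    qed
    then have "Finite_Prime Q \<in> finite_primes K"
      using Q(1) Finite_Prime_in_finite_primes_iff[OF subfield_K] by (simp add: finite_prime_ideal_def)
    moreover have "prime_below F (Finite_Prime Q) = p" using Q(2) 1 by simp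
    ultimately show thesis using assms
      by (intro that[of "Finite_Prime Q"]) (auto simp: primes_above_def primes_of_field_def)
  next
    case 2
    obtain \<tau>' where \<tau>': "\<tau>' \<in> embeddings K" "\<And>y. y \<in> F \<Longrightarrow> \<tau>' y = \<tau> y"
      using extend_hom[OF number_field_K subfield_F F_subset_K embeddings_hom_on[OF 2(1)]] by metis
    have ext: "\<tau> \<in> extensional F" using 2(1) by (simp add: embeddings_def)
    have "restrict \<tau>' F = \<tau>" using \<tau>'(2) ext by (auto simp: fun_eq_iff extensional_def)
    moreover have "restrict (\<lambda>x\<in>K. cnj (\<tau>' x)) F = (\<lambda>x\<in>F. cnj (\<tau> x))"
      using \<tau>'(2) F_subset_K by (auto simp: fun_eq_iff)
    ultimately have below: "prime_below F (Infinite_Prime {\<tau>', \<lambda>x\<in>K. cnj (\<tau>' x)}) = p" using 2(2) by simp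
    moreover have "Infinite_Prime {\<tau>', \<lambda>x\<in>K. cnj (\<tau>' x)} \<in> infinite_primes K"
      using \<tau>'(1) unfolding infinite_primes_def by blast
    ultimately show thesis using assms
      by (intro that[of "Infinite_Prime {\<tau>', \<lambda>x\<in>K. cnj (\<tau>' x)}"]) (auto simp: primes_above_def primes_of_field_def)
  qed
qed

lemma S_F_nonempty: "S_F \<noteq> {}"
proof -
  obtain \<tau> where "\<tau> \<in> embeddings F" using embeddings_nonempty[OF number_field_F] by blast
  then have "Infinite_Prime {\<tau>, \<lambda>x\<in>F. cnj (\<tau> x)} \<in> S_F"
    using infinite_S_F unfolding infinite_primes_def by blast
  then show ?thesis by blast
qed

text \<open>
  Restriction of primes maps \<open>S\<^sub>K\<close> onto \<open>S\<^sub>F\<close>, and a surjection between finite sets of equal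
  cardinality is injective. The set \<open>S\<^sub>K\<close> is finite because its cardinality, that of the nonempty
  finite set \<open>S\<^sub>F\<close>, is not 0.
\<close>

lemma inj_prime_below: "inj_on (prime_below F) S_K"
proof -
  have img: "prime_below F ` S_K = S_F"
    using prime_of_K_over by (auto simp: primes_above_def image_iff)
  have "finite S_K" using card_eq finite_S_F S_F_nonempty by (metis card_gt_0_iff)
  then show ?thesis by (rule eq_card_imp_inj_on) (simp add: img card_eq)
qed

text \<open>
  The primes \<open>Q\<close> and \<open>\<sigma> ` Q\<close> lie over the same prime of \<open>F\<close>.
\<close>

lemma \<sigma>_image_S_K:
  assumes "finite_prime_ideal K Q" "Finite_Prime Q \<in> S_K"
  shows "\<sigma> ` Q = Q"
proof -
  have below: "prime_below F (Finite_Prime (\<sigma> ` Q)) = prime_below F (Finite_Prime Q)"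
    using \<sigma>_image_inter_F[OF prime_ideal_subset[OF assms(1)]] by simp
  have "Finite_Prime (\<sigma> ` Q) \<in> S_K"
    using assms \<sigma>_image_prime[OF assms(1)] below Finite_Prime_in_finite_primes_iff[OF subfield_K]
    by (simp add: primes_above_def primes_of_field_def)
  then show ?thesis using inj_onD[OF inj_prime_below below _ assms(2)] by simp
qed

lemma Finite_Prime_S_K_iff:
  "finite_prime_ideal K Q \<Longrightarrow> Finite_Prime Q \<in> S_K \<longleftrightarrow> Finite_Prime (Q \<inter> F) \<in> S_F"
  by (auto simp: primes_above_def primes_of_field_def Finite_Prime_in_finite_primes_iff[OF subfield_K])

lemma \<sigma>_local_units:
  assumes P: "finite_prime_ideal K P" and x: "x \<in> local_units K P"
  shows "\<sigma> x \<in> local_units K (\<sigma> ` P)"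
proof -
  have P': "prime_in (ring_of_integers K) P" "prime_in (ring_of_integers K) (\<sigma> ` P)"
    using P \<sigma>_image_prime[OF P] by (auto simp: finite_prime_ideal_def)
  have x': "x \<noteq> 0" "x \<in> integers_localized_at K P" "inverse x \<in> integers_localized_at K P"
    using x local_units_iff[OF subfield_K P'(1)] by auto
  then have K: "x \<in> K" using localized_subset[OF subfield_K] by blast
  show ?thesis unfolding local_units_iff[OF subfield_K P'(2)]
    using \<sigma>_localized[OF P x'(2)] \<sigma>_localized[OF P x'(3)] K x'(1) \<sigma>_simps(9)[OF K] by (simp add: \<sigma>_simps(7))
qed

lemma U_K_K: "x \<in> U_K \<Longrightarrow> x \<in> K" and U_K_nonzero: "x \<in> U_K \<Longrightarrow> x \<noteq> 0"
  by (auto simp: S_units_iff[OF subfield_K])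

lemma U_F_F: "x \<in> U_F \<Longrightarrow> x \<in> F"
  by (auto simp: S_units_iff[OF subfield_F])

lemma \<sigma>_U_K: assumes x: "x \<in> U_K" shows "\<sigma> x \<in> U_K"
proof -
  note xK = U_K_K[OF x]
  have "\<sigma> x \<in> local_units K Q" if Q: "finite_prime_ideal K Q" "Finite_Prime Q \<notin> S_K" for Q
  proof -
    note Q' = \<sigma>_image_prime[OF Q(1)] and QK = prime_ideal_subset[OF Q(1)]
    have "Finite_Prime (\<sigma> ` Q) \<notin> S_K"
      using Q Finite_Prime_S_K_iff Q' \<sigma>_image_inter_F[OF QK] by metis
    then have "x \<in> local_units K (\<sigma> ` Q)" using x Q' S_units_iff[OF subfield_K] by blast
    then have "\<sigma> x \<in> local_units K (\<sigma> ` \<sigma> ` Q)" by (rule \<sigma>_local_units[OF Q'])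
    moreover have "\<sigma> ` \<sigma> ` Q = Q" using QK \<sigma>_\<sigma> by (force simp: image_iff)
    ultimately show ?thesis by simp
  qed
  then show ?thesis using xK U_K_nonzero[OF x] \<sigma>_closed \<sigma>_simps(9) by (simp add: S_units_iff[OF subfield_K])
qed

lemma mult_subgroup_U_K: "mult_subgroup U_K" and mult_subgroup_U_F: "mult_subgroup U_F"
  and mult_subgroup_W: "mult_subgroup W"
  using mult_subgroup_S_units[OF subfield_K] mult_subgroup_S_units[OF subfield_F] mult_subgroup_roots_of_unity[OF subfield_K] by auto

lemma W_U_K: "W \<subseteq> U_K" by (rule roots_of_unity_subset_S_units[OF subfield_K])

text \<open>
  If \<open>y \<in> F\<close> is not integral at \<open>P\<close>, its inverse is \<open>a / b\<close> with \<open>a \<in> P\<close> and \<open>b \<notin> P\<close>, and the same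
  fraction shows that \<open>y\<close> is not integral at a prime \<open>Q\<close> over \<open>P\<close>. Conversely, units at \<open>Q \<inter> F\<close> are
  units at \<open>Q\<close>.
\<close>

lemma U_K_inter_F: "U_K \<inter> F = U_F"
proof (intro equalityI subsetI)
  fix x assume x: "x \<in> U_K \<inter> F"
  have loc: "y \<in> integers_localized_at F P"
    if y: "y \<in> U_K" "y \<in> F" and P: "finite_prime_ideal F P" "Finite_Prime P \<notin> S_F" for y P
  proof (rule ccontr)
    assume ny: "y \<notin> integers_localized_at F P"
    have P': "prime_in (ring_of_integers F) P" "P \<noteq> {0}" using P by (auto simp: finite_prime_ideal_def)
    obtain Q where Q: "prime_in (ring_of_integers K) Q" "Q \<inter> F = P"
      by (rule lying_over_quadratic[OF subfield_K subfield_F F_subset_K \<sigma>_hom \<sigma>_closed \<sigma>_\<sigma> fixed_iff P'(1)])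
    then have Q0: "finite_prime_ideal K Q"
      using P'(2) is_subfieldD(1)[OF subfield_F] by (auto simp: finite_prime_ideal_def)
    then have "Finite_Prime Q \<notin> S_K" using P(2) Q(2) Finite_Prime_S_K_iff by simp
    then have "y \<in> local_units K Q" using y(1) Q0 S_units_iff[OF subfield_K] by blast
    then have "y \<in> integers_localized_at K Q" using local_units_iff[OF subfield_K Q(1)] by blast
    then obtain c d where cd: "y = c / d" "c \<in> ring_of_integers K" "d \<in> ring_of_integers K" "d \<notin> Q"
      by (rule localizedE)
    have "inverse y \<in> integers_localized_at F P" "inverse y \<notin> local_units F P"
      using nonunit_inverse_localized[OF number_field_F P'(1) y(2) ny] by auto
    then obtain a b where ab: "inverse y = a / b" "a \<in> ring_of_integers F" "b \<in> ring_of_integers F" "b \<notin> P" "a \<in> P"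
      using local_unitsI by (metis localizedE)
    have OFK: "z \<in> ring_of_integers K" if "z \<in> ring_of_integers F" for z
      using that F_subset_K by (auto simp: ring_of_integers_def)
    have bQ: "b \<notin> Q" using ab Q(2) by (auto simp: ring_of_integers_def)
    have aQ: "a \<in> Q" using ab Q(2) by auto
    have "b \<noteq> 0" "d \<noteq> 0" using bQ cd prime_inD(3)[OF Q(1)] by auto
    moreover have "y \<noteq> 0" using U_K_nonzero y(1) by blast
    ultimately have "b * d = c * a" using ab(1) cd(1) by (auto simp: field_simps)
    also have "c * a \<in> Q" using ideal_inD(4)[OF prime_inD(1)[OF Q(1)] cd(2) aQ] .
    finally show False using prime_inD(5)[OF Q(1) OFK[OF ab(3)] cd(3)] bQ cd(4) by blast
  qed
  have inv: "inverse x \<in> U_K" "inverse x \<in> F" using x mult_subgroupD(4)[OF mult_subgroup_U_K] is_subfieldD(6)[OF subfield_F] by auto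
  have "x \<in> local_units F P" if P: "finite_prime_ideal F P" "Finite_Prime P \<notin> S_F" for P
  proof -
    have P': "prime_in (ring_of_integers F) P" using P by (auto simp: finite_prime_ideal_def)
    show ?thesis unfolding local_units_iff[OF subfield_F P']
      using loc[OF _ _ P] x inv U_K_nonzero by auto
  qed
  then show "x \<in> U_F" using x U_K_nonzero by (auto simp: S_units_iff[OF subfield_F])
next
  fix x assume x: "x \<in> U_F"
  have xF: "x \<in> F" "x \<noteq> 0" using x by (auto simp: S_units_iff[OF subfield_F])
  have "x \<in> local_units K Q" if Q: "finite_prime_ideal K Q" "Finite_Prime Q \<notin> S_K" for Q
  proof -
    have Q': "prime_in (ring_of_integers K) Q" using Q by (auto simp: finite_prime_ideal_def)
    note id = ideal_inD[OF prime_inD(1)[OF Q']]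
    have OFK: "z \<in> ring_of_integers K" if "z \<in> ring_of_integers F" for z
      using that F_subset_K by (auto simp: ring_of_integers_def)
    have OF: "z \<in> F" if "z \<in> ring_of_integers F" for z using that by (simp add: ring_of_integers_def)
    have R: "z \<in> ring_of_integers F" if "z \<in> Q" "z \<in> F" for z
      using that id(1) by (auto simp: ring_of_integers_def)
    note rF = is_subringD[OF is_subring_ring_of_integers[OF subfield_F]]
    have "prime_in (ring_of_integers F) (Q \<inter> F)" unfolding prime_in_def ideal_in_def
    proof (intro conjI ballI impI)
      show "Q \<inter> F \<subseteq> ring_of_integers F" using R by blast
      show "0 \<in> Q \<inter> F" using id(2) is_subfieldD(1)[OF subfield_F] by simp
      show "1 \<notin> Q \<inter> F" using prime_inD(2)[OF Q'] by simp
      show "u + v \<in> Q \<inter> F" if "u \<in> Q \<inter> F" "v \<in> Q \<inter> F" for u v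
        using that id(3) is_subfieldD(3)[OF subfield_F] by simp
      show "u * v \<in> Q \<inter> F" if "u \<in> ring_of_integers F" "v \<in> Q \<inter> F" for u v
        using that id(4) OFK OF is_subfieldD(4)[OF subfield_F] by simp
      show "u \<in> Q \<inter> F \<or> v \<in> Q \<inter> F"
        if "u \<in> ring_of_integers F" "v \<in> ring_of_integers F" "u * v \<in> Q \<inter> F" for u v
        using that prime_inD(5)[OF Q' OFK OFK] OF by blast
    qed
    note prime = this
    obtain p :: int where p: "\<And>k. of_int k \<in> Q \<longleftrightarrow> p dvd k" "p > 1"
      using prime_number_of_prime_ideal[OF subfield_K Q(1)] by blast
    have "of_int p \<in> Q \<inter> F" using p(1)[of p] is_subfield_of_int[OF subfield_F] by simp
    moreover have "(of_int p :: 'a) \<noteq> 0" using p(2) by simp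
    ultimately have "Q \<inter> F \<noteq> {0}" by blast
    with prime have "finite_prime_ideal F (Q \<inter> F)" by (simp add: finite_prime_ideal_def)
    moreover have "Finite_Prime (Q \<inter> F) \<notin> S_F" using Q Finite_Prime_S_K_iff by blast
    ultimately have "x \<in> local_units F (Q \<inter> F)" using x S_units_iff[OF subfield_F] by blast
    then obtain a b where ab: "x = a / b" "a \<in> ring_of_integers F" "a \<notin> Q \<inter> F" "b \<in> ring_of_integers F" "b \<notin> Q \<inter> F"
      by (rule local_unitsE)
    then have "a \<notin> Q" "b \<notin> Q" using OF by auto
    then show ?thesis unfolding ab(1) by (intro local_unitsI OFK ab)
  qed
  then show "x \<in> U_K \<inter> F" using xF F_subset_K by (auto simp: S_units_iff[OF subfield_K])
qed

lemma U_F_U_K: "U_F \<subseteq> U_K" using U_K_inter_F by blast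

abbreviation norm_K where "norm_K x \<equiv> x * \<sigma> x"

lemma norm_U_F: "x \<in> U_K \<Longrightarrow> norm_K x \<in> U_F"
proof -
  assume x: "x \<in> U_K"
  note K = U_K_K[OF x]
  have "\<sigma> (norm_K x) = norm_K x" using K by (simp add: \<sigma>_simps \<sigma>_closed \<sigma>_\<sigma>)
  then have "norm_K x \<in> F" using fixed_iff K \<sigma>_closed is_subfieldD(4)[OF subfield_K] by blast
  moreover have "norm_K x \<in> U_K" by (rule mult_subgroupD(3)[OF mult_subgroup_U_K x \<sigma>_U_K[OF x]])
  ultimately show ?thesis using U_K_inter_F by blast
qed

text \<open>
  Put \<open>y = \<sigma> x / x\<close>, so that \<open>\<sigma> y\<close> is the inverse of \<open>y\<close>. A finite prime \<open>Q\<close> in \<open>S\<^sub>K\<close> is fixed by \<open>\<sigma>\<close>, so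
  if the inverse of \<open>y\<close> is integral at \<open>Q\<close>, then so is \<open>y\<close>; as the localisation is a valuation ring,
  \<open>y\<close> is integral in any case. At the other primes \<open>y\<close> is a unit. Hence \<open>y\<close> is an algebraic integer,
  and its conjugates have absolute value 1.
\<close>

lemma quotient_by_conjugate_root_of_unity:
  assumes x: "x \<in> U_K" shows "\<sigma> x / x \<in> W"
proof (rule root_of_unity_of_norm_1[OF number_field_K])
  note K = U_K_K[OF x] and x0 = U_K_nonzero[OF x]
  define y where "y = \<sigma> x / x"
  have yK: "y \<in> K" using K \<sigma>_closed by (simp add: y_def is_subfieldD[OF subfield_K])
  have yU: "y \<in> U_K" unfolding y_def by (rule mult_subgroupD(5)[OF mult_subgroup_U_K \<sigma>_U_K[OF x] x])
  have \<sigma>y: "\<sigma> y = inverse y"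
    using K x0 by (simp add: y_def divide_inverse \<sigma>_simps \<sigma>_closed \<sigma>_\<sigma> is_subfieldD[OF subfield_K])
  show "\<sigma> x / x \<in> K" using yK by (simp add: y_def)
  have "algebraic_int y"
  proof (rule algebraic_int_of_localized[OF number_field_K yK])
    fix Q assume Q: "finite_prime_ideal K Q"
    then have Q': "prime_in (ring_of_integers K) Q" by (simp add: finite_prime_ideal_def)
    show "y \<in> integers_localized_at K Q"
    proof (cases "Finite_Prime Q \<in> S_K")
      case True
      have "y \<in> integers_localized_at K Q" if "inverse y \<in> integers_localized_at K Q"
        using \<sigma>_localized[OF Q that] \<sigma>_image_S_K[OF Q True] \<sigma>y \<sigma>_\<sigma>[OF yK] by simp
      then show ?thesis using localized_valuation[OF number_field_K Q' yK] by blast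
    next
      case False
      then have "y \<in> local_units K Q" using yU Q S_units_iff[OF subfield_K] by blast
      then show ?thesis using local_units_iff[OF subfield_K Q'] by blast
    qed
  qed
  then show "algebraic_int (\<sigma> x / x)" by (simp add: y_def)
  fix \<tau> assume \<tau>: "\<tau> \<in> embeddings K"
  note h = hom_onD[OF embeddings_hom_on[OF \<tau>] subfield_K]
  have "\<tau> (\<sigma> x / x) = cnj (\<tau> x) / \<tau> x"
    using K \<sigma>_closed by (simp add: divide_inverse h is_subfieldD[OF subfield_K] embedding_\<sigma>[OF \<tau>])
  moreover have "\<tau> x \<noteq> 0" using h(9)[OF K] x0 by simp
  ultimately show "norm (\<tau> (\<sigma> x / x)) = 1" by (simp add: norm_divide)
qed

text \<open>
  If \<open>\<sigma> x\<close> is the inverse of \<open>x\<close>, the root of unity \<open>\<sigma> x / x\<close> is the inverse of \<open>x\<^sup>2\<close>.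
\<close>

lemma norm_one_iff: "x \<in> U_K \<Longrightarrow> norm_K x = 1 \<longleftrightarrow> x \<in> W"
proof
  assume x: "x \<in> U_K" "norm_K x = 1"
  then have "\<sigma> x = inverse x" by (simp add: inverse_unique)
  then have "\<sigma> x / x = inverse (x * x)" using U_K_nonzero[OF x(1)] by (simp add: divide_inverse)
  then have "inverse (x * x) \<in> W" using quotient_by_conjugate_root_of_unity[OF x(1)] by simp
  then obtain n where n: "n > 0" "inverse (x * x) ^ n = 1" by (auto simp: roots_of_unity_def)
  then have "inverse (x ^ (2 * n)) = 1"
    by (simp only: power_inverse power_mult power2_eq_square)
  then have "x ^ (2 * n) = 1" by simp
  then show "x \<in> W" using U_K_K[OF x(1)] n(1) by (auto simp: roots_of_unity_def intro!: exI[of _ "2 * n"])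
qed (rule roots_of_unity_norm)

abbreviation "sq \<equiv> (\<lambda>x::'a. x\<^sup>2)"
abbreviation "quot \<equiv> (\<lambda>x. \<sigma> x / x)"
abbreviation "U_F_W \<equiv> U_F <#>\<^bsub>mult_group_on U_K\<^esub> W"

lemma UFW_iff: "x \<in> U_F_W \<longleftrightarrow> (\<exists>u\<in>U_F. \<exists>w\<in>W. x = u * w)"
  by (auto simp: set_mult_def)

lemma norm_hom: "x \<in> U_K \<Longrightarrow> y \<in> U_K \<Longrightarrow> norm_K (x * y) = norm_K x * norm_K y"
  by (simp add: \<sigma>_simps U_K_K mult_ac)

lemma quot_hom: "x \<in> U_K \<Longrightarrow> y \<in> U_K \<Longrightarrow> quot (x * y) = quot x * quot y"
  by (simp add: \<sigma>_simps U_K_K)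

lemma mult_subgroups:
  "mult_subgroup (norm_K ` U_K)" "mult_subgroup (quot ` U_K)" "mult_subgroup (sq ` U_F)" "mult_subgroup (sq ` W)"
proof -
  show "mult_subgroup (norm_K ` U_K)"
    by (rule mult_subgroup_image[OF mult_subgroup_U_K norm_hom]) (simp_all add: \<sigma>_simps)
  show "mult_subgroup (quot ` U_K)"
    by (rule mult_subgroup_image[OF mult_subgroup_U_K quot_hom]) (simp_all add: \<sigma>_simps)
  show "mult_subgroup (sq ` U_F)" "mult_subgroup (sq ` W)"
    by (rule mult_subgroup_image; simp add: mult_subgroup_U_F mult_subgroup_W power_mult_distrib)+
qed

text \<open>
  If \<open>\<sigma> x / x = w\<^sup>2\<close>, then \<open>x * w\<close> is fixed by \<open>\<sigma>\<close>, because \<open>\<sigma> w\<close> is the inverse of \<open>w\<close>.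
\<close>

lemma quot_preimage: "{x \<in> U_K. quot x \<in> sq ` W} = U_F_W"
proof (intro equalityI subsetI)
  fix x assume "x \<in> {x \<in> U_K. quot x \<in> sq ` W}"
  then obtain w where x: "x \<in> U_K" and w: "w \<in> W" "\<sigma> x / x = w\<^sup>2" by auto
  note xK = U_K_K[OF x] and x0 = U_K_nonzero[OF x]
  have wU: "w \<in> U_K" using w W_U_K by blast
  note wK = U_K_K[OF wU] and w0 = U_K_nonzero[OF wU]
  have \<sigma>w: "\<sigma> w * w = 1" using roots_of_unity_norm[OF w(1)] by (simp add: mult.commute)
  have "\<sigma> (x * w) = (w\<^sup>2 * x) * \<sigma> w" using w(2) x0 xK wK by (simp add: \<sigma>_simps field_simps)
  also have "\<dots> = x * w * (\<sigma> w * w)" by (simp add: power2_eq_square mult_ac)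
  finally have "\<sigma> (x * w) = x * w" using \<sigma>w by simp
  then have "x * w \<in> F" using fixed_iff[of "x * w"] xK wK is_subfieldD(4)[OF subfield_K] by simp
  moreover have "x * w \<in> U_K" by (rule mult_subgroupD(3)[OF mult_subgroup_U_K x wU])
  ultimately have "x * w \<in> U_F" using U_K_inter_F by blast
  moreover have "inverse w \<in> W" by (rule mult_subgroupD(4)[OF mult_subgroup_W w(1)])
  moreover have "x = (x * w) * inverse w" using w0 by simp
  ultimately show "x \<in> U_F_W" unfolding UFW_iff by blast
next
  fix x assume "x \<in> U_F_W"
  then obtain u w where uw: "u \<in> U_F" "w \<in> W" "x = u * w" unfolding UFW_iff by blast
  have wU: "w \<in> U_K" "u \<in> U_K" using uw W_U_K U_F_U_K by auto
  then have K: "w \<in> K" "u \<in> K" "w \<noteq> 0" "u \<noteq> 0" using U_K_K U_K_nonzero by auto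
  have "\<sigma> w = inverse w" using roots_of_unity_norm[OF uw(2)] by (simp add: inverse_unique)
  then have "quot x = (inverse w)\<^sup>2"
    using K \<sigma>_F[OF U_F_F[OF uw(1)]] by (simp add: uw(3) \<sigma>_simps power2_eq_square field_simps)
  moreover have "inverse w \<in> W" by (rule mult_subgroupD(4)[OF mult_subgroup_W uw(2)])
  moreover have "x \<in> U_K" unfolding uw(3) by (rule mult_subgroupD(3)[OF mult_subgroup_U_K wU(2,1)])
  ultimately show "x \<in> {x \<in> U_K. quot x \<in> sq ` W}" by blast
qed

text \<open>
  If \<open>N x = u\<^sup>2\<close>, then \<open>x / u\<close> has norm 1, so it is a root of unity.
\<close>

lemma norm_preimage: "{x \<in> U_K. norm_K x \<in> sq ` U_F} = U_F_W"
proof (intro equalityI subsetI)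
  fix x assume "x \<in> {x \<in> U_K. norm_K x \<in> sq ` U_F}"
  then obtain u where x: "x \<in> U_K" and u: "u \<in> U_F" "norm_K x = u\<^sup>2" by auto
  have uU: "u \<in> U_K" using u U_F_U_K by blast
  note K = U_K_K[OF x] U_K_nonzero[OF x] U_K_K[OF uU] U_K_nonzero[OF uU]
  have xu: "x / u \<in> U_K" by (rule mult_subgroupD(5)[OF mult_subgroup_U_K x uU])
  have "\<sigma> (x / u) = \<sigma> x / u"
    using K \<sigma>_F[OF U_F_F[OF u(1)]] by (simp add: divide_inverse \<sigma>_simps is_subfieldD[OF subfield_K])
  then have "norm_K (x / u) = norm_K x / u\<^sup>2" by (simp add: power2_eq_square)
  then have "norm_K (x / u) = 1" using u(2) K by simp
  then have "x / u \<in> W" using norm_one_iff[OF xu] by simp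
  moreover have "x = u * (x / u)" using K by simp
  ultimately show "x \<in> U_F_W" unfolding UFW_iff using u(1) by blast
next
  fix x assume "x \<in> U_F_W"
  then obtain u w where uw: "u \<in> U_F" "w \<in> W" "x = u * w" unfolding UFW_iff by blast
  have U: "w \<in> U_K" "u \<in> U_K" using uw W_U_K U_F_U_K by auto
  have "norm_K x = norm_K u * norm_K w" unfolding uw(3) by (rule norm_hom[OF U(2,1)])
  then have "norm_K x = u\<^sup>2"
    using roots_of_unity_norm[OF uw(2)] \<sigma>_F[OF U_F_F[OF uw(1)]] by (simp add: power2_eq_square)
  moreover have "x \<in> U_K" unfolding uw(3) by (rule mult_subgroupD(3)[OF mult_subgroup_U_K U(2,1)])
  ultimately show "x \<in> {x \<in> U_K. norm_K x \<in> sq ` U_F}" using uw(1) by blast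
qed

lemma index_UFW_quot:
  "subgroup_index (mult_group_on U_K) U_F_W = subgroup_index (mult_group_on (quot ` U_K)) (sq ` W)"
  unfolding quot_preimage[symmetric]
  by (rule subgroup_index_preimage[OF mult_subgroup_U_K mult_subgroups(4) quot_hom]) (simp_all add: \<sigma>_simps)

lemma index_UFW_norm:
  "subgroup_index (mult_group_on U_K) U_F_W = subgroup_index (mult_group_on (norm_K ` U_K)) (sq ` U_F)"
  unfolding norm_preimage[symmetric]
  by (rule subgroup_index_preimage[OF mult_subgroup_U_K mult_subgroups(3) norm_hom]) (simp_all add: \<sigma>_simps)

text \<open>
  Squaring on the finite group \<open>W\<close> has kernel \<open>{1, - 1}\<close>.
\<close>

lemma index_W_squares: "subgroup_index (mult_group_on W) (sq ` W) = 2"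
proof -
  note W = mult_subgroup_W
  have finW: "finite W" by (rule finite_roots_of_unity[OF number_field_K])
  have one: "mult_subgroup ({1} :: 'a set)" by (simp add: mult_subgroup_def)
  have pm: "mult_subgroup ({1, - 1} :: 'a set)" by (simp add: mult_subgroup_def)
  have m1: "- 1 \<in> W" by (auto simp: roots_of_unity_def is_subfieldD[OF subfield_K] intro!: exI[of _ 2])
  have pre: "{x \<in> W. x\<^sup>2 \<in> {1}} = {1, - 1}"
    using m1 mult_subgroupD(1)[OF W] by (auto simp: power2_eq_1_iff)
  have "subgroup_index (mult_group_on W) {1, - 1} = subgroup_index (mult_group_on (sq ` W)) {1}"
    unfolding pre[symmetric] by (rule subgroup_index_preimage[OF W one]) (simp_all add: power_mult_distrib)
  also have "\<dots> = card (sq ` W)" by (rule subgroup_index_trivial[OF mult_subgroups(4)])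
  finally have a: "subgroup_index (mult_group_on W) {1, - 1} = card (sq ` W)" .
  have "card W = subgroup_index (mult_group_on W) {1, - 1} * subgroup_index (mult_group_on {1, - 1 :: 'a}) {1}"
    unfolding subgroup_index_trivial[OF W, symmetric]
    by (rule subgroup_index_tower[OF W pm one]) (use m1 mult_subgroupD(1)[OF W] in auto)
  then have c1: "card W = card (sq ` W) * 2" unfolding a subgroup_index_trivial[OF pm] by simp
  have "card W = subgroup_index (mult_group_on W) (sq ` W) * subgroup_index (mult_group_on (sq ` W)) {1}"
    unfolding subgroup_index_trivial[OF W, symmetric]
    by (rule subgroup_index_tower[OF W mult_subgroups(4) one])
      (use W mult_subgroupD(1)[OF mult_subgroups(4)] in \<open>auto simp: mult_subgroup_power\<close>)
  then have c2: "card W = subgroup_index (mult_group_on W) (sq ` W) * card (sq ` W)"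
    unfolding subgroup_index_trivial[OF mult_subgroups(4)] .
  have "card (sq ` W) > 0" using finW mult_subgroupD(1)[OF W] by (auto simp: card_gt_0_iff)
  then show ?thesis using c1 c2 by simp
qed

text \<open>
  The tower \<open>W \<supseteq> quot ` U_K \<supseteq> W\<^sup>2\<close> has total index 2; \<open>quot\<close> identifies the lower step with \<open>U_K\<close>
  modulo \<open>U_F_W\<close>.
\<close>

lemma index_product_H1:
  "subgroup_index (mult_group_on W) (quot ` U_K) * subgroup_index (mult_group_on U_K) U_F_W = 2"
proof -
  have sub: "quot ` U_K \<subseteq> W" using quotient_by_conjugate_root_of_unity by auto
  have sq: "sq ` W \<subseteq> quot ` U_K"
  proof (rule image_subsetI)
    fix w assume w: "w \<in> W"
    then have "inverse w \<in> W" by (rule mult_subgroupD(4)[OF mult_subgroup_W])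
    have wK: "w \<in> K" "w \<noteq> 0" using w W_U_K U_K_K U_K_nonzero by blast+
    have "\<sigma> w = inverse w" using roots_of_unity_norm[OF w] by (simp add: inverse_unique)
    then have "\<sigma> (inverse w) = w" using wK by (simp add: \<sigma>_simps)
    then have "quot (inverse w) = w\<^sup>2" by (simp add: power2_eq_square divide_inverse)
    moreover have "inverse w \<in> U_K" using \<open>inverse w \<in> W\<close> W_U_K by (rule rev_subsetD)
    ultimately show "w\<^sup>2 \<in> quot ` U_K" by (intro image_eqI[where x = "inverse w"]) simp_all
  qed
  show ?thesis
    using subgroup_index_tower[OF mult_subgroup_W mult_subgroups(2,4) sq sub] index_W_squares index_UFW_quot
    by simp
qed

text \<open>
  Each infinite prime, being the class of an embedding, comes from at most two embeddings.
\<close>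

lemma finite_embeddings_F: "finite (embeddings F)"
proof -
  define f where "f \<tau> = Infinite_Prime {\<tau>, \<lambda>x\<in>F. cnj (\<tau> x)}" for \<tau> :: "'a \<Rightarrow> complex"
  have "finite (f ` embeddings F)"
    by (rule finite_subset[OF _ finite_S_F]) (use infinite_S_F in \<open>auto simp: f_def infinite_primes_def\<close>)
  moreover have "finite {\<tau> \<in> embeddings F. f \<tau> = y}" for y
  proof (cases "\<exists>\<tau>0. f \<tau>0 = y")
    case True
    then obtain \<tau>0 where "f \<tau>0 = y" by blast
    then have "{\<tau> \<in> embeddings F. f \<tau> = y} \<subseteq> {\<tau>0, \<lambda>x\<in>F. cnj (\<tau>0 x)}" by (auto simp: f_def)
    then show ?thesis by (rule finite_subset) simp
  next
    case False
    then have "{\<tau> \<in> embeddings F. f \<tau> = y} = {}" by blast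
    then show ?thesis by (metis finite.emptyI)
  qed
  ultimately have "finite (\<Union>y\<in>f ` embeddings F. {\<tau> \<in> embeddings F. f \<tau> = y})" by blast
  then show ?thesis by (rule finite_subset[rotated]) auto
qed

text \<open>
  In the tower \<open>U_F \<supseteq> N U_K \<supseteq> U_F\<^sup>2\<close> the total index is \<open>2 ^ (r + 1)\<close>, where \<open>r\<close> is the rank of \<open>U_F\<close>.
  The rank of \<open>U_K\<close> is the same: \<open>x\<^sup>2\<close> differs from \<open>N x\<close> by a root of unity, so a power of \<open>x\<close> is in
  \<open>U_F\<close>.
\<close>

lemma index_U_F:
  "subgroup_index (mult_group_on U_F) (norm_K ` U_K) * subgroup_index (mult_group_on U_K) U_F_W =
    2 ^ (abelian_rank (mult_group_on U_K) + 1)"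
proof -
  note F = mult_subgroup_U_F
  obtain E T where E: "E \<subseteq> U_F" "mult_independent E" and T: "finite T" "T \<subseteq> U_F"
      "\<And>a. a \<in> U_F \<Longrightarrow> \<exists>t\<in>T. a / t \<in> mult_span E"
    using S_units_finitely_generated[OF number_field_F finite_embeddings_F finite_S_F] by metis
  have E0: "0 \<notin> E" using E(2) by (simp add: mult_independent_def)
  have rank: "abelian_rank (mult_group_on U_K) = card E"
  proof (rule abelian_rank_eq_card[OF mult_subgroup_U_K _ E(2)])
    show "E \<subseteq> U_K" using E(1) U_F_U_K by blast
    fix x assume x: "x \<in> U_K"
    have "inverse (quot x) \<in> W"
      by (rule mult_subgroupD(4)[OF mult_subgroup_W quotient_by_conjugate_root_of_unity[OF x]])
    then obtain n where n: "n > 0" "inverse (quot x) ^ n = 1" by (auto simp: roots_of_unity_def)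
    have "\<sigma> x \<noteq> 0" using \<sigma>_simps(9)[OF U_K_K[OF x]] U_K_nonzero[OF x] by simp
    then have "x ^ 2 = norm_K x * inverse (quot x)" by (simp add: power2_eq_square)
    then have "x ^ (2 * n) = norm_K x ^ n * inverse (quot x) ^ n"
      unfolding power_mult by (simp only: power_mult_distrib)
    then have xn: "x ^ (2 * n) = norm_K x ^ n" using n(2) by simp
    have "norm_K x ^ n \<in> U_F" by (rule mult_subgroup_power[OF F norm_U_F[OF x]])
    then obtain m where "m > 0" "(norm_K x ^ n) ^ m \<in> mult_span E"
      using power_in_span_of_finite_index[OF E0 F T] by blast
    then show "\<exists>m>0. x ^ m \<in> mult_span E"
      using n(1) by (intro exI[of _ "2 * n * m"]) (simp add: power_mult[of x "2 * n"] xn)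
  qed
  have m1: "- 1 \<in> U_F"
    using is_subfieldD[OF subfield_F] by (intro algebraic_unit_in_S_units[OF subfield_F]) (auto intro: int_imp_algebraic_int)
  have sub: "sq ` U_F \<subseteq> norm_K ` U_K"
  proof (rule image_subsetI)
    fix u assume u: "u \<in> U_F"
    then have "norm_K u = u\<^sup>2" using \<sigma>_F[OF U_F_F[OF u]] by (simp add: power2_eq_square)
    moreover have "u \<in> U_K" using u U_F_U_K by (rule rev_subsetD)
    ultimately show "u\<^sup>2 \<in> norm_K ` U_K" by (intro image_eqI[where x = u]) simp_all
  qed
  have sub2: "norm_K ` U_K \<subseteq> U_F" using norm_U_F by auto
  have "subgroup_index (mult_group_on U_F) (sq ` U_F) = 2 ^ (card E + 1)"
    by (rule subgroup_index_squares[OF F m1 E T])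
  then show ?thesis
    using subgroup_index_tower[OF F mult_subgroups(1,3) sub sub2] index_UFW_norm rank by simp
qed

section \<open>First cohomology of the S-units\<close>

abbreviation "G \<equiv> Gal K F"
abbreviation "Z1 \<equiv> cocycles1 G (mult_group_on U_K) (\<lambda>s x. s x)"
abbreviation "B1 \<equiv> coboundaries1 G (mult_group_on U_K) (\<lambda>s x. s x)"

lemma cocycle_mult:
  assumes f: "f \<in> Z1" and g: "g \<in> carrier G" and h: "h \<in> carrier G"
  shows "f (g \<otimes>\<^bsub>G\<^esub> h) = f g * g (f h)"
proof -
  have "f \<in> carrier G \<rightarrow>\<^sub>E U_K \<and>
      (\<forall>g\<in>carrier G. \<forall>h\<in>carrier G. f (g \<otimes>\<^bsub>G\<^esub> h) = f g * g (f h))"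
    using f unfolding cocycles1_def mem_Collect_eq mult_group_on_simps .
  from bspec[OF bspec[OF conjunct2[OF this] g] h] show ?thesis .
qed

lemma cocycle_value:
  assumes f: "f \<in> Z1" and g: "g \<in> carrier G" shows "f g \<in> U_K"
proof -
  have "f \<in> carrier G \<rightarrow>\<^sub>E U_K"
    using f unfolding cocycles1_def mem_Collect_eq mult_group_on_simps by (rule conjunct1)
  then show ?thesis using g by (rule PiE_mem)
qed

lemma ident_in_Gal: "ident \<in> carrier G" and \<sigma>_in_Gal: "\<sigma> \<in> carrier G"
  by (simp_all add: carrier_Gal)

lemma cocycle_ident:
  assumes f: "f \<in> Z1" shows "f ident = 1"
proof -
  have fi: "f ident \<in> U_K" by (rule cocycle_value[OF f ident_in_Gal])
  have "f (ident \<otimes>\<^bsub>G\<^esub> ident) = f ident * ident (f ident)"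
    by (rule cocycle_mult[OF f ident_in_Gal ident_in_Gal])
  then have "f ident = f ident * f ident" using U_K_K[OF fi] by (simp add: Gal_mult)
  then show ?thesis using U_K_nonzero[OF fi] by simp
qed

lemma cocycle_\<sigma>:
  assumes f: "f \<in> Z1" shows "f \<sigma> \<in> W"
proof -
  have fs: "f \<sigma> \<in> U_K" by (rule cocycle_value[OF f \<sigma>_in_Gal])
  have "f (\<sigma> \<otimes>\<^bsub>G\<^esub> \<sigma>) = f \<sigma> * \<sigma> (f \<sigma>)"
    by (rule cocycle_mult[OF f \<sigma>_in_Gal \<sigma>_in_Gal])
  then have "norm_K (f \<sigma>) = 1" using cocycle_ident[OF f] by (simp add: Gal_mult)
  then show ?thesis using norm_one_iff[OF fs] by simp
qed

text \<open>
  Every cocycle has this form, with \<open>w\<close> its value at \<open>\<sigma>\<close>.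
\<close>

definition cocycle_of :: "'a \<Rightarrow> ('a \<Rightarrow> 'a) \<Rightarrow> 'a" where
  "cocycle_of w = (\<lambda>g\<in>carrier G. if g = \<sigma> then w else 1)"

lemma cocycle_of_simps: "cocycle_of w \<sigma> = w" "cocycle_of w ident = 1"
  using ident_ne_\<sigma> by (auto simp: cocycle_of_def carrier_Gal)

lemma cocycle_of_in: "w \<in> W \<Longrightarrow> cocycle_of w \<in> Z1"
proof -
  assume w: "w \<in> W"
  then have wU: "w \<in> U_K" using W_U_K by blast
  have "cocycle_of w \<in> carrier G \<rightarrow>\<^sub>E U_K"
    using wU mult_subgroupD(1)[OF mult_subgroup_U_K] by (auto simp: cocycle_of_def)
  moreover have "cocycle_of w (g \<otimes>\<^bsub>G\<^esub> h) = cocycle_of w g * g (cocycle_of w h)"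
    if "g \<in> {ident, \<sigma>}" "h \<in> {ident, \<sigma>}" for g h
    using that roots_of_unity_norm[OF w] U_K_K[OF wU]
    by (auto simp: Gal_mult cocycle_of_simps \<sigma>_simps is_subfieldD(2)[OF subfield_K])
  ultimately show ?thesis by (simp add: cocycles1_def carrier_Gal)
qed

lemma cocycle_eqI:
  assumes "f \<in> carrier G \<rightarrow>\<^sub>E U_K" "g \<in> carrier G \<rightarrow>\<^sub>E U_K" "f ident = g ident" "f \<sigma> = g \<sigma>"
  shows "f = g"
  by (rule PiE_ext[OF assms(1,2)]) (use assms(3,4) in \<open>auto simp: carrier_Gal\<close>)

lemma coboundary: "B1 = (\<lambda>a. cocycle_of (quot a)) ` U_K"
proof -
  have "(\<lambda>g\<in>carrier G. g a \<otimes>\<^bsub>mult_group_on U_K\<^esub> inv\<^bsub>mult_group_on U_K\<^esub> a) = cocycle_of (quot a)"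
    if "a \<in> U_K" for a
    using that U_K_K[OF that] U_K_nonzero[OF that] ident_ne_\<sigma>
    by (auto simp: cocycle_of_def carrier_Gal inv_mult_group_on[OF mult_subgroup_U_K that] fun_eq_iff divide_inverse)
  then show ?thesis unfolding coboundaries1_def by (auto intro!: image_cong)
qed

text \<open>
  Evaluation at \<open>\<sigma>\<close> identifies the group of cocycles with \<open>W\<close>, the elements of norm 1, and the
  coboundaries with \<open>quot ` U_K\<close>.
\<close>

lemma order_H1: "order (H1 G (mult_group_on U_K) (\<lambda>s x. s x)) = subgroup_index (mult_group_on W) (quot ` U_K)"
proof -
  let ?Z = "cocycle_group1 G (mult_group_on U_K) (\<lambda>s x. s x)"
  let ?B = "quot ` U_K"
  have BW: "?B \<subseteq> W" using quotient_by_conjugate_root_of_unity by auto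
  have mul: "f \<otimes>\<^bsub>?Z\<^esub> g = cocycle_of (f \<sigma> * g \<sigma>)" if "f \<in> Z1" "g \<in> Z1" for f g
    using cocycle_ident[OF that(1)] cocycle_ident[OF that(2)] ident_ne_\<sigma>
    by (intro ext) (auto simp: cocycle_group1_def cocycle_of_def carrier_Gal)
  have ZE: "f = cocycle_of (f \<sigma>)" if "f \<in> Z1" for f
  proof (rule cocycle_eqI)
    show "f \<in> carrier G \<rightarrow>\<^sub>E U_K" using that by (simp add: cocycles1_def)
    show "cocycle_of (f \<sigma>) \<in> carrier G \<rightarrow>\<^sub>E U_K"
      using cocycle_of_in[OF cocycle_\<sigma>[OF that]] by (simp add: cocycles1_def)
  qed (simp_all add: cocycle_of_simps cocycle_ident[OF that])
  have Z1: "Z1 = cocycle_of ` W"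
    using ZE cocycle_\<sigma> cocycle_of_in by (auto simp: image_iff)
  have inj: "inj cocycle_of" by (rule injI) (metis cocycle_of_simps(1))
  have coset: "B1 #>\<^bsub>?Z\<^esub> cocycle_of w = cocycle_of ` coset_of ?B w" if w: "w \<in> W" for w
  proof -
    have "B1 #>\<^bsub>?Z\<^esub> cocycle_of w = (\<lambda>b. cocycle_of b \<otimes>\<^bsub>?Z\<^esub> cocycle_of w) ` ?B"
      by (auto simp: r_coset_def coboundary)
    also have "\<dots> = (\<lambda>b. cocycle_of (b * w)) ` ?B"
      using BW w cocycle_of_in by (intro image_cong refl) (auto simp: mul cocycle_of_simps subsetD)
    finally show ?thesis by (simp add: coset_of_def image_image)
  qed
  have "carrier (H1 G (mult_group_on U_K) (\<lambda>s x. s x)) = (\<lambda>f. B1 #>\<^bsub>?Z\<^esub> f) ` Z1"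
    by (auto simp: H1_def FactGroup_def RCOSETS_def cocycle_group1_def)
  also have "\<dots> = (\<lambda>w. B1 #>\<^bsub>?Z\<^esub> cocycle_of w) ` W" unfolding Z1 image_image ..
  also have "\<dots> = (\<lambda>w. cocycle_of ` coset_of ?B w) ` W" by (intro image_cong refl coset)
  finally have "order (H1 G (mult_group_on U_K) (\<lambda>s x. s x)) = card ((\<lambda>w. cocycle_of ` coset_of ?B w) ` W)"
    by (simp add: order_def)
  also have "\<dots> = card (coset_of ?B ` W)"
    by (rule card_image_eq_card_image) (simp add: inj_image_eq_iff[OF inj])
  also have "\<dots> = subgroup_index (mult_group_on W) ?B"
    by (rule subgroup_index_eq_card_cosets[symmetric, OF mult_subgroup_W mult_subgroups(2)])
  finally show ?thesis .
qed

end

theorem proposition3p4: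
  fixes K F :: "'a::field_char_0 set"
    and \<sigma> :: "'a \<Rightarrow> 'a"
    and S_F :: "'a prime_of_field set"
  assumes "CM_extension K F"
    and "complex_conjugation K F \<sigma>"
    and "finite S_F"
    and "S_F \<subseteq> primes_of_field F"
    and "infinite_primes F \<subseteq> S_F"
    and "card S_F = card (primes_above K F S_F)"
  shows
    "let S_K = primes_above K F S_F;
         U_K = S_units K S_K;
         U_F = S_units F S_F;
         NU_K = (\<lambda>\<alpha>. \<alpha> * \<sigma> \<alpha>) ` U_K;
         sq_U_F = (\<lambda>u. u ^ 2) ` U_F;
         W_K = roots_of_unity K;
         r = abelian_rank (mult_group_on U_K);
         h = order (H1 (Gal K F) (mult_group_on U_K) (\<lambda>s x. s x));
         index_UW = subgroup_index (mult_group_on U_K) (U_F <#>\<^bsub>mult_group_on U_K\<^esub> W_K);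
         index_N_sq = subgroup_index (mult_group_on NU_K) sq_U_F;
         index_N = subgroup_index (mult_group_on U_F) NU_K
     in real h = 2 / real index_UW \<and>
        2 / real index_UW = 2 / real index_N_sq \<and>
        2 / real index_N_sq = 2 powi (- int r) * real index_N \<and>
        index_UW = index_N_sq \<and> index_N_sq dvd 2 \<and>
        h dvd 2 \<and>
        (index_N = 2 ^ r \<or> index_N = 2 ^ (r + 1))"
proof -
  interpret CM_S_units K F \<sigma> S_F
    by unfold_locales (rule assms)+
  define h where "h = order (H1 (Gal K F) (mult_group_on U_K) (\<lambda>s x. s x))"
  define Q where "Q = subgroup_index (mult_group_on U_K) (U_F <#>\<^bsub>mult_group_on U_K\<^esub> W)"
  define N where "N = subgroup_index (mult_group_on U_F) (norm_K ` U_K)"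
  define r where "r = abelian_rank (mult_group_on U_K)"
  have hQ: "h * Q = 2" using index_product_H1 order_H1 by (simp add: h_def Q_def)
  have NQ: "N * Q = 2 ^ (r + 1)" using index_U_F by (simp add: N_def Q_def r_def)
  have Q': "subgroup_index (mult_group_on (norm_K ` U_K)) (sq ` U_F) = Q"
    using index_UFW_norm by (simp add: Q_def)
  have Q0: "Q > 0" using hQ by (cases Q) auto
  have dvd: "Q dvd 2" "h dvd 2" using hQ by (metis dvd_triv_right, metis dvd_triv_left)
  have h: "real h = 2 / real Q" using hQ Q0 by (simp add: field_simps flip: of_nat_mult)
  have "real (N * Q) = real (2 ^ (r + 1))" using NQ by (rule arg_cong)
  then have "real N * real Q = 2 * 2 ^ r" by simp
  then have N: "2 / real Q = 2 powi (- int r) * real N"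
    using Q0 by (simp add: power_int_minus field_simps)
  have "Q \<le> 2" using dvd(1) by (rule dvd_imp_le) simp
  then have "Q = 1 \<or> Q = 2" using Q0 by linarith
  then have "N = 2 ^ r \<or> N = 2 ^ (r + 1)" using NQ by auto
  then show ?thesis unfolding Let_def using h N dvd Q'
    by (simp add: h_def Q_def N_def r_def)
qed

end
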